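(* Let $n\geq 1$. The symplectic group $Sp(2n,2)$ has a presentation with generators $$\{H_i, P_i, Z_j \mid 1\leq i\leq n,\ 1\leq j\leq n-1\}$$ subject to the following defining relations (that is, the abstract group with this presentation is isomorphic to $Sp(2n,2)$): \begin{itemize} \item (R1) $Z_j^2=H_i^2=P_i^4=1$ for all $1\leq i\leq n$ and $1\leq j\leq n-1$. \item (R2) $(H_iP_i)^3=1$ for all $i$. \item (R3) $(H_iP_iH_iP_i^3)^3=1$ for all $i$. \item (R4) $(H_iP_i^2H_iP_i^2)^2=1$ for all $i$. \item (R5) $H_iH_j=H_jH_i$, $P_iP_j=P_jP_i$, and $Z_iZ_j=Z_jZ_i$ for all $i\neq j$. \item (R6) $Z_jP_i=P_iZ_j$ for all $i,j$. \item (R7) $Z_jH_i=H_iZ_j$ for all $i\notin\{j,j+1\}$. \item (R8) $Z_jH_jP_j^2H_j=H_jP_j^2P_{j+1}^2H_jZ_j$ for all $1\leq j\leq n-1$. \item (R9) $Z_jH_{j+1}P_{j+1}^2H_{j+1}=H_{j+1}P_j^2P_{j+1}^2H_{j+1}Z_j$ for all $1\leq j\leq n-1$. \item (R10) $Z_jH_jZ_j=P_jH_jP_jP_{j+1}Z_jH_jP_j$ for all $1\leq j\leq n-1$. \item (R11) $Z_jH_{j+1}Z_j=P_{j+1}H_{j+1}P_jP_{j+1}Z_jH_{j+1}P_{j+1}$ for all $1\leq j\leq n-1$. \end{itemize} When $n\geq 3$, also \begin{itemize} \item (B1) $Z_jH_jH_{j+1}Z_jH_{j+1}H_{j+2}Z_{j+1}H_{j+1}H_{j+2}Z_jH_jH_{j+1}Z_j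 = Z_{j+1}H_{j+1}H_{j+2}Z_{j+1}H_jH_{j+1}Z_jH_jH_{j+1}Z_{j+1}H_{j+1}H_{j+2}Z_{j+1}$ for all $1\leq j\leq n-2$. \item (B2) $(Z_{j+1}H_jH_{j+1}Z_jH_jH_{j+1}Z_j)^3=1$ for all $1\leq j\leq n-2$. \item (B3) $(Z_jH_{j+1}H_{j+2}Z_{j+1}H_{j+1}H_{j+2}Z_{j+1})^3=1$ for all $1\leq j\leq n-2$. \end{itemize} And, for every $n$, the extra relations \begin{itemize} \item (SP1) $P_i^2=1$ for all $1\leq i\leq n$. \item (SP2) $H_iP_i^3(H_iP_i)^2=1$ for all $1\leq i\leq n$. \item (SP3) $(H_iP_i)^2P_i^2H_iP_i=1$ for all $1\leq i\leq n$. \end{itemize}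
   Context: $Sp(2n,2)$ denotes the group of invertible linear maps of a $2n$-dimensional vector space over the field $\mathbb{F}_2$ preserving a nondegenerate alternating bilinear form. In each relation the indices range over all values for which the symbols are defined ($H_i,P_i$ for $1\leq i\leq n$, $Z_j$ for $1\leq j\leq n-1$). *)

theory Defs
  imports Complex_Main "HOL-Algebra.Group" "HOL-Library.Z2"
begin

section \<open>Groups given by generators and relations\<close>

text \<open>
  A letter \<^term>\<open>(x, True)\<close> stands for the generator \<^term>\<open>x\<close> and
  \<^term>\<open>(x, False)\<close> for its formal inverse. The group with generators \<^term>\<open>X\<close> and
  relations \<^term>\<open>R\<close> (a pair \<^term>\<open>(u, v)\<close> in \<^term>\<open>R\<close> being the relation
  \<open>u = v\<close>) consists of the words over \<open>X\<close> and its formal inverses, modulo the smallest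
  congruence that contains \<^term>\<open>R\<close> and cancels adjacent inverse letters.
\<close>

type_synonym 'g word = "('g \<times> bool) list"

definition words :: "'g set \<Rightarrow> 'g word set" where
  "words X = lists (X \<times> UNIV)"

inductive pres_eq :: "'g set \<Rightarrow> ('g word \<times> 'g word) set \<Rightarrow> 'g word \<Rightarrow> 'g word \<Rightarrow> bool"
  for X R where
  refl: "w \<in> words X \<Longrightarrow> pres_eq X R w w"
| sym: "pres_eq X R u v \<Longrightarrow> pres_eq X R v u"
| trans: "pres_eq X R u v \<Longrightarrow> pres_eq X R v w \<Longrightarrow> pres_eq X R u w"
| append: "pres_eq X R u v \<Longrightarrow> pres_eq X R u' v' \<Longrightarrow> pres_eq X R (u @ u') (v @ v')"
| cancel: "x \<in> X \<Longrightarrow> pres_eq X R [(x, b), (x, \<not> b)] []"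
| relation: "(u, v) \<in> R \<Longrightarrow> pres_eq X R u v"

definition presented_group :: "'g set \<Rightarrow> ('g word \<times> 'g word) set \<Rightarrow> 'g word set monoid" where
  "presented_group X R =
    \<lparr>carrier = words X // {(u, v). pres_eq X R u v},
     monoid.mult = (\<lambda>A B. {w. \<exists>a\<in>A. \<exists>b\<in>B. pres_eq X R (a @ b) w}),
     one = {w. pres_eq X R [] w}\<rparr>"

definition positive :: "'g list \<Rightarrow> 'g word" where
  "positive = map (\<lambda>x. (x, True))"

lemma pres_eq_words:
  assumes "pres_eq X R u v" and "R \<subseteq> words X \<times> words X"
  shows "u \<in> words X \<and> v \<in> words X"
  using assms by (induction) (auto simp: words_def)

lemma equiv_pres_eq:
  assumes "R \<subseteq> words X \<times> words X"
  shows "equiv (words X) {(u, v). pres_eq X R u v}"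
proof (rule equivI)
  show "{(u, v). pres_eq X R u v} \<subseteq> words X \<times> words X"
    using pres_eq_words[OF _ assms] by auto
  show "refl_on (words X) {(u, v). pres_eq X R u v}"
    by (auto simp: refl_on_def intro: pres_eq.refl)
  show "Relation.sym {(u, v). pres_eq X R u v}"
    by (auto simp: sym_def intro: pres_eq.sym)
  show "Relation.trans {(u, v). pres_eq X R u v}"
    by (auto simp: trans_def intro: pres_eq.trans)
qed

lemma presented_group_mult:
  assumes "a \<in> words X" and "b \<in> words X"
  shows "{w. pres_eq X R a w} \<otimes>\<^bsub>presented_group X R\<^esub> {w. pres_eq X R b w}
    = {w. pres_eq X R (a @ b) w}"
proof -
  have "pres_eq X R (a @ b) w \<longleftrightarrow> (\<exists>a' b'. pres_eq X R a a' \<and> pres_eq X R b b' \<and> pres_eq X R (a' @ b') w)"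
    (is "?l \<longleftrightarrow> ?r") for w
  proof
    show "?l \<Longrightarrow> ?r" using pres_eq.refl[OF assms(1)] pres_eq.refl[OF assms(2)] by blast
  next
    assume ?r
    then obtain a' b' where "pres_eq X R a a'" "pres_eq X R b b'" "pres_eq X R (a' @ b') w" by blast
    then show ?l using pres_eq.trans[OF pres_eq.append] by blast
  qed
  then show ?thesis by (simp add: presented_group_def)
qed

lemma pres_eq_inverse:
  "w \<in> words X \<Longrightarrow> pres_eq X R (map (\<lambda>(x, b). (x, \<not> b)) (rev w) @ w) []"
proof (induction w)
  case Nil
  then show ?case by (auto simp: words_def intro: pres_eq.refl)
next
  case (Cons p w)
  obtain x b where p: "p = (x, b)" by force
  let ?i = "map (\<lambda>(x, b). (x, \<not> b)) (rev w)"
  from Cons.prems have x: "x \<in> X" and w: "w \<in> words X" by (auto simp: words_def p)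
  have i: "?i \<in> words X" using w by (auto simp: words_def)
  have "pres_eq X R ([(x, \<not> b), (x, b)] @ w) w"
    using pres_eq.append[OF pres_eq.cancel[OF x, of R "\<not> b"] pres_eq.refl[OF w]] by simp
  then have "pres_eq X R (?i @ ([(x, \<not> b), (x, b)] @ w)) (?i @ w)"
    by (rule pres_eq.append[OF pres_eq.refl[OF i]])
  from pres_eq.trans[OF this Cons.IH[OF w]] show ?case by (simp add: p)
qed

lemma group_presented_group:
  assumes "R \<subseteq> words X \<times> words X"
  shows "group (presented_group X R)"
proof -
  let ?G = "presented_group X R" and ?c = "\<lambda>a. {w. pres_eq X R a w}"
  have car: "A \<in> carrier ?G \<longleftrightarrow> (\<exists>a\<in>words X. A = ?c a)" for A
    by (auto simp: presented_group_def quotient_def)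
  have app: "a @ b \<in> words X" if "a \<in> words X" "b \<in> words X" for a b
    using that by (auto simp: words_def)
  have nil: "[] \<in> words X" by (simp add: words_def)
  have one: "\<one>\<^bsub>?G\<^esub> = ?c []" by (simp add: presented_group_def)
  show ?thesis
  proof (rule groupI)
    fix A B assume "A \<in> carrier ?G" "B \<in> carrier ?G"
    then obtain a b where ab: "a \<in> words X" "A = ?c a" "b \<in> words X" "B = ?c b"
      unfolding car by blast
    then have "A \<otimes>\<^bsub>?G\<^esub> B = ?c (a @ b)" by (simp add: presented_group_mult)
    then show "A \<otimes>\<^bsub>?G\<^esub> B \<in> carrier ?G" unfolding car using app[OF ab(1,3)] by blast
  next
    show "\<one>\<^bsub>?G\<^esub> \<in> carrier ?G" unfolding car one using nil by blast
  next
    fix A B C assume "A \<in> carrier ?G" "B \<in> carrier ?G" "C \<in> carrier ?G"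
    then obtain a b c where "a \<in> words X" "A = ?c a" "b \<in> words X" "B = ?c b"
      "c \<in> words X" "C = ?c c"
      unfolding car by blast
    then show "A \<otimes>\<^bsub>?G\<^esub> B \<otimes>\<^bsub>?G\<^esub> C = A \<otimes>\<^bsub>?G\<^esub> (B \<otimes>\<^bsub>?G\<^esub> C)"
      by (simp add: presented_group_mult app)
  next
    fix A assume "A \<in> carrier ?G"
    then obtain a where "a \<in> words X" "A = ?c a" unfolding car by blast
    then show "\<one>\<^bsub>?G\<^esub> \<otimes>\<^bsub>?G\<^esub> A = A"
      unfolding one using presented_group_mult[OF nil, of a R] by simp
  next
    fix A assume "A \<in> carrier ?G"
    then obtain a where a: "a \<in> words X" "A = ?c a" unfolding car by blast
    let ?i = "map (\<lambda>(x, b). (x, \<not> b)) (rev a)"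
    have i: "?i \<in> words X" using a(1) by (auto simp: words_def)
    have inv: "pres_eq X R (?i @ a) []" by (rule pres_eq_inverse[OF a(1)])
    have "?c (?i @ a) = ?c []"
    proof (rule Collect_cong, rule iffI)
      show "pres_eq X R (?i @ a) w \<Longrightarrow> pres_eq X R [] w" for w
        by (rule pres_eq.trans[OF pres_eq.sym[OF inv]])
      show "pres_eq X R [] w \<Longrightarrow> pres_eq X R (?i @ a) w" for w
        by (rule pres_eq.trans[OF inv])
    qed
    then have "?c ?i \<otimes>\<^bsub>?G\<^esub> A = \<one>\<^bsub>?G\<^esub>"
      using a i by (simp add: presented_group_mult one)
    moreover have "?c ?i \<in> carrier ?G"
      unfolding car by (rule bexI[OF _ i]) (rule HOL.refl)
    ultimately show "\<exists>B\<in>carrier ?G. B \<otimes>\<^bsub>?G\<^esub> A = \<one>\<^bsub>?G\<^esub>"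
      by (rule bexI)
  qed
qed


section \<open>The generators and relations\<close>

datatype gen = gH nat | gP nat | gZ nat

definition sp_gens :: "nat \<Rightarrow> gen set" where
  "sp_gens n = {gH i |i. 1 \<le> i \<and> i \<le> n} \<union> {gP i |i. 1 \<le> i \<and> i \<le> n} \<union> {gZ j |j. 1 \<le> j \<and> j < n}"

definition wpow :: "'a list \<Rightarrow> nat \<Rightarrow> 'a list" where
  "wpow w k = concat (replicate k w)"

text \<open>No formal inverses occur in the relations, so they are pairs of words in the generators.\<close>

inductive_set sp_rels :: "nat \<Rightarrow> (gen list \<times> gen list) set" for n where
  R1_Z: "1 \<le> j \<Longrightarrow> j < n \<Longrightarrow> (wpow [gZ j] 2, []) \<in> sp_rels n"
| R1_H: "1 \<le> i \<Longrightarrow> i \<le> n \<Longrightarrow> (wpow [gH i] 2, []) \<in> sp_rels n"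
| R1_P: "1 \<le> i \<Longrightarrow> i \<le> n \<Longrightarrow> (wpow [gP i] 4, []) \<in> sp_rels n"
| R2: "1 \<le> i \<Longrightarrow> i \<le> n \<Longrightarrow> (wpow [gH i, gP i] 3, []) \<in> sp_rels n"
| R3: "1 \<le> i \<Longrightarrow> i \<le> n \<Longrightarrow> (wpow ([gH i, gP i, gH i] @ wpow [gP i] 3) 3, []) \<in> sp_rels n"
| R4: "1 \<le> i \<Longrightarrow> i \<le> n \<Longrightarrow>
    (wpow ([gH i] @ wpow [gP i] 2 @ [gH i] @ wpow [gP i] 2) 2, []) \<in> sp_rels n"
| R5_H: "1 \<le> i \<Longrightarrow> i \<le> n \<Longrightarrow> 1 \<le> j \<Longrightarrow> j \<le> n \<Longrightarrow> i \<noteq> j \<Longrightarrow>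
    ([gH i, gH j], [gH j, gH i]) \<in> sp_rels n"
| R5_P: "1 \<le> i \<Longrightarrow> i \<le> n \<Longrightarrow> 1 \<le> j \<Longrightarrow> j \<le> n \<Longrightarrow> i \<noteq> j \<Longrightarrow>
    ([gP i, gP j], [gP j, gP i]) \<in> sp_rels n"
| R5_Z: "1 \<le> i \<Longrightarrow> i < n \<Longrightarrow> 1 \<le> j \<Longrightarrow> j < n \<Longrightarrow> i \<noteq> j \<Longrightarrow>
    ([gZ i, gZ j], [gZ j, gZ i]) \<in> sp_rels n"
| R6: "1 \<le> i \<Longrightarrow> i \<le> n \<Longrightarrow> 1 \<le> j \<Longrightarrow> j < n \<Longrightarrow>
    ([gZ j, gP i], [gP i, gZ j]) \<in> sp_rels n"
| R7: "1 \<le> i \<Longrightarrow> i \<le> n \<Longrightarrow> 1 \<le> j \<Longrightarrow> j < n \<Longrightarrow> i \<notin> {j, j + 1} \<Longrightarrow>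
    ([gZ j, gH i], [gH i, gZ j]) \<in> sp_rels n"
| R8: "1 \<le> j \<Longrightarrow> j < n \<Longrightarrow>
    ([gZ j, gH j] @ wpow [gP j] 2 @ [gH j],
     [gH j] @ wpow [gP j] 2 @ wpow [gP (j + 1)] 2 @ [gH j, gZ j]) \<in> sp_rels n"
| R9: "1 \<le> j \<Longrightarrow> j < n \<Longrightarrow>
    ([gZ j, gH (j + 1)] @ wpow [gP (j + 1)] 2 @ [gH (j + 1)],
     [gH (j + 1)] @ wpow [gP j] 2 @ wpow [gP (j + 1)] 2 @ [gH (j + 1), gZ j]) \<in> sp_rels n"
| R10: "1 \<le> j \<Longrightarrow> j < n \<Longrightarrow>
    ([gZ j, gH j, gZ j],
     [gP j, gH j, gP j, gP (j + 1), gZ j, gH j, gP j]) \<in> sp_rels n"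
| R11: "1 \<le> j \<Longrightarrow> j < n \<Longrightarrow>
    ([gZ j, gH (j + 1), gZ j],
     [gP (j + 1), gH (j + 1), gP j, gP (j + 1), gZ j, gH (j + 1), gP (j + 1)]) \<in> sp_rels n"
| B1: "1 \<le> j \<Longrightarrow> j + 2 \<le> n \<Longrightarrow>
    ([gZ j, gH j, gH (j + 1), gZ j, gH (j + 1), gH (j + 2), gZ (j + 1), gH (j + 1), gH (j + 2),
      gZ j, gH j, gH (j + 1), gZ j],
     [gZ (j + 1), gH (j + 1), gH (j + 2), gZ (j + 1), gH j, gH (j + 1), gZ j, gH j, gH (j + 1),
      gZ (j + 1), gH (j + 1), gH (j + 2), gZ (j + 1)]) \<in> sp_rels n"
| B2: "1 \<le> j \<Longrightarrow> j + 2 \<le> n \<Longrightarrow>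
    (wpow [gZ (j + 1), gH j, gH (j + 1), gZ j, gH j, gH (j + 1), gZ j] 3, []) \<in> sp_rels n"
| B3: "1 \<le> j \<Longrightarrow> j + 2 \<le> n \<Longrightarrow>
    (wpow [gZ j, gH (j + 1), gH (j + 2), gZ (j + 1), gH (j + 1), gH (j + 2), gZ (j + 1)] 3, [])
      \<in> sp_rels n"
| SP1: "1 \<le> i \<Longrightarrow> i \<le> n \<Longrightarrow> (wpow [gP i] 2, []) \<in> sp_rels n"
| SP2: "1 \<le> i \<Longrightarrow> i \<le> n \<Longrightarrow>
    ([gH i] @ wpow [gP i] 3 @ wpow [gH i, gP i] 2, []) \<in> sp_rels n"
| SP3: "1 \<le> i \<Longrightarrow> i \<le> n \<Longrightarrow>
    (wpow [gH i, gP i] 2 @ wpow [gP i] 2 @ [gH i, gP i], []) \<in> sp_rels n"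

lemma sp_rels_words:
  "map_prod positive positive ` sp_rels n \<subseteq> words (sp_gens n) \<times> words (sp_gens n)"
proof -
  have "(u, v) \<in> sp_rels n \<Longrightarrow> set u \<subseteq> sp_gens n \<and> set v \<subseteq> sp_gens n" for u v
    by (erule sp_rels.cases) (auto simp: sp_gens_def wpow_def)
  then show ?thesis by (force simp: words_def positive_def)
qed


section \<open>The symplectic group\<close>

text \<open>
  \<^typ>\<open>bit\<close> is the field with two elements. The vector space is all of the type
  \<^typ>\<open>'v\<close>, with scalar multiplication \<open>scale\<close>.
\<close>

definition symplectic_form ::
    "(bit \<Rightarrow> 'v \<Rightarrow> 'v::ab_group_add) \<Rightarrow> ('v \<Rightarrow> 'v \<Rightarrow> bit) \<Rightarrow> bool" where
  "symplectic_form scale \<omega> \<longleftrightarrow>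
    (\<forall>x. Vector_Spaces.linear scale (*) (\<lambda>y. \<omega> x y)) \<and>
    (\<forall>y. Vector_Spaces.linear scale (*) (\<lambda>x. \<omega> x y)) \<and>
    (\<forall>x. \<omega> x x = 0) \<and>
    (\<forall>x. (\<forall>y. \<omega> x y = 0) \<longrightarrow> x = 0)"

definition symplectic_group ::
    "(bit \<Rightarrow> 'v \<Rightarrow> 'v::ab_group_add) \<Rightarrow> ('v \<Rightarrow> 'v \<Rightarrow> bit) \<Rightarrow> ('v \<Rightarrow> 'v) monoid" where
  "symplectic_group scale \<omega> =
    \<lparr>carrier = {f. Vector_Spaces.linear scale scale f \<and> bij f \<and> (\<forall>x y. \<omega> (f x) (f y) = \<omega> x y)},
     monoid.mult = (\<circ>),
     one = id\<rparr>"

end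

theory Submission
  imports Defs
begin

text \<open>
  Choose a symplectic basis \<open>e\<^sub>i, f\<^sub>i\<close> and write \<open>T\<^sub>u\<close> for the transvection
  \<open>x \<mapsto> x + \<omega>(u, x) u\<close>. The generators become
  \<open>P\<^sub>i = T\<close> at \<open>e\<^sub>i\<close>, \<open>H\<^sub>i = T\<close> at \<open>e\<^sub>i + f\<^sub>i\<close>, and \<open>Z\<^sub>j P\<^sub>j P\<^sub>j\<^sub>+\<^sub>1 = T\<close> at
  \<open>e\<^sub>j + e\<^sub>j\<^sub>+\<^sub>1\<close>. Call the three families of involutions \<open>p\<close>, \<open>h\<close>, \<open>q\<close>. As \<open>P\<^sub>i\<^sup>2 = 1\<close>, the relations
  that involve at most two sites say no more than this: two of these involutions commute if the
  form vanishes on their vectors and satisfy the braid relation otherwise. So the presented group is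
  a Coxeter group with further relations on three consecutive sites. The theorem
  follows from two facts, each proved by splitting off hyperbolic planes.

  First, the symplectic group is presented by all its transvections, with the relations
  \<open>t\<^sub>u\<^sup>2 = 1\<close>, \<open>t\<^sub>u t\<^sub>v t\<^sub>u = t\<close> at \<open>T\<^sub>u v\<close>, and the triviality of the product of the seven \<open>t\<^sub>u\<close> for
  \<open>u \<noteq> 0\<close> in a three-dimensional isotropic subspace. Suppose that a word in the \<open>t\<^sub>u\<close> acts
  trivially and that \<open>\<omega>(e, f) = 1\<close>. Since three letters that are not orthogonal to \<open>e\<close> can always be
  reduced to fewer, the word is a word in letters orthogonal to \<open>e\<close>
  (\<open>weq_stabilizer\<close>); such a word is an element of the unipotent radical of the stabiliser of \<open>e\<close>
  times a word in letters orthogonal to \<open>e\<close> and \<open>f\<close> (\<open>weq_unipotent\<close>); the unipotent factor is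
  determined by the image of \<open>f\<close>, and induction handles the rest (\<open>faithful_hyperbolic\<close>).

  Secondly, the presented group contains such a family \<open>t\<close> that extends \<open>p\<close>, \<open>h\<close>, \<open>q\<close>
  (\<open>transv_rep_exists\<close>). It is built one site at a time. If \<open>t\<close> is known on the span \<open>W\<close> of the
  first \<open>k\<close> sites, the conjugates of \<open>Z\<^sub>k\<close> by words in \<open>t\<close> depend only on the image \<open>v\<close> of
  \<open>e\<^sub>k\<close>, because the stabiliser of \<open>e\<^sub>k\<close> is generated by elements that commute with \<open>Z\<^sub>k\<close>; this
  defines controlled gates \<open>Z(v)\<close>, and \<open>t\<close> at \<open>v + e\<^sub>k\<^sub>+\<^sub>1\<close> has to be \<open>t\<^sub>v p\<^sub>k\<^sub>+\<^sub>1 Z(v)\<close>. Transitivity of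
  the groups already constructed reduces all the relations of the new family to a few identities on
  three consecutive sites. There the Coxeter diagram is of affine type \<open>E\<^sub>7\<close>, seven of whose nodes
  generate a symmetric group of degree eight, and whatever does not follow from the Coxeter relations
  is B2 or B3 in disguise (\<open>three_site_relations\<close>).

  The map to the symplectic group is then well defined (\<open>gate_relations\<close>), injective by the two facts
  together (\<open>eval_gate_faithful\<close>), and surjective since the symplectic group is generated by
  transvections.
\<close>

section \<open>Endofunctions as a monoid\<close>

text \<open>
  All groups below are generated by involutions, so no formal inverses are needed and elements of a
  \<^class>\<open>monoid_mult\<close> suffice. Both the symplectic group and, through its regular representation,
  the presented group live inside a monoid of endofunctions; the type makes composition an instance
  of multiplication.
\<close>

typedef 'a endo = "UNIV :: ('a \<Rightarrow> 'a) set" morphisms apply_endo Endo ..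

setup_lifting type_definition_endo

instantiation endo :: (type) monoid_mult
begin
lift_definition one_endo :: "'a endo" is id .
lift_definition times_endo :: "'a endo \<Rightarrow> 'a endo \<Rightarrow> 'a endo" is "(\<circ>)" .
instance by standard (transfer; auto)+
end

lemma apply_endo_simps [simp]:
  "apply_endo 1 = id" "apply_endo (f * g) x = apply_endo f (apply_endo g x)"
  "apply_endo (Endo h) = h"
  by (auto simp: one_endo.rep_eq times_endo.rep_eq Endo_inverse)

lemma endo_eqI: "(\<And>x. apply_endo f x = apply_endo g x) \<Longrightarrow> f = g"
  by (metis apply_endo_inject ext)

lemma bit_add_eq_zeroD: "0 = a + b \<Longrightarrow> a = (b :: bit)"
  by (cases a; cases b) simp_all

lemma involution_cancel_right: "x * y = z \<Longrightarrow> y * y = 1 \<Longrightarrow> x = z * (y :: 'm::monoid_mult)"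
  by (auto simp: mult.assoc)

section \<open>Transvections over the field with two elements\<close>

locale alternating_space =
  fixes \<omega> :: "'v::ab_group_add \<Rightarrow> 'v \<Rightarrow> bit"
  assumes char2: "x + x = (0::'v)"
    and form_add_left: "\<omega> (x + y) z = \<omega> x z + \<omega> y z"
    and form_add_right: "\<omega> x (y + z) = \<omega> x y + \<omega> x z"
    and form_self [simp]: "\<omega> x x = 0"
begin

lemma char2_cancel [simp]: "x + x = (0::'v)" "x + (x + y) = y" "x + (y + x) = y"
proof -
  show "x + x = (0::'v)" by (rule char2)
  show "x + (x + y) = y" for y by (simp add: char2 flip: add.assoc)
  then show "x + (y + x) = y" by (metis add.commute)
qed

lemma add_eq_zero_iff: "x + y = 0 \<longleftrightarrow> x = (y::'v)"
  by (metis char2 add_right_cancel)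

lemma form_zero [simp]: "\<omega> 0 x = 0" "\<omega> x 0 = 0"
  using form_add_left[of 0 0 x] form_add_right[of x 0 0] by (metis add_cancel_right_left add_0)+

lemma form_commute: "\<omega> x y = \<omega> y x"
proof -
  have "0 = \<omega> y x + \<omega> x y"
    using form_self[of "x + y", unfolded form_add_left form_add_right]
    unfolding form_self add_0_left add_0_right by (rule HOL.sym)
  then have "\<omega> y x = \<omega> x y" by (rule bit_add_eq_zeroD)
  then show ?thesis ..
qed

lemmas form_add = form_add_left form_add_right

definition transv :: "'v \<Rightarrow> 'v \<Rightarrow> 'v" where
  "transv u x = (if \<omega> u x = 0 then x else x + u)"

lemma transv_zero [simp]: "transv 0 x = x" "transv u 0 = 0" "transv u u = u"
  by (simp_all add: transv_def)

lemma transv_add: "transv u (x + y) = transv u x + transv u y"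
  by (cases "\<omega> u x"; cases "\<omega> u y") (simp_all add: transv_def form_add add_ac)

lemma transv_transv [simp]: "transv u (transv u x) = x"
  by (simp add: transv_def form_add add_ac)

lemma transv_isometry [simp]: "\<omega> (transv u x) (transv u y) = \<omega> x y"
  using form_commute[of x u] form_commute[of y u]
  by (cases "\<omega> u x"; cases "\<omega> u y") (simp_all add: transv_def form_add)

lemma transv_conj: "transv u (transv v (transv u x)) = transv (transv u v) x"
proof -
  have "\<omega> v (transv u x) = \<omega> (transv u v) x"
    by (metis transv_isometry transv_transv)
  then show ?thesis
    by (simp add: transv_def[of v] transv_def[of "transv u v"] transv_add)
qed

lemma transv_eq_zero_iff [simp]: "transv u x = 0 \<longleftrightarrow> x = 0"
  by (metis transv_transv transv_zero(2))

definition subspace2 :: "'v set \<Rightarrow> bool" where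
  "subspace2 W \<longleftrightarrow> 0 \<in> W \<and> (\<forall>x\<in>W. \<forall>y\<in>W. x + y \<in> W)"

lemma subspace2D: "subspace2 W \<Longrightarrow> 0 \<in> W" "subspace2 W \<Longrightarrow> x \<in> W \<Longrightarrow> y \<in> W \<Longrightarrow> x + y \<in> W"
  by (auto simp: subspace2_def)

lemma transv_closed: "subspace2 W \<Longrightarrow> u \<in> W \<Longrightarrow> x \<in> W \<Longrightarrow> transv u x \<in> W"
  by (simp add: transv_def subspace2D)

text \<open>
  A family that multiplies like the transvections at the vectors of \<open>W\<close>. With \<open>t 0 = 1\<close> the last
  clause holds for degenerate triples as well; for independent ones it says that the product of the
  seven values on the nonzero vectors of the isotropic span of \<open>u, v, w\<close> is trivial. It is written
  with four factors on the left because pairs \<open>t u * t (u + w)\<close> are the elements of the unipotent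
  radical of the stabiliser of \<open>w\<close>.
\<close>

definition transv_rep :: "'v set \<Rightarrow> ('v \<Rightarrow> 'm::monoid_mult) \<Rightarrow> bool" where
  "transv_rep W t \<longleftrightarrow> t 0 = 1 \<and> (\<forall>u\<in>W. t u * t u = 1)
    \<and> (\<forall>u\<in>W. \<forall>v\<in>W. t u * t v * t u = t (transv u v))
    \<and> (\<forall>u\<in>W. \<forall>v\<in>W. \<forall>w\<in>W. \<omega> u v = 0 \<longrightarrow> \<omega> u w = 0 \<longrightarrow> \<omega> v w = 0 \<longrightarrow>
        t u * t (u + w) * t v * t (v + w) = t (u + v) * t (u + v + w) * t w)"

lemma transv_repD:
  assumes "transv_rep W t"
  shows "t 0 = 1" "u \<in> W \<Longrightarrow> t u * t u = 1"
    "u \<in> W \<Longrightarrow> v \<in> W \<Longrightarrow> t u * t v * t u = t (transv u v)"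
    "u \<in> W \<Longrightarrow> v \<in> W \<Longrightarrow> w \<in> W \<Longrightarrow> \<omega> u v = 0 \<Longrightarrow> \<omega> u w = 0 \<Longrightarrow> \<omega> v w = 0 \<Longrightarrow>
        t u * t (u + w) * t v * t (v + w) = t (u + v) * t (u + v + w) * t w"
  using assms unfolding transv_rep_def by blast+

lemma transv_rep_subset: "transv_rep W t \<Longrightarrow> W' \<subseteq> W \<Longrightarrow> transv_rep W' t"
  unfolding transv_rep_def by blast

definition transv_endo :: "'v \<Rightarrow> 'v endo" where
  "transv_endo u = Endo (transv u)"

lemma apply_transv_endo [simp]: "apply_endo (transv_endo u) x = transv u x"
  by (simp add: transv_endo_def)

text \<open>
  For orthogonal \<open>u, v, w\<close> both sides of the last clause add to \<open>x\<close> a combination of \<open>u, v, w\<close>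
  that depends only on the values of the form at \<open>x\<close>; the eight cases agree.
\<close>

lemma transv_rep_endo: "transv_rep W transv_endo"
  unfolding transv_rep_def
proof (intro conjI ballI impI)
  show "transv_endo 0 = 1" "transv_endo u * transv_endo u = 1" for u
    by (auto intro!: endo_eqI)
  show "transv_endo u * transv_endo v * transv_endo u = transv_endo (transv u v)" for u v
    by (auto intro!: endo_eqI simp: transv_conj)
  fix u v w assume "\<omega> u v = 0" "\<omega> u w = 0" "\<omega> v w = 0"
  moreover from this have "\<omega> v u = 0" "\<omega> w u = 0" "\<omega> w v = 0" by (simp_all add: form_commute)
  ultimately show "transv_endo u * transv_endo (u + w) * transv_endo v * transv_endo (v + w)
      = transv_endo (u + v) * transv_endo (u + v + w) * transv_endo w"
    apply (intro endo_eqI)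
    subgoal for x
      by (cases "\<omega> u x"; cases "\<omega> v x"; cases "\<omega> w x") (simp_all add: transv_def form_add add_ac)
    done
qed

definition word :: "('v \<Rightarrow> 'm::monoid_mult) \<Rightarrow> 'v list \<Rightarrow> 'm" where
  "word t us = prod_list (map t us)"

lemma word_simps [simp]:
  "word t [] = 1" "word t (u # us) = t u * word t us" "word t (us @ vs) = word t us * word t vs"
  by (simp_all add: word_def)

abbreviation act :: "'v list \<Rightarrow> 'v \<Rightarrow> 'v" where
  "act us \<equiv> apply_endo (word transv_endo us)"

lemma act_add: "act us (x + y) = act us x + act us y"
  by (induction us) (simp_all add: transv_add)

lemma act_isometry [simp]: "\<omega> (act us x) (act us y) = \<omega> x y"
  by (induction us) simp_all

lemma act_closed: "subspace2 W \<Longrightarrow> set us \<subseteq> W \<Longrightarrow> x \<in> W \<Longrightarrow> act us x \<in> W"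
  by (induction us) (auto simp: transv_closed)

lemma word_rev:
  assumes "transv_rep W t" "set us \<subseteq> W"
  shows "word t us * word t (rev us) = 1" "word t (rev us) * word t us = 1"
proof -
  have A: "word t vs * word t (rev vs) = 1" if "set vs \<subseteq> W" for vs
    using that
  proof (induction vs)
    case (Cons v vs)
    have "word t (v # vs) * word t (rev (v # vs)) = t v * (word t vs * word t (rev vs)) * t v"
      by (simp add: mult.assoc)
    also have "\<dots> = 1" using Cons transv_repD(2)[OF assms(1), of v] by simp
    finally show ?case .
  qed simp
  show "word t us * word t (rev us) = 1" "word t (rev us) * word t us = 1"
    using A[of us] A[of "rev us"] assms(2) by simp_all
qed

lemma act_rev [simp]: "act us (act (rev us) x) = x" "act (rev us) (act us x) = x"
  using word_rev[OF transv_rep_endo[of UNIV], of us]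
  by (simp_all flip: apply_endo_simps(2))

lemma word_conj:
  assumes "subspace2 W" "transv_rep W t" "set us \<subseteq> W" "v \<in> W"
  shows "word t us * t v * word t (rev us) = t (act us v)"
  using assms(3)
proof (induction us)
  case (Cons u us)
  have "word t (u # us) * t v * word t (rev (u # us)) = t u * (word t us * t v * word t (rev us)) * t u"
    by (simp add: mult.assoc)
  also have "\<dots> = t u * t (act us v) * t u" using Cons by simp
  also have "\<dots> = t (act (u # us) v)"
    using transv_repD(3)[OF assms(2), of u "act us v"] act_closed[OF assms(1)] Cons.prems assms(4)
    by simp
  finally show ?case .
qed simp

end

section \<open>Words in transvections are determined by their action\<close>

context alternating_space begin

lemma transv_rep_commute:
  assumes "transv_rep W t" "u \<in> W" "v \<in> W" "\<omega> u v = 0"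
  shows "t u * t v = t v * t u"
proof -
  have "t u * t v * t u = t v"
    using transv_repD(3)[OF assms(1-3)] assms(4) by (simp add: transv_def)
  then show ?thesis by (metis transv_repD(2)[OF assms(1,2)] mult.assoc mult_1_right)
qed

lemma transv_rep_push:
  assumes "transv_rep W t" "u \<in> W" "v \<in> W"
  shows "t u * t v = t (transv u v) * t u"
  by (metis transv_repD(2)[OF assms(1,2)] transv_repD(3)[OF assms(1-3)] mult.assoc mult_1_right)

lemma transv_rep_merge:
  assumes W: "subspace2 W" and t: "transv_rep W t" and "u \<in> W" "v \<in> W" "\<omega> u v = 1"
  shows "t u * t v = t v * t (u + v)"
proof -
  have "t (u + v) = t v * t u * t v"
    using assms transv_repD(3)[OF t, of v u] by (simp add: transv_def form_commute[of v])
  then have "t v * t (u + v) = t v * t v * t u * t v" by (simp add: mult.assoc)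
  then show ?thesis using transv_repD(2)[OF t] assms by simp
qed

lemma transv_rep_isotropic:
  assumes W: "subspace2 W" and t: "transv_rep W t" and in_W: "u \<in> W" "v \<in> W" "w \<in> W"
    and orth: "\<omega> u v = 0" "\<omega> u w = 0" "\<omega> v w = 0"
  shows "t u * t v * t w = t (u + v + w) * t (v + w) * t (u + w) * t (u + v)"
proof -
  note inv = transv_repD(2)[OF t] and sub = subspace2D[OF W]
  have f: "\<omega> v u = 0" "\<omega> w u = 0" "\<omega> w v = 0" using orth by (simp_all add: form_commute)
  let ?x = "u + v + w"
  have comm: "t ?x * t y = t y * t ?x" if "y \<in> {v + w, u + w, u + v}" for y
    by (rule transv_rep_commute[OF t]) (use that in_W sub orth f in \<open>auto simp: form_add\<close>)
  have "t u * t v * t w * t ?x = t (u + w) * t (v + w) * t (u + v)"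
    using transv_repD(4)[OF t, of u w "u + v"] in_W sub orth f by (simp add: form_add add_ac)
  also have "t (u + w) * t (v + w) = t (v + w) * t (u + w)"
    by (rule transv_rep_commute[OF t]) (use in_W sub orth f in \<open>auto simp: form_add\<close>)
  finally have "t u * t v * t w = t (v + w) * t (u + w) * t (u + v) * t ?x"
    by (rule involution_cancel_right) (use in_W sub in \<open>auto simp: inv\<close>)
  also have "\<dots> = t (v + w) * t (u + w) * (t ?x * t (u + v))" by (simp add: comm mult.assoc)
  also have "\<dots> = t (v + w) * (t ?x * t (u + w)) * t (u + v)" by (simp add: comm mult.assoc)
  also have "\<dots> = t ?x * t (v + w) * t (u + w) * t (u + v)"
    using comm[of "v + w"] by (simp flip: mult.assoc)
  finally show ?thesis .
qed

text \<open>
  The counterpart of the isotropic relation for \<open>\<omega> a b = 1\<close>. The span of \<open>a, b, e\<close> has radical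
  spanned by \<open>e\<close>, and \<open>t a, t b, t (a + e)\<close> behave like the transpositions \<open>(1 2), (2 3), (3 4)\<close>;
  the identity is the product rule \<open>(1 2)(3 4) (2 3)(1 4) = (1 3)(2 4)\<close> of the Klein four-group.
\<close>

lemma transv_rep_shift:
  assumes W: "subspace2 W" and t: "transv_rep W t" and in_W: "a \<in> W" "b \<in> W" "e \<in> W"
    and orth: "\<omega> a b = 1" "\<omega> e a = 0" "\<omega> e b = 0"
  shows "t a * t (a + e) * t b * t (b + e) = t (a + b) * t (a + b + e)"
proof -
  note push = transv_rep_push[OF t] and sub = subspace2D[OF W]
  have f: "\<omega> b a = 1" "\<omega> a e = 0" "\<omega> b e = 0" using orth by (simp_all add: form_commute)
  have "t a * t (a + e) * t b * t (b + e) = t a * (t (a + e) * t b) * t (b + e)"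
    by (simp add: mult.assoc)
  also have "t (a + e) * t b = t (a + b + e) * t (a + e)"
    using push[of "a + e" b] in_W sub orth f by (simp add: transv_def form_add add_ac)
  also have "t a * (t (a + b + e) * t (a + e)) * t (b + e) = (t a * t (a + b + e)) * t (a + e) * t (b + e)"
    by (simp add: mult.assoc)
  also have "t a * t (a + b + e) = t (b + e) * t a"
    using push[of a "a + b + e"] in_W sub orth f by (simp add: transv_def form_add add_ac)
  also have "t (b + e) * t a * t (a + e) * t (b + e) = (t (b + e) * t a) * (t (a + e) * t (b + e))"
    by (simp add: mult.assoc)
  also have "t (b + e) * t a = t (a + b + e) * t (b + e)"
    using push[of "b + e" a] in_W sub orth f by (simp add: transv_def form_add add_ac)
  also have "t (a + e) * t (b + e) = t (b + e) * t (a + b)"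
    using transv_rep_merge[OF W t, of "a + e" "b + e"] in_W sub orth f
    by (simp add: form_add add_ac)
  also have "t (a + b + e) * t (b + e) * (t (b + e) * t (a + b)) = t (a + b + e) * (t (b + e) * t (b + e)) * t (a + b)"
    by (simp add: mult.assoc)
  also have "\<dots> = t (a + b) * t (a + b + e)"
    using transv_repD(2)[OF t, of "b + e"] transv_rep_commute[OF t, of "a + b" "a + b + e"] in_W sub orth f
    by (simp add: form_add)
  finally show ?thesis .
qed

text \<open>
  Rewriting of words has to preserve both the value under \<open>t\<close> and the action, so equivalence
  records both. Every rewriting rule is valid for each family of this kind, hence for \<open>t\<close> and for
  the transvections themselves (\<open>weqI\<close>).
\<close>

definition weq :: "('v \<Rightarrow> 'm::monoid_mult) \<Rightarrow> 'v list \<Rightarrow> 'v list \<Rightarrow> bool" where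
  "weq t us vs \<longleftrightarrow> word t us = word t vs \<and> word transv_endo us = word transv_endo vs"

lemma weqD: "weq t us vs \<Longrightarrow> word t us = word t vs" "weq t us vs \<Longrightarrow> act us = act vs"
  by (simp_all add: weq_def)

lemma weq_refl [simp]: "weq t us us"
  by (simp add: weq_def)

lemma weq_trans [trans]: "weq t us vs \<Longrightarrow> weq t vs ws \<Longrightarrow> weq t us ws"
  by (simp add: weq_def)

lemma weq_append: "weq t us us' \<Longrightarrow> weq t vs vs' \<Longrightarrow> weq t (us @ vs) (us' @ vs')"
  by (simp add: weq_def)

lemma weq_Cons: "weq t us us' \<Longrightarrow> weq t (u # us) (u # us')"
  by (simp add: weq_def)

lemma weqI:
  assumes "transv_rep W t" "\<And>s :: 'v \<Rightarrow> 'm. transv_rep W s \<Longrightarrow> word s us = word s vs"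
    "\<And>s :: 'v \<Rightarrow> 'v endo. transv_rep W s \<Longrightarrow> word s us = word s vs"
  shows "weq (t :: 'v \<Rightarrow> 'm::monoid_mult) us vs"
  using assms transv_rep_endo by (simp add: weq_def)

lemma weq_cancel: "transv_rep W t \<Longrightarrow> u \<in> W \<Longrightarrow> weq t (u # u # us) us"
  by (rule weqI) (auto simp: transv_repD(2) simp flip: mult.assoc)

lemma weq_push: "transv_rep W t \<Longrightarrow> u \<in> W \<Longrightarrow> v \<in> W \<Longrightarrow> weq t (u # v # us) (transv u v # u # us)"
  by (rule weqI) (auto simp: transv_rep_push simp flip: mult.assoc)

lemma weq_commute:
  "transv_rep W t \<Longrightarrow> u \<in> W \<Longrightarrow> v \<in> W \<Longrightarrow> \<omega> u v = 0 \<Longrightarrow> weq t (u # v # us) (v # u # us)"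
  using weq_push[of W t u v us] by (simp add: transv_def)

lemma weq_merge: "subspace2 W \<Longrightarrow> transv_rep W t \<Longrightarrow> u \<in> W \<Longrightarrow> v \<in> W \<Longrightarrow> \<omega> u v = 1 \<Longrightarrow>
    weq t (u # v # us) (v # (u + v) # us)"
  by (rule weqI) (auto simp: transv_rep_merge simp flip: mult.assoc)

lemma weq_isotropic: "subspace2 W \<Longrightarrow> transv_rep W t \<Longrightarrow> u \<in> W \<Longrightarrow> v \<in> W \<Longrightarrow> w \<in> W \<Longrightarrow>
    \<omega> u v = 0 \<Longrightarrow> \<omega> u w = 0 \<Longrightarrow> \<omega> v w = 0 \<Longrightarrow>
    weq t (u # v # w # us) ((u + v + w) # (v + w) # (u + w) # (u + v) # us)"
  by (rule weqI) (auto simp: transv_rep_isotropic simp flip: mult.assoc)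

lemma weq_shift: "subspace2 W \<Longrightarrow> transv_rep W t \<Longrightarrow> a \<in> W \<Longrightarrow> b \<in> W \<Longrightarrow> e \<in> W \<Longrightarrow>
    \<omega> a b = 1 \<Longrightarrow> \<omega> e a = 0 \<Longrightarrow> \<omega> e b = 0 \<Longrightarrow>
    weq t (a # (a + e) # b # (b + e) # us) ((a + b) # (a + b + e) # us)"
  by (rule weqI) (auto simp: transv_rep_shift simp flip: mult.assoc)

definition perp :: "'v set \<Rightarrow> 'v \<Rightarrow> 'v set" where
  "perp W e = {x \<in> W. \<omega> e x = 0}"

lemma subspace2_perp: "subspace2 W \<Longrightarrow> subspace2 (perp W e)"
  by (simp add: subspace2_def perp_def form_add)

text \<open>
  The letters not orthogonal to \<open>e\<close>, in reduced form: at most two of them remain, and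
  two only if they are different and commute.
\<close>

definition crossing :: "'v set \<Rightarrow> 'v \<Rightarrow> 'v list \<Rightarrow> bool" where
  "crossing W e pre \<longleftrightarrow> set pre \<subseteq> W \<and> (\<forall>x\<in>set pre. \<omega> e x = 1)
     \<and> (pre = [] \<or> (\<exists>x. pre = [x]) \<or> (\<exists>x y. pre = [x, y] \<and> \<omega> x y = 0 \<and> x \<noteq> y))"

lemma weq_two_crossing:
  assumes W: "subspace2 W" and t: "transv_rep W t" and "x \<in> W" "y \<in> W" "\<omega> e x = 1" "\<omega> e y = 1"
  shows "\<exists>pre vs. crossing W e pre \<and> set vs \<subseteq> perp W e \<and> weq t [x, y] (pre @ vs)"
proof -
  consider "x = y" | "\<omega> x y = 1" | "x \<noteq> y" "\<omega> x y = 0" by (cases "\<omega> x y") auto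
  then show ?thesis
  proof cases
    case 1
    show ?thesis
      by (rule exI[of _ "[]"], rule exI[of _ "[]"])
        (use assms weq_cancel[OF t, of x "[]"] in \<open>simp add: 1 crossing_def\<close>)
  next
    case 2
    show ?thesis
      by (rule exI[of _ "[y]"], rule exI[of _ "[x + y]"])
        (use assms 2 weq_merge[OF W t, of x y "[]"] in \<open>simp add: crossing_def perp_def form_add subspace2D\<close>)
  next
    case 3
    show ?thesis
      by (rule exI[of _ "[x, y]"], rule exI[of _ "[]"])
        (use assms 3 in \<open>simp add: crossing_def\<close>)
  qed
qed

lemma weq_crossing_Cons:
  assumes W: "subspace2 W" and t: "transv_rep W t" and e: "e \<in> W" and u: "u \<in> W"
    and pre: "crossing W e pre"
  shows "\<exists>pre' vs. crossing W e pre' \<and> set vs \<subseteq> perp W e \<and> weq t (u # pre) (pre' @ vs)"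
proof (cases "\<omega> e u = 0")
  case 0: True
  have "weq t (u # xs) (map (transv u) xs @ [u])" if "set xs \<subseteq> W" for xs
    using that
  proof (induction xs)
    case (Cons x xs)
    then have "weq t (u # x # xs) (transv u x # u # xs)" by (intro weq_push[OF t] u) auto
    also have "weq t \<dots> (transv u x # (map (transv u) xs @ [u]))" by (rule weq_Cons) (use Cons in auto)
    finally show ?case by simp
  qed simp
  then have "weq t (u # pre) (map (transv u) pre @ [u])" using pre by (simp add: crossing_def)
  moreover have "crossing W e (map (transv u) pre)"
  proof -
    have "\<omega> e (transv u x) = \<omega> e x" for x using 0 by (simp add: transv_def form_add)
    moreover have "transv u x \<noteq> transv u y" if "x \<noteq> y" for x y by (metis that transv_transv)
    ultimately show ?thesis using pre transv_closed[OF W u] unfolding crossing_def by fastforce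
  qed
  ultimately show ?thesis using u 0
    by (intro exI[of _ "map (transv u) pre"] exI[of _ "[u]"]) (simp add: perp_def)
next
  case False
  then have 1: "\<omega> e u = 1" by simp
  from pre consider "pre = []" | x where "pre = [x]"
    | x y where "pre = [x, y]" "\<omega> x y = 0" "x \<noteq> y"
    unfolding crossing_def by blast
  then show ?thesis
  proof cases
    case 1
    show ?thesis
      by (rule exI[of _ "[u]"], rule exI[of _ "[]"]) (use 1 \<open>\<omega> e u = 1\<close> u in \<open>simp add: crossing_def\<close>)
  next
    case (2 x)
    then show ?thesis using weq_two_crossing[OF W t, of u x e] u 1 pre by (simp add: crossing_def)
  next
    case (3 x y)
    have xy: "x \<in> W" "y \<in> W" "\<omega> e x = 1" "\<omega> e y = 1" using pre 3 by (auto simp: crossing_def)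
    consider "u = x" | "u = y" | "\<omega> u x = 1" | "\<omega> u x = 0" "\<omega> u y = 1"
      | "u \<noteq> x" "u \<noteq> y" "\<omega> u x = 0" "\<omega> u y = 0" by (cases "\<omega> u x"; cases "\<omega> u y") auto
    then show ?thesis
    proof cases
      case 1
      show ?thesis
        by (rule exI[of _ "[y]"], rule exI[of _ "[]"])
          (use 1 3 xy weq_cancel[OF t, of x "[y]"] in \<open>simp add: crossing_def\<close>)
    next
      case 2
      have "weq t [y, x, y] (x # y # [y])" using weq_commute[OF t, of y x "[y]"] xy 3 by (simp add: form_commute)
      also have "weq t \<dots> [x]" using weq_Cons[OF weq_cancel[OF t, of y "[]"]] xy by simp
      finally show ?thesis
        by (intro exI[of _ "[x]"] exI[of _ "[]"]) (use 2 3 xy in \<open>simp add: crossing_def\<close>)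
    next
      case a: 3
      let ?y = "transv (u + x) y"
      have ux: "u + x \<in> W" "\<omega> e (u + x) = 0" using W u xy 1 by (auto simp: subspace2D form_add)
      have y: "?y \<in> W" "\<omega> e ?y = 1" using W ux xy by (auto simp: transv_closed) (simp add: transv_def form_add)
      obtain pre' vs where *: "crossing W e pre'" "set vs \<subseteq> perp W e" "weq t [x, ?y] (pre' @ vs)"
        using weq_two_crossing[OF W t, of x ?y e] xy y by blast
      have "weq t [u, x, y] (x # (u + x) # [y])" using weq_merge[OF W t u xy(1) a] .
      also have "weq t \<dots> (x # ?y # [u + x])" by (intro weq_Cons weq_push[OF t] ux xy)
      also have "weq t \<dots> ((pre' @ vs) @ [u + x])" using weq_append[OF *(3), of "[u + x]" "[u + x]"] by simp
      finally show ?thesis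
        by (intro exI[of _ pre'] exI[of _ "vs @ [u + x]"]) (use * 3 ux in \<open>simp add: perp_def\<close>)
    next
      case 4
      have "weq t [u, x, y] (x # u # [y])" using weq_commute[OF t u xy(1)] 4 by simp
      also have "weq t \<dots> (x # y # [u + y])" by (intro weq_Cons weq_merge[OF W t u xy(2)] 4)
      finally show ?thesis
        by (intro exI[of _ "[x, y]"] exI[of _ "[u + y]"])
          (use 1 3 4 xy u W in \<open>simp add: crossing_def perp_def form_add subspace2D\<close>)
    next
      case 5
      show ?thesis
        (* three orthogonal crossing letters: the isotropic relation leaves one, the pairwise sums being orthogonal to e *)
        by (intro exI[of _ "[u + x + y]"] exI[of _ "[x + y, u + y, u + x]"])
          (use 1 3 5 xy u W weq_isotropic[OF W t, of u x y "[]"] in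
            \<open>simp add: crossing_def perp_def form_add subspace2D\<close>)
    qed
  qed
qed

lemma weq_crossing:
  assumes W: "subspace2 W" and t: "transv_rep W t" and e: "e \<in> W" and "set us \<subseteq> W"
  shows "\<exists>pre vs. crossing W e pre \<and> set vs \<subseteq> perp W e \<and> weq t us (pre @ vs)"
  using assms(4)
proof (induction us)
  case Nil
  show ?case by (rule exI[of _ "[]"], rule exI[of _ "[]"]) (simp add: crossing_def)
next
  case (Cons u us)
  then obtain pre vs where *: "crossing W e pre" "set vs \<subseteq> perp W e" "weq t us (pre @ vs)" by auto
  obtain pre' vs' where **: "crossing W e pre'" "set vs' \<subseteq> perp W e" "weq t (u # pre) (pre' @ vs')"
    using weq_crossing_Cons[OF W t e _ *(1), of u] Cons.prems by auto
  have "weq t (u # us) ((u # pre) @ vs)" using weq_Cons[OF *(3)] by simp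
  also have "weq t \<dots> ((pre' @ vs') @ vs)" by (intro weq_append ** weq_refl)
  finally show ?case using * ** by (intro exI[of _ pre'] exI[of _ "vs' @ vs"]) simp
qed

text \<open>
  A nonempty reduced prefix moves \<open>e\<close> to \<open>e + x\<close> or \<open>e + x + y\<close>, which differ from \<open>e\<close>. So
  the stabiliser of \<open>e\<close> is generated by the transvections at vectors orthogonal to \<open>e\<close>, and this
  holds at the level of words.
\<close>

lemma weq_stabilizer:
  assumes W: "subspace2 W" and t: "transv_rep W t" and e: "e \<in> W" and us: "set us \<subseteq> W"
    and fix_e: "act us e = e"
  obtains vs where "set vs \<subseteq> perp W e" "weq t us vs"
proof -
  obtain pre vs where *: "crossing W e pre" "set vs \<subseteq> perp W e" "weq t us (pre @ vs)"
    using weq_crossing[OF W t e us] by blast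
  have "act ws e = e" if "set ws \<subseteq> perp W e" for ws
    using that by (induction ws) (auto simp: perp_def transv_def form_commute)
  then have pre_e: "act pre e = e" using fix_e weqD(2)[OF *(3)] *(2) by simp
  have "pre = []"
  proof -
    have "e \<noteq> e + x" if "\<omega> e x = 1" for x using that by (metis add_cancel_right_right form_zero(2) bit_not_one_iff)
    moreover have "e \<noteq> e + y + x" if "x \<noteq> y" for x y
      using that by (metis add.assoc add_cancel_right_right add_eq_zero_iff)
    ultimately show ?thesis using *(1) pre_e
      by (auto simp: crossing_def transv_def form_commute form_add)
  qed
  then show ?thesis using that * by simp
qed

lemma weq_central: "subspace2 W \<Longrightarrow> transv_rep W t \<Longrightarrow> a \<in> W \<Longrightarrow> b \<in> W \<Longrightarrow> e \<in> W \<Longrightarrow>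
    \<omega> a b = 0 \<Longrightarrow> \<omega> e a = 0 \<Longrightarrow> \<omega> e b = 0 \<Longrightarrow>
    weq t (a # (a + e) # b # (b + e) # us) ((a + b) # (a + b + e) # e # us)"
  by (rule weqI) (auto simp: transv_repD(4) form_commute[of _ e] simp flip: mult.assoc)

lemma weq_zero: "transv_rep W t \<Longrightarrow> weq t (0 # us) us"
  by (rule weqI) (auto simp: transv_repD(1))

text \<open>
  The pairs \<open>t w * t (w + e)\<close>, up to a factor \<open>t e\<close>, make up the unipotent radical of the
  stabiliser of \<open>e\<close>. It is normalised by every \<open>t v\<close> with \<open>v\<close> orthogonal to \<open>e\<close>.
\<close>

lemma weq_unipotent_Cons:
  assumes W: "subspace2 W" and t: "transv_rep W t" and e: "e \<in> W"
    and v: "v \<in> W" "\<omega> e v = 0" and w: "w \<in> W" "\<omega> e w = 0"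
    and c: "c = [] \<or> c = [e]"
  shows "weq t (v # w # (w + e) # c @ ms) (transv v w # (transv v w + e) # c @ v # ms)"
proof -
  note sub = subspace2D[OF W]
  have ve: "\<omega> v e = 0" using v by (simp add: form_commute)
  have "weq t (v # w # (w + e) # c @ ms) (transv v w # v # (w + e) # c @ ms)"
    by (rule weq_push[OF t]) (use v w in auto)
  also have "weq t \<dots> (transv v w # transv v (w + e) # v # c @ ms)"
    by (intro weq_Cons weq_push[OF t]) (use v w e sub in auto)
  also have "transv v (w + e) = transv v w + e" using ve by (simp add: transv_add) (simp add: transv_def)
  also have "weq t (transv v w # (transv v w + e) # v # c @ ms) (transv v w # (transv v w + e) # c @ v # ms)"
    by (intro weq_Cons) (use c weq_commute[OF t v(1) e ve] in auto)
  finally show ?thesis .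
qed

text \<open>
  Factorisation of the stabiliser of \<open>e\<close> as the unipotent radical times the group of the
  complement of the hyperbolic plane. A letter \<open>a + e\<close> is split as \<open>t a * t (a + e)\<close> times \<open>t a\<close>,
  and the radical is closed under multiplication by the isotropic relation (\<open>\<omega> a x = 0\<close>) or by
  the Klein four-group rule (\<open>\<omega> a x = 1\<close>).
\<close>

lemma weq_unipotent:
  assumes W: "subspace2 W" and t: "transv_rep W t" and ef: "e \<in> W" "f \<in> W" "\<omega> e f = 1"
    and "set vs \<subseteq> perp W e"
  shows "\<exists>w c ms. w \<in> perp (perp W e) f \<and> (c = [] \<or> c = [e]) \<and> set ms \<subseteq> perp (perp W e) f
    \<and> weq t vs (w # (w + e) # c @ ms)"
  using assms(6)
proof (induction vs)
  case Nil
  (* the pair for w = 0 is t e, so the empty word needs the extra letter e *)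
  have "weq t (0 # (0 + e) # [e] @ []) (e # [e])" using weq_zero[OF t] by simp
  also have "weq t \<dots> []" by (rule weq_cancel[OF t ef(1)])
  finally have "weq t [] (0 # (0 + e) # [e] @ [])" by (simp add: weq_def)
  then show ?case using subspace2_perp[OF subspace2_perp[OF W]]
    by (intro exI[of _ 0] exI[of _ "[e]"] exI[of _ "[]"]) (simp add: subspace2D)
next
  case (Cons v vs)
  let ?W = "perp (perp W e) f"
  note sub = subspace2D[OF W]
  obtain w c ms where w: "w \<in> ?W" and c: "c = [] \<or> c = [e]" and ms: "set ms \<subseteq> ?W"
    and eq: "weq t vs (w # (w + e) # c @ ms)" using Cons by auto
  have v: "v \<in> W" "\<omega> e v = 0" using Cons.prems by (auto simp: perp_def)
  have w': "w \<in> W" "\<omega> e w = 0" "\<omega> f w = 0" using w by (auto simp: perp_def)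
  have fe: "\<omega> f e = 1" using ef by (simp add: form_commute)
  show ?case
  proof (cases "\<omega> f v = 0")
    case True
    have "weq t (v # vs) (v # w # (w + e) # c @ ms)" by (rule weq_Cons[OF eq])
    also have "weq t \<dots> (transv v w # (transv v w + e) # c @ v # ms)"
      by (rule weq_unipotent_Cons[OF W t ef(1)]) (use v w' c in auto)
    finally show ?thesis using True v w' ms c sub
      by (intro exI[of _ "transv v w"] exI[of _ c] exI[of _ "v # ms"])
        (auto simp: perp_def transv_def form_add)
  next
    case False
    define a where "a = v + e"
    have a: "a \<in> W" "\<omega> e a = 0" "\<omega> f a = 0" using v ef fe False sub by (auto simp: a_def form_add)
    have ae: "\<omega> a e = 0" using a by (simp add: form_commute)
    define x where "x = transv a w"
    have x: "x \<in> W" "\<omega> e x = 0" "\<omega> f x = 0"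
      using a w' sub by (auto simp: x_def transv_def form_add)
    have va: "v = a + e" by (simp add: a_def add.assoc)
    have "weq t (v # vs) (a # a # (a + e) # vs)"
      unfolding va using weq_cancel[OF t a(1), of "(a + e) # vs"] by (simp add: weq_def)
    also have "weq t \<dots> (a # (a + e) # a # vs)"
      by (intro weq_Cons weq_commute[OF t]) (use a ae ef sub in \<open>auto simp: form_add\<close>)
    also have "weq t \<dots> (a # (a + e) # a # w # (w + e) # c @ ms)" by (intro weq_Cons eq)
    also have "weq t \<dots> (a # (a + e) # x # (x + e) # c @ a # ms)"
      unfolding x_def
      by (intro weq_Cons weq_unipotent_Cons[OF W t ef(1)]) (use a w' c in auto)
    finally have eq': "weq t (v # vs) (a # (a + e) # x # (x + e) # c @ a # ms)" .
    have in_W': "a + x \<in> ?W" "set (a # ms) \<subseteq> ?W" using a x ms sub by (auto simp: perp_def form_add)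
    show ?thesis
    proof (cases "\<omega> a x = 0")
      case True
      define c' where "c' = (if c = [] then [e] else [])"
      note eq'
      also have "weq t (a # (a + e) # x # (x + e) # c @ a # ms) ((a + x) # (a + x + e) # e # c @ a # ms)"
        by (rule weq_central[OF W t]) (use a x ef True in auto)
      also have "weq t \<dots> ((a + x) # (a + x + e) # c' @ a # ms)"
        using c by (intro weq_Cons) (auto simp: c'_def weq_cancel[OF t ef(1)])
      finally show ?thesis using in_W'
        by (intro exI[of _ "a + x"] exI[of _ c'] exI[of _ "a # ms"]) (auto simp: c'_def)
    next
      case False
      note eq'
      also have "weq t (a # (a + e) # x # (x + e) # c @ a # ms) ((a + x) # (a + x + e) # c @ a # ms)"
        by (rule weq_shift[OF W t]) (use a x ef False in auto)
      finally show ?thesis using in_W' c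
        by (intro exI[of _ "a + x"] exI[of _ c] exI[of _ "a # ms"]) auto
    qed
  qed
qed

definition faithful :: "'v set \<Rightarrow> ('v \<Rightarrow> 'm::monoid_mult) \<Rightarrow> bool" where
  "faithful W t \<longleftrightarrow> (\<forall>us. set us \<subseteq> W \<longrightarrow> (\<forall>x\<in>W. act us x = x) \<longrightarrow> word t us = 1)"

lemma act_orthogonal: "(\<And>u. u \<in> set us \<Longrightarrow> \<omega> u x = 0) \<Longrightarrow> act us x = x"
  by (induction us) (auto simp: transv_def)

text \<open>
  The unipotent factor of a word that acts trivially is trivial, because it is determined by its
  effect on \<open>f\<close>, which the remaining letters fix.
\<close>

lemma faithful_hyperbolic:
  assumes W: "subspace2 W" and t: "transv_rep W t" and ef: "e \<in> W" "f \<in> W" "\<omega> e f = 1"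
    and faith: "faithful (perp (perp W e) f) t"
  shows "faithful W t"
  unfolding faithful_def
proof (intro allI impI)
  fix us assume us: "set us \<subseteq> W" "\<forall>x\<in>W. act us x = x"
  let ?W = "perp (perp W e) f"
  have fe: "\<omega> f e = 1" using ef by (simp add: form_commute)
  obtain vs where vs: "set vs \<subseteq> perp W e" "weq t us vs"
    using weq_stabilizer[OF W t ef(1) us(1)] us(2) ef by blast
  obtain w c ms where w: "w \<in> ?W" and c: "c = [] \<or> c = [e]" and ms: "set ms \<subseteq> ?W"
    and eq: "weq t vs (w # (w + e) # c @ ms)"
    using weq_unipotent[OF W t ef vs(1)] by blast
  have w': "\<omega> w e = 0" "\<omega> w f = 0" "\<omega> f w = 0" using w by (auto simp: perp_def form_commute)
  have "act ms f = f" using ms by (intro act_orthogonal) (auto simp: perp_def form_commute)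
  moreover have "act us f = act (w # (w + e) # c) (act ms f)"
    unfolding weqD(2)[OF vs(2)] weqD(2)[OF eq] by simp
  moreover have "act us f = f" using us(2) ef(2) by blast
  ultimately have f: "act (w # (w + e) # c) f = f" by metis
  have "w = 0 \<and> c = [e]"
  proof (cases "c = []")
    case True
    then have "f + (w + e) = f" using f w' ef by (simp add: transv_def form_add)
    then have "w = e" by (simp add: add_eq_zero_iff)
    then show ?thesis using w' fe by simp
  next
    case False
    then show ?thesis using c f w' ef by (simp add: transv_def form_add add_ac)
  qed
  then have *: "w # (w + e) # c @ ms = 0 # e # e # ms" by simp
  have "weq t us (0 # e # e # ms)" using weq_trans[OF vs(2) eq[unfolded *]] .
  also have "weq t \<dots> (e # e # ms)" by (rule weq_zero[OF t])
  also have "weq t \<dots> ms" by (rule weq_cancel[OF t ef(1)])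
  finally have "weq t us ms" .
  moreover have "word t ms = 1"
    using faith ms us(2) weqD(2)[OF \<open>weq t us ms\<close>] unfolding faithful_def by (auto simp: perp_def)
  ultimately show "word t us = 1" by (simp add: weq_def)
qed

definition nondegenerate :: "'v set \<Rightarrow> bool" where
  "nondegenerate W \<longleftrightarrow> (\<forall>x\<in>W. x \<noteq> 0 \<longrightarrow> (\<exists>y\<in>W. \<omega> x y = 1))"

section \<open>Transitivity and generation\<close>

text \<open>
  If \<open>\<omega> u v = 1\<close>, the transvection at \<open>u + v\<close> does it; otherwise pass through a vector that
  is not orthogonal to either.
\<close>

lemma transv_transitive:
  assumes W: "subspace2 W" "nondegenerate W" and uv: "u \<in> W" "v \<in> W" "u \<noteq> 0" "v \<noteq> 0"
  obtains us where "set us \<subseteq> W" "act us u = v"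
proof (cases "\<omega> u v = 1")
  case True
  have "\<omega> v u = 1" using True by (simp add: form_commute)
  then show ?thesis using that[of "[u + v]"] W uv by (simp add: transv_def form_add subspace2D)
next
  case False
  obtain y z where y: "y \<in> W" "\<omega> u y = 1" and z: "z \<in> W" "\<omega> v z = 1"
    using W(2) uv unfolding nondegenerate_def by blast
  have "\<exists>w\<in>W. \<omega> u w = 1 \<and> \<omega> v w = 1"
  proof (cases "\<omega> v y = 1 \<or> \<omega> u z = 1")
    case True
    then show ?thesis using y z by blast
  next
    case False
    then show ?thesis using y z W by (intro bexI[of _ "y + z"]) (auto simp: form_add subspace2D)
  qed
  then obtain w where w: "w \<in> W" "\<omega> u w = 1" "\<omega> v w = 1" by blast
  then have "\<omega> w u = 1" "\<omega> w v = 1" by (simp_all add: form_commute)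
  then show ?thesis using that[of "[w + v, u + w]"] W uv w
    by (simp add: transv_def form_add subspace2D)
qed

lemma hyperbolic_split:
  assumes W: "subspace2 W" and ef: "e \<in> W" "f \<in> W" "\<omega> e f = 1" and x: "x \<in> W"
  obtains y a where "y \<in> perp (perp W e) f" "a \<in> {0, e, f, e + f}" "x = y + a"
proof -
  define a where "a = (if \<omega> f x = 0 then 0 else e) + (if \<omega> e x = 0 then 0 else f)"
  have "\<omega> f e = 1" using ef by (simp add: form_commute)
  then have "x + a \<in> perp (perp W e) f" using assms
    by (auto simp: perp_def a_def form_add subspace2D)
  moreover have "x = (x + a) + a" by (simp add: add.assoc)
  moreover have "a \<in> {0, e, f, e + f}" by (simp add: a_def)
  ultimately show ?thesis using that by blast
qed

lemma nondegenerate_perp: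
  assumes W: "subspace2 W" "nondegenerate W" and ef: "e \<in> W" "f \<in> W" "\<omega> e f = 1"
  shows "nondegenerate (perp (perp W e) f)"
  unfolding nondegenerate_def
proof (intro ballI impI)
  fix x assume x: "x \<in> perp (perp W e) f" "x \<noteq> 0"
  then obtain y where y: "y \<in> W" "\<omega> x y = 1" using W(2) by (auto simp: nondegenerate_def perp_def)
  obtain z a where z: "z \<in> perp (perp W e) f" "a \<in> {0, e, f, e + f}" "y = z + a"
    using hyperbolic_split[OF W(1) ef y(1)] .
  have "\<omega> x e = 0" "\<omega> x f = 0" using x by (auto simp: perp_def form_commute)
  then have "\<omega> x z = 1" using y(2) z by (auto simp: form_add)
  then show "\<exists>y\<in>perp (perp W e) f. \<omega> x y = 1" using z by blast
qed

text \<open>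
  Formulated for functions that are isometries on \<open>W\<close> only, so that the induction can restrict
  to the complement of a hyperbolic plane.
\<close>

definition isometries_generated :: "'v set \<Rightarrow> bool" where
  "isometries_generated W \<longleftrightarrow> (\<forall>g. (\<forall>x\<in>W. g x \<in> W) \<longrightarrow> (\<forall>x\<in>W. \<forall>y\<in>W. g (x + y) = g x + g y) \<longrightarrow>
     (\<forall>x\<in>W. \<forall>y\<in>W. \<omega> (g x) (g y) = \<omega> x y) \<longrightarrow> (\<exists>us. set us \<subseteq> W \<and> (\<forall>x\<in>W. g x = act us x)))"

lemma isometries_generated_hyperbolic:
  assumes W: "subspace2 W" "nondegenerate W" and ef: "e \<in> W" "f \<in> W" "\<omega> e f = 1"
    and gen: "isometries_generated (perp (perp W e) f)"
  shows "isometries_generated W"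
  unfolding isometries_generated_def
proof (intro allI impI)
  let ?W = "perp (perp W e) f"
  fix g assume g: "\<forall>x\<in>W. g x \<in> W" "\<forall>x\<in>W. \<forall>y\<in>W. g (x + y) = g x + g y"
    "\<forall>x\<in>W. \<forall>y\<in>W. \<omega> (g x) (g y) = \<omega> x y"
  note sub = subspace2D[OF W(1)]
  have fe: "\<omega> f e = 1" using ef by (simp add: form_commute)
  have ge: "\<omega> (g e) (g f) = 1" using g ef by simp
  then have "g e \<noteq> 0" "e \<noteq> 0" using ef by auto
  then obtain us where us: "set us \<subseteq> W" "act us (g e) = e"
    using transv_transitive[OF W, of "g e" e] g ef by blast
  define f' where "f' = act us (g f)"
  have f': "f' \<in> W" using act_closed[OF W(1) us(1)] g ef by (simp add: f'_def)
  have "\<omega> (act us (g e)) (act us (g f)) = 1" using ge by simp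
  then have ef': "\<omega> e f' = 1" "\<omega> f' e = 1" by (simp_all add: us f'_def form_commute)
  (* the stabiliser of e is transitive on the vectors f' with form value 1 on e *)
  obtain vs where vs: "set vs \<subseteq> W" "act vs e = e" "act vs f' = f"
  proof (cases "\<omega> f f' = 0")
    case True
    then have "\<omega> f' f = 0" by (simp add: form_commute)
    then show ?thesis using that[of "[f + f' + e, e]"] True ef f' ef' fe sub
      by (simp add: transv_def form_add add_ac)
  next
    case False
    then have "\<omega> f' f = 1" by (simp add: form_commute)
    then show ?thesis using that[of "[f + f']"] False ef f' ef' fe sub
      by (simp add: transv_def form_add add_ac)
  qed
  define g2 where "g2 = (\<lambda>x. act (vs @ us) (g x))"
  have g2: "g2 e = e" "g2 f = f" using us vs by (simp_all add: g2_def f'_def)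
  have g2_W: "g2 x \<in> W" if "x \<in> W" for x
    using act_closed[OF W(1)] us vs g that by (simp add: g2_def)
  have g2_add: "g2 (x + y) = g2 x + g2 y" if "x \<in> W" "y \<in> W" for x y
    using g that by (simp add: g2_def act_add)
  have g2_iso: "\<omega> (g2 x) (g2 y) = \<omega> x y" if "x \<in> W" "y \<in> W" for x y
    using g that by (simp add: g2_def)
  have g2_W': "g2 x \<in> ?W" if "x \<in> ?W" for x
    using that g2_W g2_iso[of e x] g2_iso[of f x] ef by (auto simp: perp_def g2)
  have "?W \<subseteq> W" by (auto simp: perp_def)
  then have "\<exists>ws. set ws \<subseteq> ?W \<and> (\<forall>x\<in>?W. g2 x = act ws x)"
    by (intro gen[unfolded isometries_generated_def, rule_format] g2_W' g2_add g2_iso) auto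
  then obtain ws where ws: "set ws \<subseteq> ?W" "\<forall>x\<in>?W. g2 x = act ws x" by blast
  have ws_ef: "act ws e = e" "act ws f = f"
    using ws(1) by (auto intro!: act_orthogonal simp: perp_def form_commute)
  have "g x = act (rev us @ rev vs @ ws) x" if x: "x \<in> W" for x
  proof -
    obtain y a where y: "y \<in> ?W" "a \<in> {0, e, f, e + f}" "x = y + a"
      using hyperbolic_split[OF W(1) ef x] .
    have "g2 0 = 0" using g2_add[of 0 0] sub by simp
    then have "g2 a = act ws a" "a \<in> W"
      using y(2) g2 ws_ef ef g2_add[of e f] sub act_add[of ws 0 0] by (auto simp: act_add)
    then have "g2 x = act ws x" using g2_add[of y a] y ws(2) \<open>?W \<subseteq> W\<close> by (auto simp: act_add)
    then have "act ws x = act vs (act us (g x))" by (simp add: g2_def)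
    then show ?thesis by simp
  qed
  then show "\<exists>us. set us \<subseteq> W \<and> (\<forall>x\<in>W. g x = act us x)"
    using us vs ws \<open>?W \<subseteq> W\<close> by (intro exI[of _ "rev us @ rev vs @ ws"]) auto
qed

text \<open>
  Invariance under conjugation and under commutation passes from a set of vectors to this closure;
  it therefore suffices to check the generators.
\<close>

inductive_set transv_closure :: "'v set \<Rightarrow> 'v set" for S where
  base: "u \<in> S \<Longrightarrow> u \<in> transv_closure S"
| step: "u \<in> transv_closure S \<Longrightarrow> v \<in> transv_closure S \<Longrightarrow> transv u v \<in> transv_closure S"

lemma transv_closure_act:
  "set us \<subseteq> transv_closure S \<Longrightarrow> v \<in> transv_closure S \<Longrightarrow> act us v \<in> transv_closure S"
  by (induction us) (auto intro: transv_closure.step)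

end

section \<open>Three sites: the affine diagram of type E7\<close>

text \<open>
  Three consecutive sites give the diagram
  \<open>p\<^sub>1 - h\<^sub>1 - q\<^sub>1 - h\<^sub>2 - q\<^sub>2 - h\<^sub>3 - p\<^sub>3\<close>, here \<open>s 1, ..., s 7\<close>, with the extra node
  \<open>a = p\<^sub>2\<close> attached to \<open>h\<^sub>2 = s 4\<close>. It helps to think of \<open>s i\<close> as the transposition \<open>(i i+1)\<close> in
  the symmetric group of degree eight. The symplectic group of rank three has \<open>63 = 28 + 35\<close>
  transvections: the transpositions and one for each partition of the eight points into two
  quadruples; \<open>a\<close> belongs to \<open>1234|5678\<close>, whose halves are respected by all \<open>s i\<close> with \<open>i \<noteq> 4\<close>.
\<close>

locale affine_E7 =
  fixes s :: "nat \<Rightarrow> 'm::monoid_mult" and a :: 'm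
  assumes s_inv: "i \<in> {1..7} \<Longrightarrow> s i * s i = 1"
    and s_comm: "i \<in> {1..7} \<Longrightarrow> j \<in> {1..7} \<Longrightarrow> j + 2 \<le> i \<Longrightarrow> s i * s j = s j * s i"
    and s_braid: "i \<in> {1..7} \<Longrightarrow> j \<in> {1..7} \<Longrightarrow> i = j + 1 \<Longrightarrow> s i * s j * s i = s j * s i * s j"
    and a_inv: "a * a = 1"
    and a_comm: "i \<in> {1..7} \<Longrightarrow> i \<noteq> 4 \<Longrightarrow> a * s i = s i * a"
    and a_braid: "a * s 4 * a = s 4 * a * s 4"
begin

abbreviation node :: "nat \<Rightarrow> bool" where "node i \<equiv> i \<in> {1..7}"

lemma s_inv': "node i \<Longrightarrow> s i * (s i * x) = x"
  by (simp add: s_inv flip: mult.assoc)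

lemma s_comm': "node i \<Longrightarrow> node j \<Longrightarrow> j + 2 \<le> i \<Longrightarrow> s i * (s j * x) = s j * (s i * x)"
  using arg_cong[OF s_comm[of i j], of "\<lambda>y. y * x"] by (simp only: mult.assoc)

lemma s_braid': "node i \<Longrightarrow> node j \<Longrightarrow> i = j + 1 \<Longrightarrow> s i * (s j * (s i * x)) = s j * (s i * (s j * x))"
  using arg_cong[OF s_braid[of i j], of "\<lambda>y. y * x"] by (simp only: mult.assoc)

lemma s_braid3: "node i \<Longrightarrow> node j \<Longrightarrow> node k \<Longrightarrow> i = j + 1 \<Longrightarrow> j = k + 1 \<Longrightarrow>
    s i * (s j * (s k * (s i * x))) = s j * (s i * (s j * (s k * x)))"
  using s_comm'[of i k x] s_braid'[of i j "s k * x"] by simp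

lemma s_braid4: "node i \<Longrightarrow> node j \<Longrightarrow> node k \<Longrightarrow> node l \<Longrightarrow> i = j + 1 \<Longrightarrow> j = k + 1 \<Longrightarrow> k = l + 1 \<Longrightarrow>
    s i * (s j * (s k * (s l * (s i * x)))) = s j * (s i * (s j * (s k * (s l * x))))"
  using s_comm'[of i l x] s_braid3[of i j k "s l * x"] by simp

lemma s_braid5: "node i \<Longrightarrow> node j \<Longrightarrow> node k \<Longrightarrow> node l \<Longrightarrow> node m \<Longrightarrow> i = j + 1 \<Longrightarrow> j = k + 1 \<Longrightarrow> k = l + 1 \<Longrightarrow> l = m + 1 \<Longrightarrow>
    s i * (s j * (s k * (s l * (s m * (s i * x))))) = s j * (s i * (s j * (s k * (s l * (s m * x)))))"
  using s_comm'[of i m x] s_braid4[of i j k l "s m * x"] by simp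

lemma a_inv': "a * (a * x) = x"
  by (simp add: a_inv flip: mult.assoc)

lemma a_comm': "node i \<Longrightarrow> i \<noteq> 4 \<Longrightarrow> a * (s i * x) = s i * (a * x)"
  by (simp add: a_comm flip: mult.assoc)

lemma a_braid': "a * (s 4 * (a * x)) = s 4 * (a * (s 4 * x))"
  using arg_cong[OF a_braid, of "\<lambda>y. y * x"] by (simp only: mult.assoc)

text \<open>
  The rules for the \<open>s i\<close> belong to the standard complete rewriting system of the symmetric
  group, stated with a tail \<open>x\<close> so that they apply inside products that are nested to the right;
  those for \<open>a\<close> push \<open>a\<close> to the right.
\<close>

lemmas s_nf = s_inv' s_comm' s_braid' s_braid3 s_braid4 s_braid5
lemmas nf0 = s_nf a_inv' a_comm'
lemmas nf = nf0 a_braid'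

text \<open>
  In the permutation picture \<open>c\<close> and \<open>d\<close> are the transvections attached to \<open>1256|3478\<close> and
  \<open>3456|1278\<close>, obtained from \<open>a\<close> by conjugation with permutations that map \<open>{1, 2, 3, 4}\<close> to
  \<open>{1, 2, 5, 6}\<close> and to \<open>{3, 4, 5, 6}\<close>. In terms of vectors they are \<open>e\<^sub>1 + e\<^sub>2 + e\<^sub>3\<close> and
  \<open>e\<^sub>1 + e\<^sub>3\<close>, and \<open>z\<close> is the permutation \<open>(1 2)(3 4)(5 6)(7 8)\<close>. The seven involutions
  \<open>a, c, d, s 1, s 3, s 5, s 7\<close> belong to one isotropic subspace. Finally
  \<open>tau\<close> is a permutation that maps \<open>{1, 2, 3, 4}\<close> to \<open>{1, 2, 5, 6}\<close> and this to
  \<open>{3, 4, 5, 6}\<close>, with cube \<open>z\<close>.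
\<close>

definition c where "c = s 4 * s 3 * s 5 * s 4 * a * s 4 * s 5 * s 3 * s 4"

definition d where "d = s 2 * s 1 * s 3 * s 2 * c * s 2 * s 3 * s 1 * s 2"

definition z where "z = s 1 * s 3 * s 5 * s 7"

definition tau where "tau = s 7 * s 4 * s 5 * s 3 * s 4 * s 1 * s 2 * s 3 * s 1 * s 2"

lemma tau_a: "tau * a * x = c * tau * x"
  by (simp add: tau_def c_def mult.assoc nf)

lemma tau_tau_a: "tau * tau * a * x = d * tau * tau * x"
  by (simp add: tau_def c_def d_def mult.assoc nf)

lemma tau3: "tau * tau * tau * x = z * x"
  by (simp add: tau_def z_def mult.assoc nf)

lemma s5_d: "s 5 * d * x = d * s 5 * x"
  by (simp add: c_def d_def mult.assoc nf)

text \<open>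
  Other expressions for \<open>c\<close>: the word in the middle is the transposition \<open>(3 6)\<close>. It commutes
  with \<open>s 4 = (4 5)\<close>, whence \<open>a\<close> and \<open>c\<close> commute.
\<close>

lemma c_form: "c * x = s 4 * a * s 3 * s 5 * s 4 * s 5 * s 3 * a * s 4 * x"
proof -
  have "c * x = s 4 * s 3 * s 5 * (s 4 * a * s 4) * s 5 * s 3 * s 4 * x"
    by (simp add: c_def mult.assoc)
  also have "\<dots> = s 4 * s 3 * s 5 * (a * s 4 * a) * s 5 * s 3 * s 4 * x"
    unfolding a_braid ..
  also have "\<dots> = s 4 * a * s 3 * s 5 * s 4 * s 5 * s 3 * a * s 4 * x"
    by (simp add: mult.assoc nf0)
  finally show ?thesis .
qed

lemma c_conj: "c = s 4 * a * s 3 * s 4 * s 5 * s 4 * s 3 * a * s 4"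
  using c_form[of 1] by (simp add: mult.assoc s_braid')

lemma a_c: "a * c * x = c * a * x"
proof -
  define w where "w = s 3 * s 5 * s 4 * s 5 * s 3"
  have c: "c * y = s 4 * (a * (w * (a * (s 4 * y))))" for y
    by (simp only: c_form w_def mult.assoc)
  have w: "s 4 * (w * (s 4 * y)) = w * y" for y
    by (simp add: w_def mult.assoc nf)
  have "a * (c * (a * y)) = c * y" for y
    unfolding c a_braid' w ..
  from this[of "a * x"] show ?thesis by (simp add: mult.assoc a_inv')
qed

lemma s_c:
  fixes i j :: nat
  assumes "(i, j) \<in> {(1, 1), (3, 5), (5, 3), (7, 7)}"
  shows "s i * c * x = c * s i * x"
proof -
  have j: "j \<in> {1..7}" "j \<noteq> 4" using assms by auto
  have "s i * c * x = s 4 * s 3 * s 5 * s 4 * s j * a * s 4 * s 5 * s 3 * s 4 * x"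
    using assms by (auto simp: c_def mult.assoc s_nf)
  also have "\<dots> = s 4 * s 3 * s 5 * s 4 * a * s j * s 4 * s 5 * s 3 * s 4 * x"
    by (simp only: mult.assoc a_comm'[OF j])
  also have "\<dots> = c * s i * x"
    using assms by (auto simp: c_def mult.assoc s_nf)
  finally show ?thesis .
qed

text \<open>
  B2 says that \<open>w\<close> has order three. Removing all but one of the letters \<open>a\<close> by conjugation turns \<open>w\<close>
  into \<open>a * tau\<close>, and \<open>(a * tau)\<^sup>3\<close> is \<open>a * c * d * z\<close> as \<open>tau\<close> moves \<open>a\<close> to \<open>c\<close> and then to \<open>d\<close>.
  So B2 is the relation of an isotropic three-dimensional subspace.
\<close>

lemma isotropic_product:
  assumes w: "w = s 5 * s 7 * a * s 2 * s 4 * s 1 * s 3 * a * s 2 * s 4 * s 1 * s 3 * a" "w * w * w = 1"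
  shows "a * c * d * z = 1"
proof -
  (* s 2 * s 3 * s 1 moves the quadruples of the conjugate of w to those of a, c, d *)
  define m where "m = s 2 * s 3 * s 1 * s 4 * s 2 * s 5 * s 7 * a"
  define m' where "m' = a * s 5 * s 7 * s 2 * s 4 * s 1 * s 3 * s 2"
  have m: "m' * (m * x) = x" for x
    by (simp add: m_def m'_def mult.assoc nf)
  have mw: "a * (tau * x) = m * (w * (m' * x))" for x
    unfolding assms(1) by (simp add: m_def m'_def tau_def mult.assoc nf)
  have "a * (tau * (a * (tau * (a * (tau * 1))))) = m * (w * w * w) * m'"
    unfolding mw m by (simp only: mult.assoc mult_1_right m)
  also have "\<dots> = 1"
    unfolding assms(2) by (simp add: m_def m'_def nf mult.assoc s_inv)
  finally have "1 = a * (tau * (a * (tau * (a * (tau * 1)))))" ..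
  also have "\<dots> = a * c * d * z"
    using tau_a[of "tau * a * tau"] tau_tau_a[of "tau"] tau3[of 1] by (simp only: mult.assoc mult_1_right)
  finally show ?thesis ..
qed

text \<open>
  B3 is B2 reflected in the diagram, which fixes \<open>a\<close>, \<open>c\<close> and \<open>z\<close> but replaces \<open>d\<close> by the
  conjugate of \<open>a\<close> that belongs to the complementary quadruple \<open>{1, 2, 7, 8}\<close>.
\<close>

lemma isotropic_product_mirror:
  assumes "w = s 3 * s 1 * a * s 6 * s 4 * s 7 * s 5 * a * s 6 * s 4 * s 7 * s 5 * a" "w * w * w = 1"
  shows "a * c * (s 6 * s 7 * s 5 * s 6 * c * s 6 * s 5 * s 7 * s 6) * z = 1"
proof -
  interpret mirror: affine_E7 "\<lambda>i. s (8 - i)" a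
  proof
    show "i \<in> {1..7} \<Longrightarrow> s (8 - i) * s (8 - i) = 1" for i :: nat
      by (rule s_inv) auto
    show "s (8 - i) * s (8 - j) = s (8 - j) * s (8 - i)"
      if "i \<in> {1..7}" "j \<in> {1..7}" "j + 2 \<le> i" for i j :: nat
      using that by (intro s_comm[symmetric]) auto
    show "s (8 - i) * s (8 - j) * s (8 - i) = s (8 - j) * s (8 - i) * s (8 - j)"
      if "i \<in> {1..7}" "j \<in> {1..7}" "i = j + 1" for i j :: nat
      using that by (intro s_braid[symmetric]) auto
    show "a * s (8 - i) = s (8 - i) * a" if "i \<in> {1..7}" "i \<noteq> 4" for i :: nat
      using that by (intro a_comm) auto
    show "a * s (8 - 4) * a = s (8 - 4) * a * s (8 - 4)" using a_braid by simp
  qed (rule a_inv)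
  have c: "mirror.c = c"
    unfolding mirror.c_def c_def using s_comm'[of 5 3] by (simp add: mult.assoc)
  have z: "mirror.z * x = z * x" for x
    unfolding mirror.z_def z_def by (simp add: mult.assoc nf)
  have "a * c * mirror.d * mirror.z = 1"
    using mirror.isotropic_product[of w] assms unfolding c by simp
  then show ?thesis using z[of 1] unfolding mirror.d_def c by (simp add: mult.assoc nf)
qed

text \<open>
  The reflection group of affine type distinguishes a quadruple from its complement. Since B2 and B3
  express the conjugates for \<open>{3, 4, 5, 6}\<close> and \<open>{1, 2, 7, 8}\<close> by the same element, they are
  equal, and this is what the second identity needs; the third one is B2 rearranged.
\<close>

theorem three_site_relations:
  assumes B2: "w = s 5 * s 7 * a * s 2 * s 4 * s 1 * s 3 * a * s 2 * s 4 * s 1 * s 3 * a" "w * w * w = 1"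
    and B3: "v = s 3 * s 1 * a * s 6 * s 4 * s 7 * s 5 * a * s 6 * s 4 * s 7 * s 5 * a" "v * v * v = 1"
  shows "s 5 * d = d * s 5"
    and "s 5 * s 6 * d * s 6 * s 5 = s 7 * s 6 * c * s 6 * s 7"
    and "a * s 7 * s 5 * s 1 * s 7 * d = s 3 * s 7 * c"
proof -
  define d' where "d' = s 6 * s 7 * s 5 * s 6 * c * s 6 * s 5 * s 7 * s 6"
  show "s 5 * d = d * s 5" using s5_d[of 1] by simp
  have eq: "a * c * d * z = 1" "a * c * d' * z = 1"
    using isotropic_product[OF B2] isotropic_product_mirror[OF B3] unfolding d'_def by auto
  have zz: "z * z = 1" unfolding z_def by (simp add: mult.assoc nf s_inv)
  have cc: "c * (c * x) = x" for x unfolding c_def by (simp add: mult.assoc nf)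
  have d: "x = c * a * z" if "a * c * x * z = 1" for x
  proof -
    have "x = c * (a * (a * c * x * z) * z)"
      using zz by (simp add: mult.assoc a_inv' cc)
    also have "\<dots> = c * a * z" unfolding that by (simp add: mult.assoc)
    finally show ?thesis .
  qed
  have "d = d'" using d eq by metis
  then show "s 5 * s 6 * d * s 6 * s 5 = s 7 * s 6 * c * s 6 * s 7"
    unfolding d'_def by (simp add: mult.assoc nf s_inv s_comm)
  show "a * s 7 * s 5 * s 1 * s 7 * d = s 3 * s 7 * c"
  proof -
    have "a * s 7 * s 5 * s 1 * s 7 * d = a * (s 1 * (s 5 * (c * (a * z))))"
      unfolding d[OF eq(1)] by (simp add: mult.assoc nf0)
    also have "\<dots> = a * (c * (a * (s 1 * (s 5 * z))))"
      using s_c[of 1 1] s_c[of 5 3] by (simp add: mult.assoc a_comm')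
    also have "\<dots> = c * (s 1 * (s 5 * z))"
      using a_c by (simp add: mult.assoc a_inv')
    also have "\<dots> = c * (s 3 * (s 7 * 1))"
      unfolding z_def by (simp add: mult.assoc nf)
    also have "\<dots> = s 3 * s 7 * c"
      using s_c[of 3 5] s_c[of 7 7 1] by (simp add: mult.assoc)
    finally show ?thesis .
  qed
qed

end

section \<open>Extending a family by a hyperbolic plane\<close>

context alternating_space begin

text \<open>
  One vector \<open>v + e\<close> links the plane to its complement: the complement moves it to every \<open>w + e\<close>
  with \<open>w \<noteq> 0\<close>, and the plane turns \<open>e\<close> into \<open>f\<close> and \<open>e + f\<close>.
\<close>

lemma transv_closure_hyperbolic:
  assumes U: "subspace2 U" and ef: "e \<in> U" "f \<in> U" "\<omega> e f = 1"
    and nd: "nondegenerate (perp (perp U e) f)"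
    and S: "e \<in> S" "e + f \<in> S" "perp (perp U e) f - {0} \<subseteq> transv_closure S"
    and link: "perp (perp U e) f \<noteq> {0} \<Longrightarrow> \<exists>v\<in>perp (perp U e) f. v \<noteq> 0 \<and> v + e \<in> S"
  shows "U - {0} \<subseteq> transv_closure S"
proof
  fix x assume "x \<in> U - {0}"
  let ?W = "perp (perp U e) f" and ?C = "transv_closure S"
  have W: "subspace2 ?W" by (intro subspace2_perp U)
  have fe: "\<omega> f e = 1" using ef by (simp add: form_commute)
  have tef: "transv (e + f) (v + e) = v + f" "transv e (v + f) = v + (e + f)" if "v \<in> ?W" for v
    using that ef fe form_commute[of v] by (auto simp: transv_def form_add perp_def add_ac)
  have ve: "v + e \<in> ?C" if v: "v \<in> ?W" for v
  proof (cases "v = 0")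
    case True
    then show ?thesis using S by (auto intro: transv_closure.base)
  next
    case False
    then obtain v0 where v0: "v0 \<in> ?W" "v0 \<noteq> 0" "v0 + e \<in> S" using link v by blast
    obtain us where us: "set us \<subseteq> ?W" "act us v0 = v" using transv_transitive[OF W nd v0(1) v v0(2) False] .
    have "act (filter (\<lambda>u. u \<noteq> 0) us) y = act us y" for y by (induction us) auto
    moreover have "act us e = e" using us(1) by (intro act_orthogonal) (auto simp: perp_def form_commute)
    ultimately have "v + e = act (filter (\<lambda>u. u \<noteq> 0) us) (v0 + e)" using us by (simp add: act_add)
    moreover have "set (filter (\<lambda>u. u \<noteq> 0) us) \<subseteq> ?C" using us S by auto
    ultimately show ?thesis by (metis transv_closure_act transv_closure.base v0(3))
  qed
  have vf: "v + f \<in> ?C" if "v \<in> ?W" for v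
    using transv_closure.step[OF transv_closure.base[OF S(2)] ve[OF that]] tef that by simp
  have vef: "v + (e + f) \<in> ?C" if "v \<in> ?W" for v
    using transv_closure.step[OF transv_closure.base[OF S(1)] vf[OF that]] tef that by simp
  obtain v a where "v \<in> ?W" "a \<in> {0, e, f, e + f}" "x = v + a"
    using hyperbolic_split[OF U ef, of x] \<open>x \<in> U - {0}\<close> by blast
  then show "x \<in> ?C" using ve vf vef S(3) \<open>x \<in> U - {0}\<close> by auto
qed

end

text \<open>
  \<open>Z v\<close> plays the part of the product of the transvections at \<open>v\<close>, \<open>e\<close> and \<open>v + e\<close>, that is, of
  the controlled gate \<open>x \<mapsto> x + \<omega>(v, x) e + \<omega>(e, x) v\<close>. The elements \<open>p\<close> and \<open>h\<close> stand for the
  transvections at \<open>e\<close> and \<open>e + f\<close>. These data force the value \<open>y v\<close> at \<open>v + e\<close>, and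
  conjugation by \<open>h\<close> and \<open>p\<close> then forces the values at \<open>v + f\<close> and \<open>v + (e + f)\<close>.
\<close>

locale rep_extension = alternating_space \<omega>
  for \<omega> :: "'v::ab_group_add \<Rightarrow> 'v \<Rightarrow> bit" +
  fixes U W :: "'v set" and e f :: 'v and t Z :: "'v \<Rightarrow> 'm::monoid_mult" and p h :: 'm
  assumes U: "subspace2 U" and ef: "e \<in> U" "f \<in> U" "\<omega> e f = 1"
    and W_def: "W = perp (perp U e) f"
    and nd: "nondegenerate W"
    and t: "transv_rep W t"
    and p_inv: "p * p = 1" and h_inv: "h * h = 1" and ph: "p * h * p = h * p * h"
    and p_t: "v \<in> W \<Longrightarrow> p * t v = t v * p" and h_t: "v \<in> W \<Longrightarrow> h * t v = t v * h"
    and Z_0: "Z 0 = 1"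
    and Z_inv: "v \<in> W \<Longrightarrow> Z v * Z v = 1"
    and Z_conj: "v \<in> W \<Longrightarrow> w \<in> W \<Longrightarrow> t w * Z v * t w = Z (transv w v)"
    and p_Z: "v \<in> W \<Longrightarrow> p * Z v = Z v * p"
begin

lemma W: "subspace2 W"
  unfolding W_def by (intro subspace2_perp U)

lemma ef_rules [simp]: "\<omega> e f = 1" "\<omega> f e = 1" "e \<in> U" "f \<in> U"
  using ef by (simp_all add: form_commute)

lemma W_rules [simp]:
  assumes "v \<in> W"
  shows "\<omega> e v = 0" "\<omega> f v = 0" "\<omega> v e = 0" "\<omega> v f = 0" "v \<in> U"
  using assms by (auto simp: W_def perp_def form_commute)

lemma U_split:
  assumes "x \<in> U"
  obtains v a where "v \<in> W" "a \<in> {0, e, f, e + f}" "x = v + a"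
  using hyperbolic_split[OF U ef assms] unfolding W_def by blast

lemma t_0 [simp]: "t 0 = 1" and t_inv: "v \<in> W \<Longrightarrow> t v * t v = 1"
  and t_conj: "v \<in> W \<Longrightarrow> w \<in> W \<Longrightarrow> t w * t v * t w = t (transv w v)"
  using transv_repD[OF t] by auto

lemma t_Z: "v \<in> W \<Longrightarrow> t v * Z v = Z v * t v"
  using Z_conj[of v v] by (metis involution_cancel_right t_inv transv_zero(3))

definition y :: "'v \<Rightarrow> 'm" where
  "y v = t v * p * Z v"

definition ext :: "'v \<Rightarrow> 'm" where
  "ext x = (if \<omega> e x = 0 then if \<omega> f x = 0 then t x else y (x + e)
    else if \<omega> f x = 0 then h * y (x + f) * h else p * h * y (x + (e + f)) * h * p)"

lemma ext_simps:
  assumes "v \<in> W"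
  shows "ext v = t v" "ext (v + e) = y v" "ext (v + f) = h * y v * h"
    "ext (v + (e + f)) = p * h * y v * h * p"
proof -
  have vv: "v + e + e = v" "v + f + f = v" "v + (e + f) + (e + f) = v" by (simp_all add: add_ac)
  show "ext v = t v" "ext (v + e) = y v" "ext (v + f) = h * y v * h"
    "ext (v + (e + f)) = p * h * y v * h * p"
    using assms by (simp_all add: ext_def form_add vv)
qed

lemma y_0: "y 0 = p"
  by (simp add: y_def Z_0)

lemma y_p: "v \<in> W \<Longrightarrow> p * y v = y v * p"
  using p_t[of v] p_Z[of v] by (metis mult.assoc y_def)

lemma y_inv: "v \<in> W \<Longrightarrow> y v * y v = 1"
  by (metis (no_types, lifting) mult.assoc mult_1_left p_Z p_inv p_t t_Z t_inv Z_inv y_def)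

lemma y_conj: "v \<in> W \<Longrightarrow> w \<in> W \<Longrightarrow> t w * y v * t w = y (transv w v)"
proof -
  assume vw: "v \<in> W" "w \<in> W"
  have *: "t w * (t w * z) = z" for z using t_inv[OF vw(2)] by (simp flip: mult.assoc)
  have "t w * y v * t w = (t w * t v * t w) * (t w * p * t w) * (t w * Z v * t w)"
    by (simp add: y_def mult.assoc *)
  also have "t w * p * t w = p" using p_t[OF vw(2)] t_inv[OF vw(2)] by (metis mult.assoc mult_1_right)
  finally show ?thesis using vw by (simp add: t_conj Z_conj y_def)
qed

lemma y_act: "set us \<subseteq> W \<Longrightarrow> v \<in> W \<Longrightarrow> word t us * y v * word t (rev us) = y (act us v)"
proof (induction us)
  case (Cons u us)
  have "word t (u # us) * y v * word t (rev (u # us)) = t u * (word t us * y v * word t (rev us)) * t u"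
    by (simp add: mult.assoc)
  also have "\<dots> = y (act (u # us) v)"
    using Cons y_conj[of "act us v" u] act_closed[OF W, of us v] by simp
  finally show ?case .
qed simp

lemma Z_y: "v \<in> W \<Longrightarrow> Z v = t v * p * y v"
  unfolding y_def using t_inv[of v] p_t[of v] p_inv by (metis mult.assoc mult_1_left)

lemma ext_0 [simp]: "ext 0 = 1"
  using ext_simps(1)[of 0] W by (simp add: subspace2D)

lemma ext_e: "ext e = p" and ext_ef: "ext (e + f) = h"
proof -
  have 0: "0 \<in> W" using W by (simp add: subspace2D)
  show "ext e = p" using ext_simps(2)[OF 0] y_0 by simp
  have "ext (e + f) = p * h * p * h * p" using ext_simps(4)[OF 0] y_0 by simp
  also have "\<dots> = h * p * (h * h) * p" unfolding ph by (simp add: mult.assoc)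
  finally show "ext (e + f) = h" by (simp add: h_inv p_inv mult.assoc)
qed

text \<open>
  Good vectors are closed under transvections, and all vectors of \<open>W\<close> as well as \<open>e\<close> and \<open>e + f\<close>
  are good by construction. A single good vector \<open>v + e\<close> with \<open>v \<noteq> 0\<close> in \<open>W\<close> then makes all
  vectors good.
\<close>

definition good :: "'v \<Rightarrow> bool" where
  "good u \<longleftrightarrow> u \<in> U \<and> (\<forall>x\<in>U. ext u * ext x * ext u = ext (transv u x))"

lemma goodD: "good u \<Longrightarrow> x \<in> U \<Longrightarrow> ext u * ext x * ext u = ext (transv u x)" "good u \<Longrightarrow> u \<in> U"
  by (auto simp: good_def)

lemma good_transv:
  assumes u: "good u" and v: "good v"
  shows "good (transv u v)"
  unfolding good_def
proof (intro conjI ballI)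
  have uv: "u \<in> U" "v \<in> U" using u v by (auto simp: good_def)
  then show "transv u v \<in> U" by (simp add: transv_closed U)
  fix x assume x: "x \<in> U"
  have "ext (transv u v) = ext u * ext v * ext u" using goodD(1)[OF u uv(2)] by simp
  then have "ext (transv u v) * ext x * ext (transv u v)
      = ext u * (ext v * (ext u * ext x * ext u) * ext v) * ext u"
    by (simp add: mult.assoc)
  also have "\<dots> = ext (transv u (transv v (transv u x)))"
    using u v uv x by (simp add: goodD transv_closed U)
  finally show "ext (transv u v) * ext x * ext (transv u v) = ext (transv (transv u v) x)"
    by (simp add: transv_conj)
qed

lemma good_closure:
  assumes "\<And>u. u \<in> S \<Longrightarrow> good u" "u \<in> transv_closure S"
  shows "good u"
  using assms(2) by induction (auto intro: assms(1) good_transv)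

lemma good_0: "good 0"
  using U by (simp add: good_def subspace2D)

lemma good_W:
  assumes w: "w \<in> W"
  shows "good w"
  unfolding good_def
proof (intro conjI ballI)
  show "w \<in> U" using w by simp
  fix x assume "x \<in> U"
  then obtain v a where v: "v \<in> W" and a: "a \<in> {0, e, f, e + f}" and x: "x = v + a" by (rule U_split)
  have T: "transv w v \<in> W" using v w W by (rule_tac transv_closed)
  have Ta: "transv w (v + a) = transv w v + a" using a w by (auto simp: transv_def form_add add_ac)
  have h: "t w * (h * z * h) * t w = h * (t w * z * t w) * h"
    and p: "t w * (p * z * p) * t w = p * (t w * z * t w) * p" for z
    using h_t[OF w] p_t[OF w] by (metis mult.assoc)+
  have f: "t w * (h * y v * h) * t w = h * y (transv w v) * h"
    unfolding h using y_conj[OF v w] by simp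
  have "t w * (p * (h * y v * h) * p) * t w = p * (h * y (transv w v) * h) * p"
    unfolding p f ..
  then have "t w * ext (v + a) * t w = ext (transv w v + a)"
    using a f ext_simps[OF v] ext_simps[OF T] t_conj[OF v w] y_conj[OF v w]
    by (auto simp: mult.assoc)
  then show "ext w * ext x * ext w = ext (transv w x)"
    unfolding x Ta using ext_simps[OF w] by simp
qed

lemma p_inv': "p * (p * z) = z" and h_inv': "h * (h * z) = z"
  by (simp_all add: p_inv h_inv flip: mult.assoc)

lemma good_e: "good e"
  unfolding good_def ext_e
proof (intro conjI ballI)
  fix x assume "x \<in> U"
  then obtain v a where v: "v \<in> W" and a: "a \<in> {0, e, f, e + f}" and x: "x = v + a" by (rule U_split)
  have "p * t v * p = t v" "p * y v * p = y v"
    using p_t[OF v] y_p[OF v] by (simp_all add: mult.assoc p_inv)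
  moreover have "transv e v = v" "transv e (v + e) = v + e" "transv e (v + f) = v + (e + f)"
    "transv e (v + (e + f)) = v + f"
    using v by (simp_all add: transv_def form_add add_ac)
  ultimately show "p * ext x * p = ext (transv e x)"
    using a ext_simps[OF v] unfolding x by (auto simp: mult.assoc p_inv p_inv')
qed simp

lemma good_ef: "good (e + f)"
  unfolding good_def ext_ef
proof (intro conjI ballI)
  show "e + f \<in> U" using U by (simp add: subspace2D)
  fix x assume "x \<in> U"
  then obtain v a where v: "v \<in> W" and a: "a \<in> {0, e, f, e + f}" and x: "x = v + a" by (rule U_split)
  have "h * t v * h = t v" using h_t[OF v] by (simp add: mult.assoc h_inv)
  moreover have "h * (p * h * y v * h * p) * h = p * h * y v * h * p"
  proof -
    have "h * (p * h * y v * h * p) * h = (h * p * h) * y v * (h * p * h)" by (simp add: mult.assoc)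
    also have "\<dots> = p * h * (p * y v) * p * h * p" unfolding ph[symmetric] by (simp add: mult.assoc)
    also have "\<dots> = p * h * y v * h * p" unfolding y_p[OF v] by (simp add: mult.assoc p_inv')
    finally show ?thesis .
  qed
  moreover have "transv (e + f) v = v" "transv (e + f) (v + e) = v + f" "transv (e + f) (v + f) = v + e"
    "transv (e + f) (v + (e + f)) = v + (e + f)"
    using v by (simp_all add: transv_def form_add add_ac)
  ultimately show "h * ext x * h = ext (transv (e + f) x)"
    using a ext_simps[OF v] unfolding x by (auto simp: mult.assoc h_inv h_inv')
qed

lemma ext_inv:
  assumes u: "u \<in> U"
  shows "ext u * ext u = 1"
proof -
  obtain v a where v: "v \<in> W" and a: "a \<in> {0, e, f, e + f}" and x: "u = v + a" using u by (rule U_split)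
  have "y v * (y v * z) = z" for z using y_inv[OF v] by (simp flip: mult.assoc)
  then show ?thesis using a ext_simps[OF v] t_inv[OF v] y_inv[OF v] unfolding x
    by (auto simp: mult.assoc h_inv h_inv' p_inv p_inv')
qed

text \<open>
  The relation of an isotropic triple \<open>u, v, w\<close> is invariant under conjugation, so \<open>w\<close> can be
  moved to \<open>e\<close>. Modulo \<open>e\<close> the vectors \<open>u\<close> and \<open>v\<close> then lie in \<open>W\<close>, each pair \<open>ext x * ext (x + e)\<close>
  is \<open>p * Z x'\<close>, and the relation becomes the additivity of \<open>Z\<close>.
\<close>

theorem transv_rep_ext:
  assumes link: "W \<noteq> {0} \<Longrightarrow> \<exists>v\<in>W. v \<noteq> 0 \<and> good (v + e)" and ndU: "nondegenerate U"
    and Z_add: "\<And>v w. v \<in> W \<Longrightarrow> w \<in> W \<Longrightarrow> \<omega> v w = 0 \<Longrightarrow> Z v * Z w = Z (v + w)"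
  shows "transv_rep U ext"
proof -
  have "U - {0} \<subseteq> transv_closure {u. good u}"
  proof (rule transv_closure_hyperbolic[OF U ef])
    show "nondegenerate (perp (perp U e) f)" using nd by (simp add: W_def)
    show "e \<in> {u. good u}" "e + f \<in> {u. good u}" using good_e good_ef by auto
    show "perp (perp U e) f - {0} \<subseteq> transv_closure {u. good u}"
      using good_W by (auto simp flip: W_def intro: transv_closure.base)
    show "\<exists>v\<in>perp (perp U e) f. v \<noteq> 0 \<and> v + e \<in> {u. good u}" if "perp (perp U e) f \<noteq> {0}"
      using link that by (simp flip: W_def)
  qed
  then have good: "good u" if "u \<in> U" for u
    using good_closure[of "{u. good u}" u] good_0 that by blast
  note inv = ext_inv
  have conj: "ext u * ext x * ext u = ext (transv u x)" if "u \<in> U" "x \<in> U" for u x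
    using goodD(1)[OF good] that by blast
  define E where "E u v w \<longleftrightarrow> ext u * ext (u + w) * ext v * ext (v + w) = ext (u + v) * ext (u + v + w) * ext w"
    for u v w
  have E_conj: "E u v w" if "E (transv x u) (transv x v) (transv x w)" "x \<in> U" "u \<in> U" "v \<in> U" "w \<in> U"
    for x u v w
  proof -
    have *: "ext x * (ext x * z) = z" for z using inv[OF \<open>x \<in> U\<close>] by (simp flip: mult.assoc)
    have c: "ext (transv x z) = ext x * ext z * ext x" if "z \<in> U" for z using conj \<open>x \<in> U\<close> that by simp
    have "ext x * (ext u * ext (u + w) * ext v * ext (v + w)) * ext x
        = ext x * (ext (u + v) * ext (u + v + w) * ext w) * ext x"
      using that(1) unfolding E_def transv_add[symmetric] using that U
      by (simp add: c subspace2D mult.assoc *)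
    then have "ext x * (ext x * (ext u * ext (u + w) * ext v * ext (v + w)) * ext x) * ext x
        = ext x * (ext x * (ext (u + v) * ext (u + v + w) * ext w) * ext x) * ext x" by simp
    then show ?thesis using inv[OF \<open>x \<in> U\<close>] by (simp add: E_def mult.assoc *)
  qed
  have E_act: "E u v w" if "E (act us u) (act us v) (act us w)" "set us \<subseteq> U" "u \<in> U" "v \<in> U" "w \<in> U"
    for us u v w
    using that
  proof (induction us)
    case (Cons x us)
    then have "E (act us u) (act us v) (act us w)"
      using act_closed[OF U, of us] by (intro E_conj[of x "act us u" "act us v" "act us w"]) auto
    then show ?case using Cons by simp
  qed simp
  have E_e: "E u v e" if uv: "u \<in> U" "v \<in> U" "\<omega> u v = 0" "\<omega> u e = 0" "\<omega> v e = 0" for u v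
  proof -
    have dec: "\<exists>u'\<in>W. u = u' \<or> u = u' + e" if "u \<in> U" "\<omega> u e = 0" for u
    proof -
      obtain u' a where "u' \<in> W" "a \<in> {0, e, f, e + f}" "u = u' + a" using \<open>u \<in> U\<close> by (rule U_split)
      then show ?thesis using \<open>\<omega> u e = 0\<close> by (intro bexI[of _ u']) (auto simp: form_add)
    qed
    obtain u' v' where u': "u' \<in> W" "u = u' \<or> u = u' + e" and v': "v' \<in> W" "v = v' \<or> v = v' + e"
      using dec uv by meson
    have M: "ext x * ext (x + e) = p * Z x'" if x': "x' \<in> W" "x = x' \<or> x = x' + e" for x x'
    proof -
      have "t x' * y x' = p * Z x'" "y x' * t x' = p * Z x'"
        unfolding y_def using t_inv[OF x'(1)] t_Z[OF x'(1)] p_t[OF x'(1)] p_Z[OF x'(1)]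
        by (metis mult.assoc mult_1_left mult_1_right)+
      then show ?thesis using x' ext_simps[OF x'(1)] by (auto simp: add.assoc)
    qed
    have uv': "u' + v' \<in> W" "\<omega> u' v' = 0" using u' v' W uv(3) by (auto simp: subspace2D form_add)
    have "u + v = (u' + v') \<or> u + v = (u' + v') + e" using u' v' by (auto simp: add_ac)
    then have "ext (u + v) * ext (u + v + e) * ext e = p * Z (u' + v') * p"
      using M uv' ext_e by simp
    also have "\<dots> = Z (u' + v')" using p_Z[OF uv'(1)] by (simp add: mult.assoc p_inv)
    also have "\<dots> = Z u' * Z v'" using Z_add u' v' uv' by simp
    also have "\<dots> = Z u' * p * (p * Z v')" by (simp add: mult.assoc p_inv')
    also have "\<dots> = (ext u * ext (u + e)) * (ext v * ext (v + e))"
      using M[OF u'] M[OF v'] p_Z[OF u'(1)] by simp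
    finally show ?thesis by (simp add: E_def mult.assoc)
  qed
  have E: "E u v w" if uvw: "u \<in> U" "v \<in> U" "w \<in> U" "\<omega> u v = 0" "\<omega> u w = 0" "\<omega> v w = 0" for u v w
  proof (cases "w = 0")
    case True
    then show ?thesis using inv uvw U by (simp add: E_def mult.assoc subspace2D)
  next
    case False
    have "e \<noteq> 0" using ef(3) by (metis form_zero(1) zero_neq_one)
    then obtain us where us: "set us \<subseteq> U" "act us w = e"
      using transv_transitive[OF U ndU uvw(3) ef(1) False] by blast
    have "\<omega> (act us x) e = \<omega> x w" for x using act_isometry[of us x w] us(2) by simp
    then have "E (act us u) (act us v) e"
      using uvw act_closed[OF U us(1)] by (intro E_e) auto
    then show ?thesis using E_act[of us u v w] us uvw by simp
  qed
  show ?thesis unfolding transv_rep_def using inv conj E unfolding E_def by simp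
qed

end

section \<open>Symplectic bases\<close>

lemma commute_mult:
  fixes x :: "'m::monoid_mult"
  assumes "x * a = a * x" "x * b = b * x"
  shows "x * (a * b) = a * b * x"
proof -
  have "x * (a * b) = (x * a) * b" by (simp only: mult.assoc)
  also have "\<dots> = a * (x * b)" unfolding assms(1) by (simp only: mult.assoc)
  also have "\<dots> = a * b * x" unfolding assms(2) by (simp only: mult.assoc)
  finally show ?thesis .
qed

lemmas commute_mult' = commute_mult[OF HOL.sym HOL.sym, symmetric]

context alternating_space begin

lemma transv_closure_mono: "S \<subseteq> S' \<Longrightarrow> transv_closure S \<subseteq> transv_closure S'"
proof
  show "x \<in> transv_closure S'" if "S \<subseteq> S'" "x \<in> transv_closure S" for x
    using that(2) by induction (use that(1) in \<open>auto intro: transv_closure.intros\<close>)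
qed

lemma transv_rep_centralizer:
  assumes W: "subspace2 W" and t: "transv_rep W t" and S: "S \<subseteq> W"
    and x: "\<And>s. s \<in> S \<Longrightarrow> x * t s = t s * x" and w: "w \<in> transv_closure S"
  shows "w \<in> W \<and> x * t w = t w * x"
  using w
proof induction
  case (base u)
  then show ?case using S x by auto
next
  case (step u v)
  have "x * (t u * t v * t u) = t u * t v * t u * x" using step by (intro commute_mult) auto
  then show ?case using step transv_repD(3)[OF t, of u v] transv_closed[OF W] by simp
qed

lemma word_commute: "(\<And>u. u \<in> set us \<Longrightarrow> x * t u = t u * x) \<Longrightarrow> x * word t us = word t us * x"
proof (induction us)
  case (Cons u us)
  then show ?case using commute_mult[of x "t u" "word t us"] by simp
qed simp

end

locale symplectic_basis = alternating_space \<omega>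
  for \<omega> :: "'v::ab_group_add \<Rightarrow> 'v \<Rightarrow> bit" +
  fixes n :: nat and e f :: "nat \<Rightarrow> 'v"
  assumes e_e [simp]: "i \<in> {1..n} \<Longrightarrow> j \<in> {1..n} \<Longrightarrow> \<omega> (e i) (e j) = 0"
    and f_f [simp]: "i \<in> {1..n} \<Longrightarrow> j \<in> {1..n} \<Longrightarrow> \<omega> (f i) (f j) = 0"
    and e_f [simp]: "i \<in> {1..n} \<Longrightarrow> j \<in> {1..n} \<Longrightarrow> \<omega> (e i) (f j) = (if i = j then 1 else 0)"
    and complete: "(\<And>i. i \<in> {1..n} \<Longrightarrow> \<omega> (e i) x = 0 \<and> \<omega> (f i) x = 0) \<Longrightarrow> x = 0"
begin

lemma f_e [simp]: "i \<in> {1..n} \<Longrightarrow> j \<in> {1..n} \<Longrightarrow> \<omega> (f i) (e j) = (if i = j then 1 else 0)"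
  using e_f[of j i] by (auto simp: form_commute[of "f i"])

text \<open>
  \<open>V k\<close> is the span of the first \<open>k\<close> hyperbolic planes, described as an orthogonal complement in order
  to avoid linear combinations.
\<close>

definition V :: "nat \<Rightarrow> 'v set" where
  "V k = {x. \<forall>i. k < i \<and> i \<le> n \<longrightarrow> \<omega> (e i) x = 0 \<and> \<omega> (f i) x = 0}"

lemma V_n: "V n = UNIV"
  by (auto simp: V_def)

lemma V_0: "V 0 = {0}"
  using complete by (fastforce simp: V_def)

lemma subspace2_V: "subspace2 (V k)"
  by (simp add: subspace2_def V_def form_add)

lemma V_mono: "l \<le> k \<Longrightarrow> V l \<subseteq> V k"
  by (auto simp: V_def)

lemma basis_in_V: "i \<in> {1..k} \<Longrightarrow> k \<le> n \<Longrightarrow> e i \<in> V k" "i \<in> {1..k} \<Longrightarrow> k \<le> n \<Longrightarrow> f i \<in> V k"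
  by (auto simp: V_def)

lemma V_Suc: "k < n \<Longrightarrow> perp (perp (V (Suc k)) (e (Suc k))) (f (Suc k)) = V k"
  by (auto simp: V_def perp_def) (metis Suc_lessI)+

lemma nondegenerate_V:
  assumes "k \<le> n"
  shows "nondegenerate (V k)"
  unfolding nondegenerate_def
proof (intro ballI impI)
  fix x assume x: "x \<in> V k" "x \<noteq> 0"
  have "\<exists>i\<in>{1..n}. \<omega> (e i) x \<noteq> 0 \<or> \<omega> (f i) x \<noteq> 0" using complete[of x] x by blast
  then obtain i where i: "i \<in> {1..n}" "\<omega> (e i) x = 1 \<or> \<omega> (f i) x = 1" by auto
  then have "i \<le> k" using x by (force simp: V_def not_le[symmetric])
  then show "\<exists>y\<in>V k. \<omega> x y = 1"
    using i basis_in_V[of i k] assms by (auto simp: form_commute[of x])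
qed

lemma basis_nonzero: "i \<in> {1..n} \<Longrightarrow> e i \<noteq> 0"
  using e_f[of i i] by (metis form_zero(1) zero_neq_one)

text \<open>The vectors of the involutions \<open>p\<close>, \<open>h\<close> and \<open>q\<close> on the first \<open>k\<close> sites.\<close>

definition gen_vectors :: "nat \<Rightarrow> 'v set" where
  "gen_vectors k = e ` {1..k} \<union> (\<lambda>i. e i + f i) ` {1..k} \<union> (\<lambda>j. e j + e (Suc j)) ` {1..<k}"

lemma gen_vectors_in_V: "k \<le> n \<Longrightarrow> gen_vectors k \<subseteq> V k"
  by (auto simp: gen_vectors_def intro!: subspace2D(2)[OF subspace2_V] basis_in_V)

lemma V_closure: "k \<le> n \<Longrightarrow> V k - {0} \<subseteq> transv_closure (gen_vectors k)"
proof (induction k)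
  case 0
  then show ?case by (simp add: V_0)
next
  case (Suc k)
  then have k: "k < n" by simp
  let ?S = "gen_vectors (Suc k)"
  show ?case
  proof (rule transv_closure_hyperbolic[of "V (Suc k)" "e (Suc k)" "f (Suc k)", OF subspace2_V, unfolded V_Suc[OF k]])
    have "transv_closure (gen_vectors k) \<subseteq> transv_closure ?S"
      by (rule transv_closure_mono) (auto simp: gen_vectors_def)
    then show "V k - {0} \<subseteq> transv_closure ?S" using Suc by auto
    show "\<exists>v\<in>V k. v \<noteq> 0 \<and> v + e (Suc k) \<in> ?S" if "V k \<noteq> {0}"
    proof -
      have "k \<noteq> 0" using that by (auto simp: V_0)
      then show ?thesis using k basis_in_V[of k k] basis_nonzero[of k]
        by (intro bexI[of _ "e k"]) (auto simp: gen_vectors_def)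
    qed
  qed (use k nondegenerate_V[of k] basis_in_V[of "Suc k" "Suc k"] in \<open>auto simp: gen_vectors_def\<close>)
qed

end

section \<open>The transvections in the presented group\<close>

text \<open>
  The defining relations in terms of the involutions \<open>p, h, q\<close>. In B2 and B3 the letters
  \<open>Z\<^sub>j\<close> are replaced by \<open>q\<^sub>j p\<^sub>j p\<^sub>j\<^sub>+\<^sub>1\<close>.
\<close>

locale sp_relations = symplectic_basis \<omega> n e f
  for \<omega> :: "'v::ab_group_add \<Rightarrow> 'v \<Rightarrow> bit" and n e f +
  fixes p h q :: "nat \<Rightarrow> 'm::monoid_mult"
  assumes p_inv: "i \<in> {1..n} \<Longrightarrow> p i * p i = 1"
    and h_inv: "i \<in> {1..n} \<Longrightarrow> h i * h i = 1"
    and q_inv: "i \<in> {1..<n} \<Longrightarrow> q i * q i = 1"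
    and p_p: "i \<in> {1..n} \<Longrightarrow> j \<in> {1..n} \<Longrightarrow> p i * p j = p j * p i"
    and h_h: "i \<in> {1..n} \<Longrightarrow> j \<in> {1..n} \<Longrightarrow> h i * h j = h j * h i"
    and q_q: "i \<in> {1..<n} \<Longrightarrow> j \<in> {1..<n} \<Longrightarrow> q i * q j = q j * q i"
    and p_q: "i \<in> {1..n} \<Longrightarrow> j \<in> {1..<n} \<Longrightarrow> p i * q j = q j * p i"
    and p_h: "i \<in> {1..n} \<Longrightarrow> j \<in> {1..n} \<Longrightarrow> i \<noteq> j \<Longrightarrow> p i * h j = h j * p i"
    and h_q: "i \<in> {1..n} \<Longrightarrow> j \<in> {1..<n} \<Longrightarrow> i \<noteq> j \<Longrightarrow> i \<noteq> Suc j \<Longrightarrow> h i * q j = q j * h i"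
    and ph_braid: "i \<in> {1..n} \<Longrightarrow> p i * h i * p i = h i * p i * h i"
    and hq_braid: "i \<in> {1..n} \<Longrightarrow> j \<in> {1..<n} \<Longrightarrow> i = j \<or> i = Suc j \<Longrightarrow> h i * q j * h i = q j * h i * q j"
    and B2: "1 \<le> j \<Longrightarrow> Suc (Suc j) \<le> n \<Longrightarrow>
      w = q (Suc j) * p (Suc (Suc j)) * p (Suc j) * h j * h (Suc j) * p j * q j * p (Suc j) * h j * h (Suc j)
        * p j * q j * p (Suc j) \<Longrightarrow> w * w * w = 1"
    and B3: "1 \<le> j \<Longrightarrow> Suc (Suc j) \<le> n \<Longrightarrow>
      w = q j * p j * p (Suc j) * h (Suc (Suc j)) * h (Suc j) * p (Suc (Suc j)) * q (Suc j) * p (Suc j)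
        * h (Suc (Suc j)) * h (Suc j) * p (Suc (Suc j)) * q (Suc j) * p (Suc j) \<Longrightarrow> w * w * w = 1"
begin

text \<open>
  The elements that will turn out to be the transvections at \<open>e j + e (Suc j) + e (Suc (Suc j))\<close> and
  at \<open>e j + e (Suc (Suc j))\<close>.
\<close>

definition c where
  "c j = h (Suc j) * p (Suc j) * q j * h (Suc j) * q (Suc j) * h (Suc j) * q j * p (Suc j) * h (Suc j)"

definition d where
  "d j = h j * p j * q j * h j * c j * h j * q j * p j * h j"

lemma three_sites:
  assumes j: "1 \<le> j" "Suc (Suc j) \<le> n"
  shows "q (Suc j) * d j = d j * q (Suc j)"
    and "q (Suc j) * h (Suc (Suc j)) * d j * h (Suc (Suc j)) * q (Suc j)
      = p (Suc (Suc j)) * h (Suc (Suc j)) * c j * h (Suc (Suc j)) * p (Suc (Suc j))"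
    and "p (Suc j) * p (Suc (Suc j)) * q (Suc j) * p j * p (Suc (Suc j)) * d j
      = q j * p (Suc (Suc j)) * c j"
proof -
  define s where "s = (!) [1, p j, h j, q j, h (Suc j), q (Suc j), h (Suc (Suc j)), p (Suc (Suc j))]"
  have s: "s 1 = p j" "s 2 = h j" "s 3 = q j" "s 4 = h (Suc j)" "s 5 = q (Suc j)"
    "s 6 = h (Suc (Suc j))" "s 7 = p (Suc (Suc j))"
    by (simp_all add: s_def)
  have seven: "i \<in> {1..7} \<Longrightarrow> i = 1 \<or> i = 2 \<or> i = 3 \<or> i = 4 \<or> i = 5 \<or> i = 6 \<or> i = 7" for i :: nat
    by auto
  note comm = p_p p_q p_h h_h q_q h_q
  note comm' = p_q[symmetric] p_h[symmetric] h_q[symmetric]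
  interpret E: affine_E7 s "p (Suc j)"
  proof
    fix i l :: nat
    show "s i * s i = 1" if "i \<in> {1..7}"
      using seven[OF that] j p_inv h_inv q_inv by (elim disjE) (simp_all add: s del: One_nat_def)
    show "s i * s l = s l * s i" if "i \<in> {1..7}" "l \<in> {1..7}" "l + 2 \<le> i"
      using seven[OF that(1)] seven[OF that(2)] that(3) j
      by (elim disjE) (simp_all add: s del: One_nat_def, (rule comm comm'; simp)+)
    show "s i * s l * s i = s l * s i * s l" if "i \<in> {1..7}" "l \<in> {1..7}" "i = l + 1"
      using seven[OF that(1)] seven[OF that(2)] that(3) j
      by (elim disjE)
        (simp_all add: s del: One_nat_def,
          (rule hq_braid ph_braid hq_braid[symmetric] ph_braid[symmetric]; simp)+)
    show "p (Suc j) * s i = s i * p (Suc j)" if "i \<in> {1..7}" "i \<noteq> 4"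
      using seven[OF that(1)] that(2) j
      by (elim disjE) (simp_all add: s del: One_nat_def, (rule comm comm'; simp)+)
    show "p (Suc j) * p (Suc j) = 1" using p_inv j by simp
    show "p (Suc j) * s 4 * p (Suc j) = s 4 * p (Suc j) * s 4" using ph_braid j by (simp add: s)
  qed
  have c: "E.c = c j" by (simp add: E.c_conj c_def s)
  have d: "E.d = d j" unfolding E.d_def d_def c s ..
  have B: "s 5 * s 7 * p (Suc j) * s 2 * s 4 * s 1 * s 3 * p (Suc j) * s 2 * s 4 * s 1 * s 3 * p (Suc j)
      * (s 5 * s 7 * p (Suc j) * s 2 * s 4 * s 1 * s 3 * p (Suc j) * s 2 * s 4 * s 1 * s 3 * p (Suc j))
      * (s 5 * s 7 * p (Suc j) * s 2 * s 4 * s 1 * s 3 * p (Suc j) * s 2 * s 4 * s 1 * s 3 * p (Suc j)) = 1"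
    unfolding s by (rule B2[OF j HOL.refl])
  have B': "s 3 * s 1 * p (Suc j) * s 6 * s 4 * s 7 * s 5 * p (Suc j) * s 6 * s 4 * s 7 * s 5 * p (Suc j)
      * (s 3 * s 1 * p (Suc j) * s 6 * s 4 * s 7 * s 5 * p (Suc j) * s 6 * s 4 * s 7 * s 5 * p (Suc j))
      * (s 3 * s 1 * p (Suc j) * s 6 * s 4 * s 7 * s 5 * p (Suc j) * s 6 * s 4 * s 7 * s 5 * p (Suc j)) = 1"
    unfolding s by (rule B3[OF j HOL.refl])
  note E.three_site_relations[OF HOL.refl B HOL.refl B', unfolded c d s]
  then show "q (Suc j) * d j = d j * q (Suc j)"
    and "q (Suc j) * h (Suc (Suc j)) * d j * h (Suc (Suc j)) * q (Suc j)
      = p (Suc (Suc j)) * h (Suc (Suc j)) * c j * h (Suc (Suc j)) * p (Suc (Suc j))"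
    and "p (Suc j) * p (Suc (Suc j)) * q (Suc j) * p j * p (Suc (Suc j)) * d j
      = q j * p (Suc (Suc j)) * c j" by auto
qed

end

text \<open>
  The inductive step: a family on \<open>V k\<close> that has the right values on the generators is extended to
  \<open>V (Suc k)\<close>.
\<close>

locale sp_step = sp_relations \<omega> n e f p h q
  for \<omega> :: "'v::ab_group_add \<Rightarrow> 'v \<Rightarrow> bit" and n e f and p h q :: "nat \<Rightarrow> 'm::monoid_mult" +
  fixes k :: nat and t :: "'v \<Rightarrow> 'm"
  assumes k: "k < n" and t: "transv_rep (V k) t"
    and t_e: "i \<in> {1..k} \<Longrightarrow> t (e i) = p i"
    and t_ef: "i \<in> {1..k} \<Longrightarrow> t (e i + f i) = h i"
    and t_ee: "i \<in> {1..<k} \<Longrightarrow> t (e i + e (Suc i)) = q i"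
begin

lemma V_k: "subspace2 (V k)" "nondegenerate (V k)"
  using subspace2_V nondegenerate_V k by auto

lemma commutes_V:
  assumes "l \<le> k" "w \<in> V l"
    and "\<And>i. i \<in> {1..l} \<Longrightarrow> x * p i = p i * x" "\<And>i. i \<in> {1..l} \<Longrightarrow> x * h i = h i * x"
    and "\<And>i. i \<in> {1..<l} \<Longrightarrow> x * q i = q i * x"
  shows "x * t w = t w * x"
proof (cases "w = 0")
  case True
  then show ?thesis using transv_repD(1)[OF t] by simp
next
  case False
  have "x * t s = t s * x" if "s \<in> gen_vectors l" for s
    using that assms t_e t_ef t_ee by (auto simp: gen_vectors_def)
  moreover have "w \<in> transv_closure (gen_vectors l)" using V_closure[of l] assms k False by auto
  moreover have "gen_vectors l \<subseteq> V k" using gen_vectors_in_V[of l] V_mono[OF assms(1)] assms k by auto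
  ultimately show ?thesis using transv_rep_centralizer[OF V_k(1) t] by blast
qed

definition z :: 'm where
  "z = p k * p (Suc k) * q k"

lemma z_inv: "k \<noteq> 0 \<Longrightarrow> z * z = 1"
proof -
  assume k0: "k \<noteq> 0"
  have [simp]: "q k * p k = p k * q k" "q k * p (Suc k) = p (Suc k) * q k" "p (Suc k) * p k = p k * p (Suc k)"
    using p_q[of k k] p_q[of "Suc k" k] p_p[of "Suc k" k] k k0 by auto
  have [simp]: "q k * (p k * x) = p k * (q k * x)" "q k * (p (Suc k) * x) = p (Suc k) * (q k * x)"
    "p (Suc k) * (p k * x) = p k * (p (Suc k) * x)" for x
    by (simp_all flip: mult.assoc)
  have [simp]: "p k * (p k * x) = x" "p (Suc k) * (p (Suc k) * x) = x" "q k * q k = 1" "p k * p k = 1" "p (Suc k) * p (Suc k) = 1" for x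
    using p_inv[of k] p_inv[of "Suc k"] q_inv[of k] k k0 by (simp_all flip: mult.assoc)
  show ?thesis by (simp add: z_def mult.assoc)
qed

text \<open>
  \<open>z\<close> is \<open>Z\<^sub>k\<close>. A vector of \<open>V k\<close> orthogonal to \<open>e k\<close> is \<open>u\<close> or \<open>u + e k\<close> with \<open>u\<close> on the sites
  before \<open>k\<close>. Generators on those sites commute with \<open>Z\<^sub>k\<close>, and for \<open>u \<noteq> 0\<close> the element
  \<open>t (u + e k)\<close> is a conjugate of \<open>q\<^sub>k\<^sub>-\<^sub>1\<close> by a word in them.
\<close>

lemma z_commute:
  assumes k0: "k \<noteq> 0" and w: "w \<in> V k" "\<omega> (e k) w = 0"
  shows "z * t w = t w * z"
proof -
  obtain l where l: "k = Suc l" using k0 by (cases k) auto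
  have low: "z * t u = t u * z" if "u \<in> V l" for u
  proof (rule commutes_V[OF _ that])
    show "z * p i = p i * z" if "i \<in> {1..l}" for i
      unfolding z_def using that k l by (intro commute_mult' p_p p_q[symmetric]) auto
    show "z * h i = h i * z" if "i \<in> {1..l}" for i
      unfolding z_def using that k l by (intro commute_mult' p_h h_q[symmetric]) auto
    show "z * q i = q i * z" if "i \<in> {1..<l}" for i
      unfolding z_def using that k l by (intro commute_mult' p_q q_q) auto
  qed (use l in simp)
  have z_p: "z * p k = p k * z" unfolding z_def using k k0 by (intro commute_mult' p_p p_q[symmetric]) auto
  obtain u a where u: "u \<in> V l" and a: "a \<in> {0, e k, f k, e k + f k}" and wu: "w = u + a"
    using hyperbolic_split[of "V (Suc l)" "e (Suc l)" "f (Suc l)" w] subspace2_V basis_in_V[of k k] k l w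
      V_Suc[of l] by (auto simp del: One_nat_def)
  have "\<omega> (e k) u = 0" using u k l by (auto simp: V_def)
  then have "a = 0 \<or> a = e k" using a wu w(2) k k0 by (auto simp: form_add)
  then consider "w = u" | "w = e k" | "w = u + e k" "u \<noteq> 0"
    using wu by (cases "u = 0") auto
  then show ?thesis
  proof cases
    case 1
    then show ?thesis using low u by simp
  next
    case 2
    have "k \<in> {1..k}" using k0 by simp
    then show ?thesis unfolding 2 by (simp only: t_e z_p)
  next
    case 3
    have l0: "l \<noteq> 0"
    proof
      assume "l = 0"
      then have "u \<in> {0}" using u V_0 by metis
      then show False using 3(2) by simp
    qed
    have ln: "l \<le> n" "l \<in> {1..l}" "l \<in> {1..n}" using k l l0 by auto
    obtain us where us: "set us \<subseteq> V l" "act us (e l) = u"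
      using transv_transitive[OF subspace2_V nondegenerate_V[OF ln(1)] basis_in_V(1)[OF ln(2,1)] u
          basis_nonzero[OF ln(3)] 3(2)] .
    have "\<omega> x (e k) = 0" if "x \<in> V l" for x
      using that k l by (auto simp: V_def form_commute[of x])
    then have "act us (e k) = e k" using us(1) by (intro act_orthogonal) auto
    then have "act us (e l + e k) = w" using us(2) 3(1) by (simp add: act_add)
    moreover have "set us \<subseteq> V k" using us(1) V_mono[of l k] l by auto
    moreover have "e l + e k \<in> V k" using basis_in_V[of _ k] k l l0 by (intro subspace2D(2)[OF V_k(1)]) auto
    ultimately have "t w = word t us * t (e l + e k) * word t (rev us)"
      using word_conj[OF V_k(1) t, of us "e l + e k"] by simp
    also have "t (e l + e k) = q l" using t_ee[of l] l l0 by auto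
    finally have "t w = word t us * q l * word t (rev us)" .
    moreover have "z * word t us = word t us * z" "z * word t (rev us) = word t (rev us) * z"
      using us(1) low by (auto intro!: word_commute)
    moreover have "z * q l = q l * z"
      unfolding z_def using k l l0 by (intro commute_mult' p_q q_q) auto
    ultimately show ?thesis by (simp only: commute_mult)
  qed
qed

definition Z :: "'v \<Rightarrow> 'm" where
  "Z v = (if v = 0 then 1 else
     let us = SOME us. set us \<subseteq> V k \<and> act us (e k) = v in word t us * z * word t (rev us))"

lemma k_pos: "v \<in> V k \<Longrightarrow> v \<noteq> 0 \<Longrightarrow> k \<noteq> 0"
  by (cases k) (auto simp: V_0)

lemma reach:
  assumes "v \<in> V k" "v \<noteq> 0"
  obtains us where "set us \<subseteq> V k" "act us (e k) = v"
proof -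
  have "k \<noteq> 0" using k_pos assms by blast
  then have "e k \<in> V k" "e k \<noteq> 0" using basis_in_V[of k k] basis_nonzero[of k] k by auto
  then show ?thesis using transv_transitive[OF V_k _ assms(1) _ assms(2)] that by blast
qed

text \<open>
  The choice of the word is irrelevant: two words that map \<open>e k\<close> to \<open>v\<close> differ by an element of the
  stabiliser of \<open>e k\<close>, which commutes with \<open>z\<close> by \<open>weq_stabilizer\<close> and \<open>z_commute\<close>.
\<close>

lemma Z_eq:
  assumes us: "set us \<subseteq> V k" "act us (e k) = v" and v: "v \<in> V k" "v \<noteq> 0"
  shows "Z v = word t us * z * word t (rev us)"
proof -
  note k0 = k_pos[OF v]
  have ek: "e k \<in> V k" using basis_in_V k k0 by simp
  define us' where "us' = (SOME us. set us \<subseteq> V k \<and> act us (e k) = v)"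
  have us': "set us' \<subseteq> V k" "act us' (e k) = v"
    using someI[of "\<lambda>us. set us \<subseteq> V k \<and> act us (e k) = v" us] us unfolding us'_def by auto
  have "act (rev us' @ us) (e k) = e k" using us us'(2)[symmetric] by simp
  then obtain vs where vs: "set vs \<subseteq> perp (V k) (e k)" "weq t (rev us' @ us) vs"
    using weq_stabilizer[OF V_k(1) t ek, of "rev us' @ us"] us us' by auto
  have "z * word t vs = word t vs * z"
    using vs(1) z_commute[OF k0] by (intro word_commute) (auto simp: perp_def)
  then have comm: "z * (word t (rev us') * word t us) = word t (rev us') * word t us * z"
    using weqD(1)[OF vs(2)] by simp
  note inv = word_rev[OF t us(1)] word_rev[OF t us'(1)]
  have "word t us' * z * word t (rev us') = word t us' * z * word t (rev us') * (word t us * word t (rev us))"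
    using inv by simp
  also have "\<dots> = word t us' * (z * (word t (rev us') * word t us)) * word t (rev us)"
    by (simp add: mult.assoc)
  also have "\<dots> = (word t us' * word t (rev us')) * word t us * z * word t (rev us)"
    unfolding comm by (simp add: mult.assoc)
  also have "\<dots> = word t us * z * word t (rev us)" using inv by simp
  finally show ?thesis using v unfolding Z_def us'_def[symmetric] by (simp add: Let_def)
qed

lemma Z_0: "Z 0 = 1"
  by (simp add: Z_def)

lemma Z_inv: assumes "v \<in> V k" shows "Z v * Z v = 1"
proof (cases "v = 0")
  case False
  then obtain us where us: "set us \<subseteq> V k" "act us (e k) = v" using reach assms by blast
  have "Z v * Z v = word t us * (z * (word t (rev us) * word t us) * z) * word t (rev us)"
    using Z_eq[OF us assms False] by (simp add: mult.assoc)
  then show ?thesis using word_rev[OF t us(1)] z_inv k_pos[OF assms False] by simp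
qed (simp add: Z_0)

lemma Z_conj: assumes "v \<in> V k" "w \<in> V k" shows "t w * Z v * t w = Z (transv w v)"
proof (cases "v = 0")
  case False
  then obtain us where us: "set us \<subseteq> V k" "act us (e k) = v" using reach assms by blast
  have "Z (transv w v) = word t (w # us) * z * word t (rev (w # us))"
    using us assms False transv_closed[OF V_k(1)] by (intro Z_eq) auto
  then show ?thesis using Z_eq[OF us assms(1) False] by (simp add: mult.assoc)
qed (use transv_repD(2)[OF t] assms in \<open>simp add: Z_0\<close>)

lemma Suc_k_commutes:
  assumes "v \<in> V k"
  shows "p (Suc k) * t v = t v * p (Suc k)" "h (Suc k) * t v = t v * h (Suc k)"
  using assms k by (auto intro!: commutes_V[of k] p_p p_h p_h[symmetric] h_h p_q h_q)

lemma p_Z: assumes "v \<in> V k" shows "p (Suc k) * Z v = Z v * p (Suc k)"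
proof (cases "v = 0")
  case False
  then obtain us where us: "set us \<subseteq> V k" "act us (e k) = v" using reach assms by blast
  have k0: "k \<noteq> 0" using k_pos assms False by blast
  have "p (Suc k) * z = z * p (Suc k)"
    unfolding z_def using k k0 by (intro commute_mult p_p p_q) auto
  moreover have "p (Suc k) * word t us = word t us * p (Suc k)" "p (Suc k) * word t (rev us) = word t (rev us) * p (Suc k)"
    using us(1) Suc_k_commutes by (auto intro!: word_commute)
  ultimately show ?thesis unfolding Z_eq[OF us assms False] by (simp only: commute_mult)
qed (simp add: Z_0)

sublocale X: rep_extension \<omega> "V (Suc k)" "V k" "e (Suc k)" "f (Suc k)" t Z "p (Suc k)" "h (Suc k)"
proof
  show "V k = perp (perp (V (Suc k)) (e (Suc k))) (f (Suc k))" using V_Suc[OF k] ..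
  show "p (Suc k) * h (Suc k) * p (Suc k) = h (Suc k) * p (Suc k) * h (Suc k)" using ph_braid k by simp
qed (use k subspace2_V basis_in_V V_k t p_inv h_inv Suc_k_commutes Z_0 Z_inv Z_conj p_Z in auto)

end

text \<open>
  The identities needed on two sites. For the braid rules think of \<open>h, q\<close> as the transpositions
  \<open>(1 2), (2 3)\<close>, of \<open>p\<close> as \<open>(1 4)\<close>, and of \<open>h'\<close> as \<open>(3 4)\<close>.
\<close>

lemma conj_commuting:
  fixes x :: "'m::monoid_mult"
  assumes "x * q = q * x" "q * q = 1"
  shows "q * x * q = x"
  by (simp add: mult.assoc assms(1)) (simp add: assms(2) flip: mult.assoc)

lemma conj_braid:
  fixes h :: "'m::monoid_mult"
  assumes "p * q = q * p" "h * p * h = p * h * p" "h * q * h = q * h * q"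
  shows "q * (h * p * h) * q = p * (h * q * h) * p"
proof -
  have "q * (h * p * h) * q = (q * p) * h * (p * q)" unfolding assms(2) by (simp only: mult.assoc)
  also have "\<dots> = (p * q) * h * (q * p)" unfolding assms(1) ..
  also have "\<dots> = p * (h * q * h) * p" unfolding assms(3) by (simp only: mult.assoc)
  finally show ?thesis .
qed

lemma conj_braid_self:
  fixes h :: "'m::monoid_mult"
  assumes "q * q = 1" "h * q * h = q * h * q"
  shows "q * (h * q * h) * q = h"
proof -
  have "q * (h * q * h) * q = (q * q) * h * (q * q)" unfolding assms(2) by (simp only: mult.assoc)
  then show ?thesis by (simp add: assms(1))
qed

lemma conj_braid_pair:
  fixes h :: "'m::monoid_mult"
  assumes "h * q * h = q * h * q" "h' * q * h' = q * h' * q" "h * h' = h' * h" "h' * h' = 1"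
  shows "q * (h' * (h * q * h) * h') * q = h' * (h * q * h) * h'"
proof -
  have "q * (h' * (h * q * h) * h') * q = (q * h' * q) * h * (q * h' * q)"
    unfolding assms(1) by (simp only: mult.assoc)
  also have "\<dots> = h' * q * (h' * h) * h' * q * h'" unfolding assms(2)[symmetric] by (simp only: mult.assoc)
  also have "\<dots> = h' * q * h * (h' * h') * q * h'" unfolding assms(3)[symmetric] by (simp only: mult.assoc)
  also have "\<dots> = h' * (q * h * q) * h'" unfolding assms(4) by (simp add: mult.assoc)
  finally show ?thesis unfolding assms(1) .
qed

context sp_step begin

lemma y_k:
  assumes k0: "k \<noteq> 0"
  shows "X.y (e k) = q k"
proof -
  have ek: "e k \<in> V k" "e k \<noteq> 0" using basis_in_V[of k k] basis_nonzero[of k] k k0 by auto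
  have comm: "p (Suc k) * p k = p k * p (Suc k)" using p_p[of "Suc k" k] k k0 by simp
  have "Z (e k) = z" using Z_eq[of "[]" "e k"] ek by simp
  then have "X.y (e k) = p k * p (Suc k) * (p k * p (Suc k)) * q k"
    using t_e[of k] k0 by (simp add: X.y_def z_def mult.assoc)
  also have "p k * p (Suc k) * (p k * p (Suc k)) = p k * (p (Suc k) * p k) * p (Suc k)"
    by (simp only: mult.assoc)
  also have "\<dots> = (p k * p k) * (p (Suc k) * p (Suc k))"
    unfolding comm by (simp only: mult.assoc)
  also have "\<dots> = 1" using p_inv k k0 by simp
  finally show ?thesis by simp
qed

text \<open>
  Since \<open>y\<close> is equivariant, its values are conjugates of \<open>y (e k) = q k\<close> along any path of generators;
  these paths spell the definitions of \<open>c\<close> and \<open>d\<close>.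
\<close>

lemma y_c_d:
  assumes j: "k = Suc j" "1 \<le> j"
  shows "X.y (e j + e k) = c j" and "X.y (e j) = d j"
proof -
  have in_V: "e j \<in> V k" "f j \<in> V k" "e k \<in> V k" "f k \<in> V k"
    using basis_in_V[of j k] basis_in_V[of k k] j k by auto
  note sub = subspace2D[OF V_k(1)]
  have ts: "t (e j) = p j" "t (e k) = p k" "t (e j + f j) = h j" "t (e k + f k) = h k" "t (e j + e k) = q j"
    using t_e[of j] t_e[of k] t_ef[of j] t_ef[of k] t_ee[of j] j by auto
  have forms: "\<omega> (e j) (e k) = 0" "\<omega> (e j) (f k) = 0" "\<omega> (f j) (e k) = 0" "\<omega> (f j) (f k) = 0"
    "\<omega> (e k) (e j) = 0" "\<omega> (f k) (e j) = 0" "\<omega> (e k) (f j) = 0" "\<omega> (f k) (f j) = 0"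
    "\<omega> (e j) (f j) = 1" "\<omega> (f j) (e j) = 1" "\<omega> (e k) (f k) = 1" "\<omega> (f k) (e k) = 1"
    using j k by auto
  have "act [e k + f k, e k, e j + e k, e k + f k] (e k) = e j + e k"
    by (simp add: transv_def form_add forms add_ac)
  then show c: "X.y (e j + e k) = c j"
    using X.y_act[of "[e k + f k, e k, e j + e k, e k + f k]" "e k"] in_V sub y_k ts j
    by (simp add: c_def mult.assoc)
  have "act [e j + f j, e j, e j + e k, e j + f j] (e j + e k) = e j"
    by (simp add: transv_def form_add forms add_ac)
  then show "X.y (e j) = d j"
    using X.y_act[of "[e j + f j, e j, e j + e k, e j + f j]" "e j + e k"] in_V sub c ts
    by (simp add: d_def mult.assoc)
qed

lemma Z_act: "set us \<subseteq> V k \<Longrightarrow> v \<in> V k \<Longrightarrow> word t us * Z v * word t (rev us) = Z (act us v)"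
proof (induction us)
  case (Cons u us)
  have "word t (u # us) * Z v * word t (rev (u # us)) = t u * (word t us * Z v * word t (rev us)) * t u"
    by (simp add: mult.assoc)
  also have "\<dots> = Z (act (u # us) v)"
    using Cons Z_conj[of "act us v" u] act_closed[OF V_k(1), of us v] by simp
  finally show ?case .
qed simp

lemma Z_add_act:
  assumes us: "set us \<subseteq> V k" and vw: "v \<in> V k" "w \<in> V k" and eq: "Z v * Z w = Z (v + w)"
  shows "Z (act us v) * Z (act us w) = Z (act us (v + w))"
proof -
  have "Z (act us v) * Z (act us w)
      = word t us * Z v * (word t (rev us) * word t us) * Z w * word t (rev us)"
    unfolding Z_act[OF us vw(1), symmetric] Z_act[OF us vw(2), symmetric] by (simp only: mult.assoc)
  also have "\<dots> = word t us * (Z v * Z w) * word t (rev us)"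
    unfolding word_rev(2)[OF t us] by (simp add: mult.assoc)
  also have "\<dots> = Z (act us (v + w))"
    unfolding eq using us vw subspace2D[OF V_k(1)] by (simp add: Z_act)
  finally show ?thesis .
qed

lemma V_orthogonal: "l < i \<Longrightarrow> i \<le> n \<Longrightarrow> x \<in> V l \<Longrightarrow> \<omega> x (e i) = 0" "l < i \<Longrightarrow> i \<le> n \<Longrightarrow> x \<in> V l \<Longrightarrow> \<omega> (e i) x = 0"
  "l < i \<Longrightarrow> i \<le> n \<Longrightarrow> x \<in> V l \<Longrightarrow> \<omega> x (f i) = 0" "l < i \<Longrightarrow> i \<le> n \<Longrightarrow> x \<in> V l \<Longrightarrow> \<omega> (f i) x = 0"
  by (auto simp: V_def form_commute[of x])

lemma e_k_perp_split:
  assumes k0: "k \<noteq> 0" and w: "w \<in> V k" "\<omega> (e k) w = 0"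
  obtains u where "u \<in> V (k - 1)" "w = u \<or> w = u + e k"
proof -
  obtain l where l: "k = Suc l" using k0 by (cases k) auto
  have ef: "e k \<in> V k" "f k \<in> V k" "\<omega> (e k) (f k) = 1" using basis_in_V[of k k] k k0 by auto
  obtain u a where u: "u \<in> perp (perp (V k) (e k)) (f k)" and a: "a \<in> {0, e k, f k, e k + f k}" and wu: "w = u + a"
    using hyperbolic_split[OF subspace2_V ef w(1)] .
  have u': "u \<in> V l" using u V_Suc[of l] k by (simp add: l)
  then have "\<omega> (e k) u = 0" using V_orthogonal(2)[of l k u] l k by simp
  moreover have "\<omega> (e k) (e k) = 0" by simp
  ultimately have "a = 0 \<or> a = e k" using a ef(3) w(2) unfolding wu by (auto simp: form_add)
  then show ?thesis using that[of u] u' wu l by auto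
qed

text \<open>
  The stabiliser of \<open>e k\<close> has at most two orbits on \<open>V k\<close> besides those of \<open>0\<close> and \<open>e k\<close>. This lemma
  and the next provide representatives: \<open>e j\<close> for the preceding site \<open>j\<close>, and \<open>f k\<close>.
\<close>

lemma reach_low:
  assumes j: "k = Suc j" "1 \<le> j" and v: "v \<in> V k" "\<omega> (e k) v = 0" "v \<noteq> 0" "v \<noteq> e k"
  obtains us where "set us \<subseteq> perp (V k) (e k)" "act us (e j) = v"
proof -
  have jn: "j \<le> n" "j \<in> {1..j}" "j \<in> {1..n}" using j k by auto
  obtain u where u: "u \<in> V j" "v = u \<or> v = u + e k"
    using e_k_perp_split[of v] v j by auto
  have u0: "u \<noteq> 0" using u v by auto
  have Vj: "V j \<subseteq> perp (V k) (e k)"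
    using V_mono[of j k] V_orthogonal(2)[of j k] j k by (auto simp: perp_def)
  have ek: "e k \<in> V k" using basis_in_V[of k k] k j by auto
  obtain us where us: "set us \<subseteq> V j" "act us (e j) = u"
    using transv_transitive[OF subspace2_V nondegenerate_V[OF jn(1)] basis_in_V(1)[OF jn(2,1)] u(1)
        basis_nonzero[OF jn(3)] u0] .
  show ?thesis
  proof (cases "v = u")
    case True
    then show ?thesis using that[of us] us Vj by auto
  next
    case False
    obtain w where w: "w \<in> V j" "\<omega> u w = 1" using nondegenerate_V[OF jn(1)] u(1) u0 by (auto simp: nondegenerate_def)
    have wu: "\<omega> w u = 1" using w(2) form_commute[of w u] by simp
    have o: "\<omega> (e k) u = 0" "\<omega> (e k) w = 0" using V_orthogonal(2)[of j k] u(1) w(1) j k by auto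
    (* u is moved to u + w and then to u + e k *)
    have "act ([w + e k, w] @ us) (e j) = v"
      using us(2) False u(2) wu o by (simp add: transv_def form_add add_ac)
    moreover have "set ([w + e k, w] @ us) \<subseteq> perp (V k) (e k)"
      using us(1) w(1) Vj o ek subspace2D[OF V_k(1)] by (auto simp: perp_def form_add)
    ultimately show ?thesis using that by blast
  qed
qed

lemma reach_crossing:
  assumes k0: "k \<noteq> 0" and v: "v \<in> V k" "\<omega> (e k) v = 1"
  obtains us where "set us \<subseteq> perp (V k) (e k)" "act us (f k) = v"
proof -
  have ef: "e k \<in> V k" "f k \<in> V k" "\<omega> (e k) (f k) = 1" "\<omega> (f k) (e k) = 1"
    using basis_in_V[of k k] k k0 by auto
  have ve: "\<omega> v (e k) = 1" using v by (simp add: form_commute[of v])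
  show ?thesis
  proof (cases "\<omega> v (f k) = 1")
    case True
    then have "act [v + f k] (f k) = v" using ef by (simp add: transv_def form_add add_ac)
    moreover have "set [v + f k] \<subseteq> perp (V k) (e k)"
      using v ef subspace2D[OF V_k(1)] by (simp add: perp_def form_add)
    ultimately show ?thesis using that by blast
  next
    case False
    then have "act [v + f k + e k, e k] (f k) = v" using ef ve by (simp add: transv_def form_add add_ac)
    moreover have "set [v + f k + e k, e k] \<subseteq> perp (V k) (e k)"
      using v ef subspace2D[OF V_k(1)] by (simp add: perp_def form_add)
    ultimately show ?thesis using that by blast
  qed
qed

text \<open>
  Moving \<open>v\<close> to \<open>e k\<close>, discarding multiples of \<open>e k\<close> in \<open>w\<close>, and moving \<open>w\<close> to \<open>e j\<close> on the
  preceding site leaves one instance, which is the third identity on three sites.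
\<close>

lemma Z_add:
  assumes vw: "v \<in> V k" "w \<in> V k" "\<omega> v w = 0"
  shows "Z v * Z w = Z (v + w)"
proof (cases "v = 0")
  case True
  then show ?thesis by (simp add: Z_0)
next
  case False
  have k0: "k \<noteq> 0" using k_pos[OF vw(1) False] .
  have ek: "e k \<in> V k" using basis_in_V[of k k] k k0 by auto
  note sub = subspace2D[OF V_k(1)]
  have low: "Z (e k) * Z u = Z (e k + u)" if u: "u \<in> V (k - 1)" for u
  proof (cases "u = 0")
    case True
    then show ?thesis by (simp add: Z_0)
  next
    case False
    obtain j where j: "k = Suc j" using k0 by (cases k) auto
    have j0: "1 \<le> j" using u V_0 False j by (cases j) auto
    have in_V: "e j \<in> V k" "e j + e k \<in> V k" "u \<in> V k"
      using basis_in_V[of j k] ek sub j k V_mono[of j k] u j0 by auto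
    have ts: "t (e k) = p k" "t (e j) = p j" "t (e j + e k) = q j"
      using t_e[of k] t_e[of j] t_ee[of j] j j0 by auto
    have "Z (e k) * Z (e j) = Z (e j + e k)"
      using three_sites(3)[of j] X.Z_y[OF in_V(1)] X.Z_y[OF in_V(2)] X.Z_y[OF ek] y_c_d[OF j j0]
        y_k[OF k0] ts j k j0 by (simp add: mult.assoc)
    then have base: "Z (e k) * Z (e j) = Z (e k + e j)" by (simp only: add.commute)
    have jn: "j \<le> n" "j \<in> {1..j}" "j \<in> {1..n}" using j j0 k by auto
    obtain us where us: "set us \<subseteq> V j" "act us (e j) = u"
      using transv_transitive[OF subspace2_V nondegenerate_V[OF jn(1)] basis_in_V(1)[OF jn(2,1)] _
          basis_nonzero[OF jn(3)] False] u j by auto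
    have "act us (e k) = e k" using us(1) V_orthogonal(1)[of j k] j k by (intro act_orthogonal) auto
    moreover have "set us \<subseteq> V k" using us(1) V_mono[of j k] j by auto
    ultimately show ?thesis using Z_add_act[OF _ ek in_V(1) base, of us] us(2) by (simp add: act_add)
  qed
  have perp: "Z (e k) * Z x = Z (e k + x)" if x: "x \<in> V k" "\<omega> (e k) x = 0" for x
  proof -
    obtain u where u: "u \<in> V (k - 1)" "x = u \<or> x = u + e k" using e_k_perp_split[OF k0 x] .
    show ?thesis
    proof (cases "x = u")
      case False
      then have x': "x = e k + u" using u by (simp add: add.commute)
      have "Z (e k) * Z x = Z (e k) * Z (e k) * Z u" unfolding x' low[OF u(1), symmetric] by (simp add: mult.assoc)
      also have "\<dots> = Z u" using Z_inv[OF ek] by simp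
      finally show ?thesis unfolding x' by simp
    qed (use low u in simp)
  qed
  obtain us where us: "set us \<subseteq> V k" "act us (e k) = v" using reach[OF vw(1) False] .
  define x where "x = act (rev us) w"
  have w: "w = act us x" by (simp add: x_def)
  have x: "x \<in> V k" using act_closed[OF V_k(1), of "rev us" w] us vw by (simp add: x_def)
  have "\<omega> (e k) x = 0" using vw(3) unfolding w us(2)[symmetric] by simp
  then show ?thesis using Z_add_act[OF us(1) ek x perp[OF x]] us(2) by (simp add: w act_add)
qed

lemma good_transport:
  assumes G: "q k * X.ext x * q k = X.ext (transv (e k + e (Suc k)) x)" and k0: "k \<noteq> 0"
    and x: "x \<in> V (Suc k)" and g: "X.good g" "\<omega> g (e k + e (Suc k)) = 0"
  shows "q k * X.ext (transv g x) * q k = X.ext (transv (e k + e (Suc k)) (transv g x))"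
proof -
  let ?u = "e k + e (Suc k)"
  have ek: "e k \<in> V k" using basis_in_V[of k k] k k0 by auto
  have u: "X.ext ?u = q k" using X.ext_simps(2)[OF ek] y_k[OF k0] by simp
  have uV: "?u \<in> V (Suc k)" using ek V_mono[of k "Suc k"] basis_in_V[of "Suc k" "Suc k"] k
    by (intro subspace2D(2)[OF subspace2_V]) auto
  have gV: "g \<in> V (Suc k)" using g X.goodD(2) by simp
  have gx: "X.ext (transv g x) = X.ext g * X.ext x * X.ext g" using X.goodD(1)[OF g(1) x] ..
  have inv: "X.ext g * X.ext g = 1" using X.ext_inv[OF gV] .
  have "X.ext g * q k * X.ext g = q k"
    using X.goodD(1)[OF g(1) uV] g(2) u by (simp add: transv_def)
  then have comm: "X.ext g * q k = q k * X.ext g" by (rule involution_cancel_right) (rule inv)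
  have "q k * X.ext (transv g x) * q k = (q k * X.ext g) * X.ext x * (X.ext g * q k)"
    unfolding gx by (simp only: mult.assoc)
  also have "\<dots> = (X.ext g * q k) * X.ext x * (q k * X.ext g)" unfolding comm ..
  also have "\<dots> = X.ext g * (q k * X.ext x * q k) * X.ext g" by (simp only: mult.assoc)
  also have "\<dots> = X.ext (transv g (transv ?u x))"
    unfolding G using X.goodD(1)[OF g(1)] x uV transv_closed[OF subspace2_V] by simp
  also have "transv g (transv ?u x) = transv ?u (transv g x)"
  proof -
    have "transv g (transv ?u (transv g (transv g x))) = transv (transv g ?u) (transv g x)"
      by (rule transv_conj)
    then show ?thesis using g(2) by (simp add: transv_def[of g ?u])
  qed
  finally show ?thesis .
qed

text \<open>
  Transvections that fix \<open>e k + e (Suc k)\<close> commute with \<open>q k\<close>, so conjugation by \<open>q k\<close> has to be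
  verified on orbit representatives only: \<open>r + a\<close> with \<open>r\<close> among \<open>0, e k, f k, e j\<close> for the preceding
  site \<open>j\<close> and \<open>a\<close> among \<open>0, e (Suc k), f (Suc k)\<close>. Only \<open>r = e j\<close> with \<open>a \<noteq> 0\<close> needs three sites.
\<close>

lemma good_link:
  assumes k0: "k \<noteq> 0"
  shows "X.good (e k + e (Suc k))"
proof -
  define u where "u = e k + e (Suc k)"
  (* u is the vector of q k, and G x states that q k conjugates ext x correctly *)
  define G where "G x \<longleftrightarrow> q k * X.ext x * q k = X.ext (transv u x)" for x
  have ek: "e k \<in> V k" "f k \<in> V k" using basis_in_V[of k k] k k0 by auto
  note sub = subspace2D[OF V_k(1)]
  have forms: "\<omega> (e k) (f k) = 1" "\<omega> (f k) (e k) = 1" "\<omega> (e k) (e (Suc k)) = 0" "\<omega> (e k) (f (Suc k)) = 0"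
    "\<omega> (f k) (e (Suc k)) = 0" "\<omega> (f k) (f (Suc k)) = 0" "\<omega> (e (Suc k)) (e k) = 0" "\<omega> (e (Suc k)) (f k) = 0"
    "\<omega> (f (Suc k)) (e k) = 0" "\<omega> (f (Suc k)) (f k) = 0" "\<omega> (e (Suc k)) (f (Suc k)) = 1"
    "\<omega> (f (Suc k)) (e (Suc k)) = 1"
    using k k0 by auto
  have uV: "u \<in> V (Suc k)" using ek V_mono[of k "Suc k"] basis_in_V[of "Suc k" "Suc k"] k
    unfolding u_def by (intro subspace2D(2)[OF subspace2_V]) auto
  have ext_u: "X.ext u = q k" using X.ext_simps(2)[OF ek(1)] y_k[OF k0] by (simp add: u_def)
  have transport: "G (act us x)" if "G x" "set us \<subseteq> perp (V k) (e k)" "x \<in> V (Suc k)" for us x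
    using that
  proof (induction us)
    case (Cons w us)
    have "\<omega> w (e k) = 0" "\<omega> w (e (Suc k)) = 0" "w \<in> V k"
      using Cons.prems(2) V_orthogonal(1)[of k "Suc k" w] k by (auto simp: perp_def form_commute[of w "e k"])
    then have "X.good w" "\<omega> w u = 0" using X.good_W by (auto simp: u_def form_add)
    moreover have "act us x \<in> V (Suc k)"
      using Cons.prems V_mono[of k "Suc k"] by (intro act_closed[OF subspace2_V]) (auto simp: perp_def)
    ultimately show ?case
      using good_transport[of "act us x" w] Cons k0 by (simp add: G_def u_def)
  qed simp
  have q_sq: "q k * q k = 1" using q_inv[of k] k k0 by simp
  have braid_h: "h i * q k * h i = q k * h i * q k" if "i = k \<or> i = Suc k" for i
    using hq_braid[of i k] that k k0 by auto
  have pp': "p k * q k = q k * p k" "p (Suc k) * q k = q k * p (Suc k)"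
    using p_q[of k k] p_q[of "Suc k" k] k k0 by auto
  have ph: "h i * p i * h i = p i * h i * p i" if "i = k \<or> i = Suc k" for i
    using ph_braid[of i] that k k0 by auto
  have t_ek: "t (e k) = p k" "t (e k + f k) = h k" using t_e[of k] t_ef[of k] k0 by auto
  have t_fk: "t (f k) = h k * p k * h k"
    using transv_repD(3)[OF t, of "e k + f k" "e k"] ek sub t_ek forms
    by (simp add: transv_def form_add add_ac)
  have y_fk: "X.y (f k) = h k * q k * h k"
    using X.y_act[of "[e k + f k]" "e k"] ek sub t_ek forms y_k[OF k0]
    by (simp add: transv_def form_add add_ac)
  have y_fek: "X.y (e k + f k) = p k * (h k * q k * h k) * p k"
    using X.y_act[of "[e k]" "f k"] ek sub t_ek forms y_fk
    by (simp add: transv_def form_add add_ac)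
  have 0: "(0 :: 'v) \<in> V k" using sub(1) .
  have efk: "e k + f k \<in> V k" using ek sub by simp
  have rep_0: "G 0" "G (0 + e (Suc k))" "G (0 + f (Suc k))"
  proof -
    have T: "transv u (0 + e (Suc k)) = 0 + e (Suc k)"
      "transv u (0 + f (Suc k)) = e k + (e (Suc k) + f (Suc k))"
      by (simp_all add: u_def transv_def form_add forms add_ac)
    show "G 0" using q_sq by (simp add: G_def)
    show "G (0 + e (Suc k))"
      unfolding G_def T X.ext_simps(2)[OF 0] X.y_0 using pp'(2) q_sq by (simp add: conj_commuting)
    show "G (0 + f (Suc k))"
      unfolding G_def T X.ext_simps(3)[OF 0] X.ext_simps(4)[OF ek(1)] X.y_0 y_k[OF k0]
      using conj_braid[OF pp'(2) ph braid_h] by (simp add: mult.assoc)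
  qed
  have rep_e: "G (e k)" "G (e k + e (Suc k))" "G (e k + f (Suc k))"
  proof -
    have T: "transv u (e k) = e k" "transv u (e k + e (Suc k)) = e k + e (Suc k)"
      "transv u (e k + f (Suc k)) = e (Suc k) + f (Suc k)"
      by (simp_all add: u_def transv_def form_add forms add_ac)
    show "G (e k)"
      unfolding G_def T X.ext_simps(1)[OF ek(1)] t_ek using pp'(1) q_sq by (simp add: conj_commuting)
    show "G (e k + e (Suc k))"
      unfolding G_def T X.ext_simps(2)[OF ek(1)] y_k[OF k0] using q_sq by (simp add: conj_commuting)
    show "G (e k + f (Suc k))"
      unfolding G_def T X.ext_simps(3)[OF ek(1)] y_k[OF k0] X.ext_ef
      using conj_braid_self[OF q_sq braid_h] by simp
  qed
  have rep_f: "G (f k)" "G (f k + e (Suc k))" "G (f k + f (Suc k))"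
  proof -
    have T: "transv u (f k) = e k + f k + e (Suc k)" "transv u (f k + e (Suc k)) = e k + f k"
      "transv u (f k + f (Suc k)) = f k + f (Suc k)"
      by (simp_all add: u_def transv_def form_add forms add_ac)
    show "G (f k)"
      unfolding G_def T X.ext_simps(1)[OF ek(2)] X.ext_simps(2)[OF efk] t_fk y_fek
      using conj_braid[OF pp'(1) ph braid_h] by simp
    show "G (f k + e (Suc k))"
      unfolding G_def T X.ext_simps(2)[OF ek(2)] X.ext_simps(1)[OF efk] t_ek y_fk
      using conj_braid_self[OF q_sq braid_h] by simp
    have "h k * h (Suc k) = h (Suc k) * h k" "h (Suc k) * h (Suc k) = 1"
      using h_h[of k "Suc k"] h_inv[of "Suc k"] k k0 by auto
    then show "G (f k + f (Suc k))"
      unfolding G_def T X.ext_simps(3)[OF ek(2)] y_fk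
      using conj_braid_pair[OF braid_h braid_h] by simp
  qed
  have rep_low: "G (e j)" "G (e j + e (Suc k))" "G (e j + f (Suc k))" if j: "k = Suc j" "1 \<le> j" for j
  proof -
    have forms': "\<omega> (e k) (e j) = 0" "\<omega> (e (Suc k)) (e j) = 0" using j k by auto
    have T: "transv u (e j) = e j" "transv u (e j + e (Suc k)) = e j + e (Suc k)"
      "transv u (e j + f (Suc k)) = (e j + e k) + (e (Suc k) + f (Suc k))"
      by (simp_all add: u_def transv_def form_add forms forms' add_ac)
    have ej: "e j \<in> V k" "e j + e k \<in> V k" using basis_in_V[of j k] ek sub j k by auto
    have "p j * q k = q k * p j" "t (e j) = p j" using p_q[of j k] t_e[of j] j k by auto
    then show "G (e j)"
      unfolding G_def T X.ext_simps(1)[OF ej(1)] using q_sq by (simp add: conj_commuting)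
    have three: "q k * d j = d j * q k"
      "q k * h (Suc k) * d j * h (Suc k) * q k = p (Suc k) * h (Suc k) * c j * h (Suc k) * p (Suc k)"
      using three_sites(1,2)[of j] j k by auto
    show "G (e j + e (Suc k))"
      unfolding G_def T X.ext_simps(2)[OF ej(1)] y_c_d(2)[OF j] conj_commuting[OF three(1)[symmetric] q_sq] ..
    show "G (e j + f (Suc k))"
      unfolding G_def T X.ext_simps(3)[OF ej(1)] X.ext_simps(4)[OF ej(2)] y_c_d[OF j] using three(2)
      by (simp add: mult.assoc)
  qed
  have reps: "\<exists>us r. set us \<subseteq> perp (V k) (e k) \<and> act us r = v \<and> r \<in> V k \<and> G r \<and> G (r + e (Suc k)) \<and> G (r + f (Suc k))"
    if v: "v \<in> V k" for v
  proof -
    consider "v = 0" | "v = e k" | "\<omega> (e k) v = 1" | "\<omega> (e k) v = 0" "v \<noteq> 0" "v \<noteq> e k"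
      by (cases "\<omega> (e k) v = 0") auto
    then show ?thesis
    proof cases
      case 1
      then show ?thesis using rep_0 v by (intro exI[of _ "[]"] exI[of _ v]) simp
    next
      case 2
      then show ?thesis using rep_e v by (intro exI[of _ "[]"] exI[of _ v]) simp
    next
      case 3
      then obtain us where "set us \<subseteq> perp (V k) (e k)" "act us (f k) = v" using reach_crossing[OF k0 v] by blast
      then show ?thesis using rep_f ek by blast
    next
      case 4
      obtain j where j: "k = Suc j" using k0 by (cases k) auto
      obtain x where x: "x \<in> V (k - 1)" "v = x \<or> v = x + e k" using e_k_perp_split[OF k0 v 4(1)] .
      have j0: "1 \<le> j"
      proof (rule ccontr)
        assume "\<not> 1 \<le> j"
        then have "j = 0" by simp
        then have "x \<in> V 0" using x(1) j by simp
        then show False using x(2) 4 by (auto simp: V_0)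
      qed
      obtain us where "set us \<subseteq> perp (V k) (e k)" "act us (e j) = v" using reach_low[OF j j0 v 4] .
      moreover have "e j \<in> V k" using basis_in_V[of j k] j j0 k by auto
      ultimately show ?thesis using rep_low[OF j j0] by blast
    qed
  qed
  have "G x" if xU: "x \<in> V (Suc k)" for x
  proof -
    obtain v a where v: "v \<in> V k" and a: "a \<in> {0, e (Suc k), f (Suc k), e (Suc k) + f (Suc k)}" and x: "x = v + a"
      using X.U_split[OF xU] .
    obtain us r where us: "set us \<subseteq> perp (V k) (e k)" "act us r = v" "r \<in> V k"
      and G: "G r" "G (r + e (Suc k))" "G (r + f (Suc k))" using reps[OF v] by blast
    have in_U: "r \<in> V (Suc k)" "e (Suc k) \<in> V (Suc k)" "f (Suc k) \<in> V (Suc k)"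
      using us(3) V_mono[of k "Suc k"] basis_in_V[of "Suc k" "Suc k"] k by auto
    note subU = subspace2D(2)[OF subspace2_V]
    have "\<omega> y (e (Suc k)) = 0" "\<omega> y (f (Suc k)) = 0" if "y \<in> set us" for y
      using that us(1) V_orthogonal[of k "Suc k" y] k by (auto simp: perp_def)
    then have fix_a: "act us (e (Suc k)) = e (Suc k)" "act us (f (Suc k)) = f (Suc k)"
      by (auto intro: act_orthogonal)
    have G1: "G v" using transport[OF G(1) us(1) in_U(1)] us(2) by simp
    have G2: "G (v + e (Suc k))"
      using transport[OF G(2) us(1) subU[OF in_U(1,2)]] us(2) fix_a by (simp add: act_add)
    have G3: "G (v + f (Suc k))"
      using transport[OF G(3) us(1) subU[OF in_U(1,3)]] us(2) fix_a by (simp add: act_add)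
    have "v \<in> V (Suc k)" using v V_mono[of k "Suc k"] by auto
    moreover have "\<omega> (e (Suc k)) v = 0" using V_orthogonal(2)[of k "Suc k" v] v k by simp
    moreover have "\<omega> (e (Suc k)) u = 0" unfolding u_def form_add using forms by simp
    ultimately have "G (transv (e (Suc k)) (v + f (Suc k)))"
      using good_transport[of "v + f (Suc k)" "e (Suc k)"] G3 k0 X.good_e subU[OF _ in_U(3)] by (simp add: G_def u_def)
    moreover have "transv (e (Suc k)) (v + f (Suc k)) = v + (e (Suc k) + f (Suc k))"
      using forms \<open>\<omega> (e (Suc k)) v = 0\<close> by (simp add: transv_def form_add add_ac)
    ultimately show "G x" using a G1 G2 G3 unfolding x by auto
  qed
  then show ?thesis unfolding X.good_def using uV ext_u by (simp add: G_def u_def)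
qed

theorem transv_rep_step:
  "\<exists>t'. transv_rep (V (Suc k)) t' \<and> (\<forall>i\<in>{1..Suc k}. t' (e i) = p i \<and> t' (e i + f i) = h i)
    \<and> (\<forall>i\<in>{1..<Suc k}. t' (e i + e (Suc i)) = q i)"
proof (intro exI conjI ballI)
  show "transv_rep (V (Suc k)) X.ext"
  proof (rule X.transv_rep_ext)
    show "\<exists>v\<in>V k. v \<noteq> 0 \<and> X.good (v + e (Suc k))" if "V k \<noteq> {0}"
    proof -
      have "k \<noteq> 0" using that by (auto simp: V_0)
      then show ?thesis using good_link basis_in_V[of k k] basis_nonzero[of k] k
        by (intro bexI[of _ "e k"]) auto
    qed
    show "nondegenerate (V (Suc k))" using nondegenerate_V k by simp
  qed (rule Z_add)
  fix i
  assume i: "i \<in> {1..Suc k}"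
  have low: "e i \<in> V k" "e i + f i \<in> V k" if "i \<noteq> Suc k"
    using that i basis_in_V[of i k] k subspace2D[OF V_k(1)] by auto
  show "X.ext (e i) = p i"
    using X.ext_e X.ext_simps(1)[OF low(1)] t_e[of i] i by (cases "i = Suc k") auto
  show "X.ext (e i + f i) = h i"
    using X.ext_ef X.ext_simps(1)[OF low(2)] t_ef[of i] i by (cases "i = Suc k") auto
next
  fix i assume i: "i \<in> {1..<Suc k}"
  show "X.ext (e i + e (Suc i)) = q i"
  proof (cases "i = k")
    case True
    then show ?thesis using X.ext_simps(2)[of "e k"] y_k basis_in_V[of k k] i k by auto
  next
    case False
    then have "e i + e (Suc i) \<in> V k" using i k basis_in_V[of i k] basis_in_V[of "Suc i" k] subspace2D[OF V_k(1)] by auto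
    then show ?thesis using X.ext_simps(1) t_ee[of i] i False by auto
  qed
qed

end

context sp_relations begin

theorem transv_rep_exists:
  "k \<le> n \<Longrightarrow> \<exists>t. transv_rep (V k) t \<and> (\<forall>i\<in>{1..k}. t (e i) = p i \<and> t (e i + f i) = h i)
    \<and> (\<forall>i\<in>{1..<k}. t (e i + e (Suc i)) = q i)"
proof (induction k)
  case 0
  have "transv_rep (V 0) (\<lambda>_. 1 :: 'm)" by (simp add: transv_rep_def)
  then show ?case by auto
next
  case (Suc k)
  then obtain t where t: "transv_rep (V k) t" "\<forall>i\<in>{1..k}. t (e i) = p i \<and> t (e i + f i) = h i"
    "\<forall>i\<in>{1..<k}. t (e i + e (Suc i)) = q i" by auto
  interpret sp_step \<omega> n e f p h q k t
    by unfold_locales (use Suc.prems t in auto)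
  show ?case by (rule transv_rep_step)
qed

end

context symplectic_basis begin

lemma faithful_V: "transv_rep (V k) t \<Longrightarrow> k \<le> n \<Longrightarrow> faithful (V k) t"
proof (induction k)
  case 0
  have "word t us = 1" if "set us \<subseteq> V 0" for us
    using that by (induction us) (auto simp: V_0 transv_repD(1)[OF 0(1)])
  then show ?case by (simp add: faithful_def)
next
  case (Suc k)
  then have "faithful (V k) t" using transv_rep_subset[OF Suc.prems(1) V_mono[of k "Suc k"]] by simp
  then show ?case
    using faithful_hyperbolic[OF subspace2_V Suc.prems(1), of "e (Suc k)" "f (Suc k)"]
      basis_in_V[of "Suc k" "Suc k"] V_Suc[of k] Suc.prems(2) by auto
qed

lemma isometries_generated_V: "k \<le> n \<Longrightarrow> isometries_generated (V k)"
proof (induction k)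
  case 0
  have "\<exists>us. set us \<subseteq> V 0 \<and> (\<forall>x\<in>V 0. g x = act us x)" if "\<forall>x\<in>V 0. g x \<in> V 0" for g
    using that by (intro exI[of _ "[]"]) (simp add: V_0)
  then show ?case by (simp add: isometries_generated_def)
next
  case (Suc k)
  then show ?case
    using isometries_generated_hyperbolic[OF subspace2_V nondegenerate_V[of "Suc k"], of "e (Suc k)" "f (Suc k)"]
      basis_in_V[of "Suc k" "Suc k"] V_Suc[of k] by auto
qed

end

section \<open>From the defining relations to Coxeter relations\<close>

lemma wpow_unfold:
  "wpow w 2 = w @ w" "wpow w 3 = w @ w @ w" "wpow w 4 = w @ w @ w @ w"
  by (simp_all add: wpow_def numeral_eq_Suc)

text \<open>
  The presentation does not list the commutation of \<open>H\<^sub>i\<close> and \<open>P\<^sub>j\<close> for \<open>i \<noteq> j\<close>. It is hidden in R10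
  and R11: with \<open>Y = Z P\<close>, relation R10 is equivalent to \<open>P' = (Y H)\<^sup>3\<close>. Since \<open>Y\<close>, \<open>H\<close> and \<open>P'\<close>
  are involutions, \<open>P'\<close> is central in the dihedral group generated by \<open>Y\<close> and \<open>H\<close>. Once \<open>H\<close> and \<open>P'\<close>
  commute, R10 turns into the braid relation of \<open>H\<close> and \<open>q = Z P P'\<close>.
\<close>

lemma R10_consequences:
  fixes Z H P P' :: "'m::monoid_mult"
  assumes inv: "P * P = 1" "P' * P' = 1" "Z * Z = 1" "H * H = 1"
    and comm: "P * P' = P' * P" "P * Z = Z * P" "P' * Z = Z * P'"
    and R10: "Z * H * Z = P * H * P * P' * Z * H * P"
  shows "P' = Z * P * H * (Z * P * H) * (Z * P * H)"
    and "H * P' = P' * H"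
    and "H * (Z * P * P') * H = Z * P * P' * H * (Z * P * P')"
proof -
  have tail: "P * (P * x) = x" "P' * (P' * x) = x" "Z * (Z * x) = x" "H * (H * x) = x"
    "P' * (P * x) = P * (P' * x)" "P * (Z * x) = Z * (P * x)" "P' * (Z * x) = Z * (P' * x)" for x
    using inv comm by (simp_all flip: mult.assoc)
  have PP'P: "P * (P' * P) = P'" by (simp add: comm(1)[symmetric] tail)
  define Y where "Y = Z * P"
  have Y: "Y * Y = 1" "Y * (Y * x) = x" for x unfolding Y_def using inv by (simp_all add: mult.assoc tail)
  have "Z * H * Z * P = P * H * P * P' * Z * H"
    unfolding R10 by (simp add: mult.assoc inv)
  then have "Z * H * Z * P * H = P * H * P * P' * Z * H * H" by simp
  then have "Z * H * Z * P * H = P * H * (P * P' * Z)" by (simp add: mult.assoc inv)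
  then have "Z * (P * (H * (P * (Z * H * Z * P * H)))) = Z * (P * (H * (P * (P * H * (P * P' * Z)))))"
    by simp
  then show P': "P' = Z * P * H * (Z * P * H) * (Z * P * H)"
    using inv comm PP'P by (simp add: mult.assoc tail)
  have PY: "P' = Y * (H * (Y * (H * (Y * H))))" using P' by (simp add: Y_def mult.assoc)
  have "P' = P' * (Y * (H * (Y * (H * (Y * H))))) * (H * (Y * (H * (Y * (H * Y)))))"
    by (simp add: mult.assoc Y tail inv)
  also have "\<dots> = H * (Y * (H * (Y * (H * Y))))" unfolding PY[symmetric] inv(2) by simp
  finally have PY': "P' = H * (Y * (H * (Y * (H * Y))))" .
  have "P' * H = H * (Y * (H * (Y * (H * Y)))) * H" unfolding PY' ..
  also have "\<dots> = H * P'" unfolding PY by (simp only: mult.assoc)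
  finally show HP': "H * P' = P' * H" ..
  have HP'': "P' * (H * x) = H * (P' * x)" for x using HP' by (simp flip: mult.assoc)
  have "H * (Z * P * P') * H = P * (P * H * P * P' * Z * H * P) * P"
    by (simp add: mult.assoc tail inv)
  also have "\<dots> = P * (Z * H * Z) * P" unfolding R10 ..
  also have "\<dots> = Z * P * P' * H * (Z * P * P')"
    using inv comm by (simp add: mult.assoc tail HP'')
  finally show "H * (Z * P * P') * H = Z * P * P' * H * (Z * P * P')" .
qed

context symplectic_basis begin

fun gate_vectors :: "gen \<Rightarrow> 'v list" where
  "gate_vectors (gH i) = [e i + f i]"
| "gate_vectors (gP i) = [e i]"
| "gate_vectors (gZ j) = [e j, e (Suc j), e j + e (Suc j)]"

text \<open>
  The commutation of \<open>H\<^sub>i\<close> and \<open>P\<^sub>j\<close> spreads from neighbouring sites to all others because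
  \<open>P\<^sub>j\<^sub>+\<^sub>1\<close> is a word in \<open>Z\<^sub>j, P\<^sub>j, H\<^sub>j\<close> and \<open>P\<^sub>j\<close> one in \<open>Z\<^sub>j, P\<^sub>j\<^sub>+\<^sub>1, H\<^sub>j\<^sub>+\<^sub>1\<close>.
\<close>

lemma sp_relations_of_presentation:
  fixes g :: "gen \<Rightarrow> 'm::monoid_mult"
  assumes g: "\<And>u v. (u, v) \<in> sp_rels n \<Longrightarrow> prod_list (map g u) = prod_list (map g v)"
  shows "sp_relations \<omega> n e f (\<lambda>i. g (gP i)) (\<lambda>i. g (gH i)) (\<lambda>j. g (gZ j) * g (gP j) * g (gP (Suc j)))"
proof -
  define P where "P i = g (gP i)" for i
  define H where "H i = g (gH i)" for i
  define Z where "Z j = g (gZ j)" for j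
  define Q where "Q j = Z j * P j * P (Suc j)" for j
  note defs = P_def[symmetric] H_def[symmetric] Z_def[symmetric]
  have PP: "P i * P i = 1" if "i \<in> {1..n}" for i
    using g[OF sp_rels.SP1[of i n]] that by (simp add: wpow_unfold defs)
  have HH: "H i * H i = 1" if "i \<in> {1..n}" for i
    using g[OF sp_rels.R1_H[of i n]] that by (simp add: wpow_unfold defs)
  have ZZ: "Z i * Z i = 1" if "i \<in> {1..<n}" for i
    using g[OF sp_rels.R1_Z[of i n]] that by (simp add: wpow_unfold defs)
  have P_P: "P i * P j = P j * P i" if "i \<in> {1..n}" "j \<in> {1..n}" for i j
    using g[OF sp_rels.R5_P[of i n j]] that by (cases "i = j") (simp_all add: defs)
  have H_H: "H i * H j = H j * H i" if "i \<in> {1..n}" "j \<in> {1..n}" for i j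
    using g[OF sp_rels.R5_H[of i n j]] that by (cases "i = j") (simp_all add: defs)
  have Z_Z: "Z i * Z j = Z j * Z i" if "i \<in> {1..<n}" "j \<in> {1..<n}" for i j
    using g[OF sp_rels.R5_Z[of i n j]] that by (cases "i = j") (simp_all add: defs)
  have P_Z: "P i * Z j = Z j * P i" if "i \<in> {1..n}" "j \<in> {1..<n}" for i j
    using g[OF sp_rels.R6[of i n j]] that by (simp add: defs)
  have H_Z: "H i * Z j = Z j * H i" if "i \<in> {1..n}" "j \<in> {1..<n}" "i \<noteq> j" "i \<noteq> Suc j" for i j
    using g[OF sp_rels.R7[of i n j]] that by (simp add: defs)
  have HP3: "H i * P i * H i * P i * H i * P i = 1" if "i \<in> {1..n}" for i
    using g[OF sp_rels.R2[of i n]] that by (simp add: wpow_unfold defs mult.assoc)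
  have HP: "P i * H i * P i = H i * P i * H i" if i: "i \<in> {1..n}" for i
  proof -
    have "H i * P i * H i * P i * H i * P i = 1" using HP3[OF i] .
    then have "H i * P i * H i * P i * H i = 1 * P i"
      by (rule involution_cancel_right) (rule PP[OF i])
    then have "H i * P i * H i * P i = 1 * P i * H i"
      by (rule involution_cancel_right) (rule HH[OF i])
    then have "H i * P i * H i = 1 * P i * H i * P i"
      by (rule involution_cancel_right) (rule PP[OF i])
    then show ?thesis by simp
  qed
  note R10' = R10_consequences[where Z = "Z j" and H = "H j" and P = "P j" and P' = "P (Suc j)" for j]
    and R11' = R10_consequences[where Z = "Z j" and H = "H (Suc j)" and P = "P (Suc j)" and P' = "P j" for j]
  have R10: "Z j * H j * Z j = P j * H j * P j * P (Suc j) * Z j * H j * P j" if "j \<in> {1..<n}" for j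
    using g[OF sp_rels.R10[of j n]] that by (simp add: defs mult.assoc)
  have R11: "Z j * H (Suc j) * Z j = P (Suc j) * H (Suc j) * P (Suc j) * P j * Z j * H (Suc j) * P (Suc j)"
    if "j \<in> {1..<n}" for j
  proof -
    have "P j * P (Suc j) = P (Suc j) * P j" using P_P[of j "Suc j"] that by simp
    then have "P (Suc j) * H (Suc j) * P (Suc j) * P j * Z j * H (Suc j) * P (Suc j)
        = P (Suc j) * H (Suc j) * (P j * P (Suc j)) * Z j * H (Suc j) * P (Suc j)"
      by (simp add: mult.assoc)
    then show ?thesis using g[OF sp_rels.R11[of j n]] that by (simp add: defs mult.assoc)
  qed
  note close = R10'(1)[OF PP PP ZZ HH P_P P_Z P_Z R10] R11'(1)[OF PP PP ZZ HH P_P P_Z P_Z R11]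
  have up: "H i * P (i + k) = P (i + k) * H i" if "1 \<le> i" "1 \<le> k" "i + k \<le> n" for i k
    using that
  proof (induction k)
    case (Suc k)
    show ?case
    proof (cases "k = 0")
      case True
      show ?thesis using R10'(2)[OF PP PP ZZ HH P_P P_Z P_Z R10, of i] Suc.prems True by simp
    next
      case False
      have "P (Suc (i + k)) = Z (i + k) * P (i + k) * H (i + k) * (Z (i + k) * P (i + k) * H (i + k))
          * (Z (i + k) * P (i + k) * H (i + k))"
        using close(1)[of "i + k"] Suc.prems by simp
      moreover have "H i * P (i + k) = P (i + k) * H i" using Suc False by simp
      moreover have "H i * Z (i + k) = Z (i + k) * H i" "H i * H (i + k) = H (i + k) * H i"
        using H_Z[of i "i + k"] H_H[of i "i + k"] Suc.prems False by auto
      ultimately show ?thesis by (simp add: commute_mult)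
    qed
  qed simp
  have down: "H (i + k) * P i = P i * H (i + k)" if "1 \<le> i" "1 \<le> k" "i + k \<le> n" for i k
    using that
  proof (induction k arbitrary: i)
    case (Suc k)
    show ?case
    proof (cases "k = 0")
      case True
      show ?thesis using R11'(2)[OF PP PP ZZ HH P_P P_Z P_Z R11, of i] Suc.prems True by simp
    next
      case False
      have "P i = Z i * P (Suc i) * H (Suc i) * (Z i * P (Suc i) * H (Suc i)) * (Z i * P (Suc i) * H (Suc i))"
        using close(2)[of i] Suc.prems by simp
      moreover have "H (i + Suc k) * P (Suc i) = P (Suc i) * H (i + Suc k)"
        using Suc.IH[of "Suc i"] Suc.prems False by simp
      moreover have "H (i + Suc k) * Z i = Z i * H (i + Suc k)"
        "H (i + Suc k) * H (Suc i) = H (Suc i) * H (i + Suc k)"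
        using H_Z[of "i + Suc k" i] H_H[of "i + Suc k" "Suc i"] Suc.prems False by auto
      ultimately show ?thesis by (simp add: commute_mult)
    qed
  qed simp
  have P_H: "P i * H j = H j * P i" if "i \<in> {1..n}" "j \<in> {1..n}" "i \<noteq> j" for i j
    using up[of j "i - j"] down[of i "j - i"] that by (cases "i < j") auto
  have Q: "Q j = Z j * P j * P (Suc j)" "Q j = Z j * P (Suc j) * P j" if "j \<in> {1..<n}" for j
    using P_P[of j "Suc j"] that by (simp_all add: Q_def mult.assoc)
  have commute_Q: "x * Q j = Q j * x" if "x * Z j = Z j * x" "x * P j = P j * x" "x * P (Suc j) = P (Suc j) * x"
    for x j
    unfolding Q_def using that by (intro commute_mult)
  have P_Q: "P i * Q j = Q j * P i" if "i \<in> {1..n}" "j \<in> {1..<n}" for i j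
    using that by (intro commute_Q P_P P_Z) auto
  have Z_Q: "Z i * Q j = Q j * Z i" if "i \<in> {1..<n}" "j \<in> {1..<n}" for i j
    using that by (intro commute_Q Z_Z P_Z[symmetric]) auto
  have PPt: "P i * (P i * x) = x" if "i \<in> {1..n}" for i x using PP[OF that] by (simp flip: mult.assoc)
  have QPP: "Q j * P (Suc j) * P j = Z j" if "j \<in> {1..<n}" for j
    using that by (simp add: Q_def mult.assoc PPt PP)
  show ?thesis
    unfolding defs Q_def[symmetric]
  proof
    show "Q i * Q i = 1" if "i \<in> {1..<n}" for i
    proof -
      have c: "P i * Q i = Q i * P i" "P (Suc i) * Q i = Q i * P (Suc i)" "P i * P (Suc i) = P (Suc i) * P i"
        using P_Q[of i i] P_Q[of "Suc i" i] P_P[of i "Suc i"] that by auto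
      have "Q i * Q i = Z i * (P i * (P (Suc i) * Q i))" by (simp add: Q_def mult.assoc)
      also have "P i * (P (Suc i) * Q i) = (P i * Q i) * P (Suc i)" unfolding c(2) by (simp only: mult.assoc)
      also have "\<dots> = Q i * (P i * P (Suc i))" unfolding c(1) by (simp only: mult.assoc)
      also have "\<dots> = Z i" unfolding c(3) using QPP that by (simp add: mult.assoc)
      finally show ?thesis using ZZ that by simp
    qed
    show "Q i * Q j = Q j * Q i" if "i \<in> {1..<n}" "j \<in> {1..<n}" for i j
      using that by (intro commute_Q Z_Q[symmetric] P_Q[symmetric]) auto
    show "H i * Q j = Q j * H i" if "i \<in> {1..n}" "j \<in> {1..<n}" "i \<noteq> j" "i \<noteq> Suc j" for i j
      using that by (intro commute_Q H_Z P_H[symmetric]) auto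
    show "H i * Q j * H i = Q j * H i * Q j" if "i \<in> {1..n}" "j \<in> {1..<n}" "i = j \<or> i = Suc j" for i j
      using that(3)
    proof
      assume "i = j"
      then show ?thesis using R10'(3)[OF PP PP ZZ HH P_P P_Z P_Z R10, of j] that by (simp add: Q)
    next
      assume "i = Suc j"
      then show ?thesis
        using R11'(3)[OF PP PP ZZ HH P_P P_Z P_Z R11, of j] that unfolding Q(2)[OF that(2)] by simp
    qed
    fix j w assume j: "1 \<le> j" "Suc (Suc j) \<le> n"
    have j': "j \<in> {1..<n}" "Suc j \<in> {1..<n}" using j by auto
    have Z1: "P j * Q j * P (Suc j) = Z j" "Q j * P j * P (Suc j) = Z j"
      and Z2: "Q (Suc j) * P (Suc (Suc j)) * P (Suc j) = Z (Suc j)" "P (Suc (Suc j)) * Q (Suc j) * P (Suc j) = Z (Suc j)"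
      using QPP[OF j'(1)] QPP[OF j'(2)] P_Q[of j j] P_Q[of "Suc (Suc j)" "Suc j"] P_P[of j "Suc j"] j
      by (simp_all add: mult.assoc)
    show "w * w * w = 1" if w: "w = Q (Suc j) * P (Suc (Suc j)) * P (Suc j) * H j * H (Suc j) * P j * Q j * P (Suc j)
        * H j * H (Suc j) * P j * Q j * P (Suc j)"
    proof -
      have "w = (Q (Suc j) * P (Suc (Suc j)) * P (Suc j)) * H j * H (Suc j) * (P j * Q j * P (Suc j))
        * H j * H (Suc j) * (P j * Q j * P (Suc j))" unfolding w by (simp only: mult.assoc)
      then show ?thesis
        using g[OF sp_rels.B2[of j n]] j unfolding Z1 Z2 by (simp add: wpow_unfold defs mult.assoc)
    qed
    show "w * w * w = 1" if w: "w = Q j * P j * P (Suc j) * H (Suc (Suc j)) * H (Suc j) * P (Suc (Suc j)) * Q (Suc j)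
        * P (Suc j) * H (Suc (Suc j)) * H (Suc j) * P (Suc (Suc j)) * Q (Suc j) * P (Suc j)"
    proof -
      have HH': "H (Suc (Suc j)) * H (Suc j) = H (Suc j) * H (Suc (Suc j))" using H_H j by simp
      have "w = (Q j * P j * P (Suc j)) * (H (Suc (Suc j)) * H (Suc j)) * (P (Suc (Suc j)) * Q (Suc j) * P (Suc j))
        * (H (Suc (Suc j)) * H (Suc j)) * (P (Suc (Suc j)) * Q (Suc j) * P (Suc j))"
        unfolding w by (simp only: mult.assoc)
      then show ?thesis
        using g[OF sp_rels.B3[of j n]] j unfolding Z1 Z2 HH' by (simp add: wpow_unfold defs mult.assoc)
    qed
  qed (use PP HH P_P H_H P_Q P_H HP in auto)
qed

end

section \<open>The relations in the symplectic group\<close>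

context alternating_space begin

text \<open>
  Writing a transvection as \<open>x + \<omega>(u, x) u\<close> with a scalar, instead of by cases, lets composite
  maps be compared by expanding both sides.
\<close>

definition bit_scale :: "bit \<Rightarrow> 'v \<Rightarrow> 'v" where
  "bit_scale c v = (if c = 0 then 0 else v)"

lemma bit_scale_simps [simp]: "bit_scale 0 v = 0" "bit_scale 1 v = v"
  by (simp_all add: bit_scale_def)

lemma bit_scale_add:
  "bit_scale (c + d) v = bit_scale c v + bit_scale d v" "bit_scale c (u + v) = bit_scale c u + bit_scale c v"
  by (cases c; cases d; simp)+

lemma form_bit_scale: "\<omega> u (bit_scale c v) = c * \<omega> u v"
  by (cases c) simp_all

lemma transv_bit_scale: "transv u x = x + bit_scale (\<omega> u x) u"
  by (simp add: transv_def bit_scale_def)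

lemmas transv_expand = transv_bit_scale bit_scale_add form_bit_scale form_add add_ac

end

context symplectic_basis begin

definition gate :: "gen \<Rightarrow> 'v endo" where
  "gate x = word transv_endo (gate_vectors x)"

lemma apply_gate:
  "apply_endo (gate (gH i)) x = transv (e i + f i) x"
  "apply_endo (gate (gP i)) x = transv (e i) x"
  "apply_endo (gate (gZ j)) x = transv (e j) (transv (e (Suc j)) (transv (e j + e (Suc j)) x))"
  by (simp_all add: gate_def)

lemma site_forms:
  assumes "i \<in> {1..n}"
  shows "\<omega> (e i) (e i) = 0" "\<omega> (f i) (f i) = 0" "\<omega> (e i) (f i) = 1" "\<omega> (f i) (e i) = 1"
  using assms by auto

lemma site_forms':
  assumes "i \<in> {1..n}" "j \<in> {1..n}" "i \<noteq> j"
  shows "\<omega> (e i) (e j) = 0" "\<omega> (f i) (f j) = 0" "\<omega> (e i) (f j) = 0" "\<omega> (f i) (e j) = 0"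
    "\<omega> (e j) (e i) = 0" "\<omega> (f j) (f i) = 0" "\<omega> (e j) (f i) = 0" "\<omega> (f j) (e i) = 0"
  using assms by auto

lemma gate_P_H: "gate (gP i) = transv_endo (e i)" "gate (gH i) = transv_endo (e i + f i)"
  by (simp_all add: gate_def)

lemma gate_commute: "\<omega> u v = 0 \<Longrightarrow> transv_endo u * transv_endo v = transv_endo v * transv_endo u"
  by (rule transv_rep_commute[OF transv_rep_endo[of UNIV]]) auto

lemma one_site_gates:
  assumes i: "1 \<le> i" "i \<le> n"
  shows "gate (gP i) * gate (gP i) = 1" "gate (gH i) * gate (gH i) = 1"
    "gate (gP i) * (gate (gP i) * x) = x" "gate (gH i) * (gate (gH i) * x) = x"
    "gate (gH i) * (gate (gP i) * (gate (gH i) * x)) = gate (gP i) * (gate (gH i) * (gate (gP i) * x))"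
proof -
  note rep = transv_repD(2,3)[OF transv_rep_endo[of UNIV] UNIV_I]
  have T: "transv (e i + f i) (e i) = f i" "transv (e i) (e i + f i) = f i"
    using site_forms[of i] i by (simp_all add: transv_def form_add add_ac)
  show inv: "gate (gP i) * gate (gP i) = 1" "gate (gH i) * gate (gH i) = 1"
    by (simp_all add: gate_P_H rep)
  then show "gate (gP i) * (gate (gP i) * x) = x" "gate (gH i) * (gate (gH i) * x) = x"
    by (simp_all flip: mult.assoc)
  have "gate (gH i) * gate (gP i) * gate (gH i) = gate (gP i) * gate (gH i) * gate (gP i)"
    unfolding gate_P_H using rep(2)[of "e i" "e i + f i"] rep(2)[of "e i + f i" "e i"] by (simp add: T)
  then show "gate (gH i) * (gate (gP i) * (gate (gH i) * x)) = gate (gP i) * (gate (gH i) * (gate (gP i) * x))"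
    by (simp flip: mult.assoc)
qed

lemma gate_Z:
  assumes j: "1 \<le> j" "j < n"
  shows "apply_endo (gate (gZ j)) x = x + bit_scale (\<omega> (e j) x) (e (Suc j)) + bit_scale (\<omega> (e (Suc j)) x) (e j)"
  using site_forms[of j] site_forms[of "Suc j"] site_forms'[of j "Suc j"] j
  by (simp add: apply_gate transv_expand)

lemma gate_P: "apply_endo (gate (gP i)) x = x + bit_scale (\<omega> (e i) x) (e i)"
  by (simp add: apply_gate transv_bit_scale)

lemma gate_H: "apply_endo (gate (gH i)) x = x + bit_scale (\<omega> (e i) x + \<omega> (f i) x) (e i) + bit_scale (\<omega> (e i) x + \<omega> (f i) x) (f i)"
  by (simp add: apply_gate transv_expand)

lemmas gate_expand = gate_P gate_H gate_Z bit_scale_add form_bit_scale form_add add_ac wpow_unfold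

lemma three_site_forms:
  assumes j: "1 \<le> j" "Suc (Suc j) \<le> n"
  shows "i \<in> {j, Suc j, Suc (Suc j)} \<Longrightarrow> l \<in> {j, Suc j, Suc (Suc j)} \<Longrightarrow>
      \<omega> (e i) (e l) = 0 \<and> \<omega> (f i) (f l) = 0 \<and> \<omega> (e i) (f l) = (if i = l then 1 else 0)
      \<and> \<omega> (f i) (e l) = (if i = l then 1 else 0)"
  using j by (auto simp del: One_nat_def)

text \<open>
  On three sites a vector is recorded by its coordinates and a remainder \<open>x\<close> orthogonal to these
  sites. The gates act on the coordinates, by swaps and additions, so that long words need no
  expansion.
\<close>

definition state :: "nat \<Rightarrow> 'v \<Rightarrow> bit \<Rightarrow> bit \<Rightarrow> bit \<Rightarrow> bit \<Rightarrow> bit \<Rightarrow> bit \<Rightarrow> 'v" where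
  "state j x a1 b1 a2 b2 a3 b3 = x + bit_scale a1 (e j) + bit_scale b1 (f j)
     + bit_scale a2 (e (Suc j)) + bit_scale b2 (f (Suc j))
     + bit_scale a3 (e (Suc (Suc j))) + bit_scale b3 (f (Suc (Suc j)))"

lemma state_exists:
  assumes j: "1 \<le> j" "Suc (Suc j) \<le> n"
  obtains y a1 b1 a2 b2 a3 b3 where "x = state j y a1 b1 a2 b2 a3 b3"
    "\<forall>i\<in>{j, Suc j, Suc (Suc j)}. \<omega> (e i) y = 0 \<and> \<omega> (f i) y = 0"
proof -
  note F = three_site_forms[OF j]
  define s where "s z = state j z (\<omega> (f j) x) (\<omega> (e j) x) (\<omega> (f (Suc j)) x) (\<omega> (e (Suc j)) x)
    (\<omega> (f (Suc (Suc j))) x) (\<omega> (e (Suc (Suc j))) x)" for z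
  have 1: "x = state j (s x) (\<omega> (f j) x) (\<omega> (e j) x) (\<omega> (f (Suc j)) x) (\<omega> (e (Suc j)) x)
    (\<omega> (f (Suc (Suc j))) x) (\<omega> (e (Suc (Suc j))) x)"
    unfolding s_def state_def by (simp add: add_ac)
  have "\<omega> (e j) (s x) = 0" "\<omega> (f j) (s x) = 0" "\<omega> (e (Suc j)) (s x) = 0" "\<omega> (f (Suc j)) (s x) = 0"
    "\<omega> (e (Suc (Suc j))) (s x) = 0" "\<omega> (f (Suc (Suc j))) (s x) = 0"
    by (simp_all only: s_def state_def form_add form_bit_scale) (simp_all add: F)
  then have 2: "\<forall>i\<in>{j, Suc j, Suc (Suc j)}. \<omega> (e i) (s x) = 0 \<and> \<omega> (f i) (s x) = 0"
    by auto
  show ?thesis by (rule that[OF 1 2])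
qed

lemma gates_state:
  assumes j: "1 \<le> j" "Suc (Suc j) \<le> n"
    and y: "\<forall>i\<in>{j, Suc j, Suc (Suc j)}. \<omega> (e i) y = 0 \<and> \<omega> (f i) y = 0"
  shows "apply_endo (gate (gH j)) (state j y a1 b1 a2 b2 a3 b3) = state j y b1 a1 a2 b2 a3 b3"
    and "apply_endo (gate (gH (Suc j))) (state j y a1 b1 a2 b2 a3 b3) = state j y a1 b1 b2 a2 a3 b3"
    and "apply_endo (gate (gH (Suc (Suc j)))) (state j y a1 b1 a2 b2 a3 b3) = state j y a1 b1 a2 b2 b3 a3"
    and "apply_endo (gate (gZ j)) (state j y a1 b1 a2 b2 a3 b3) = state j y (a1 + b2) b1 (a2 + b1) b2 a3 b3"
    and "apply_endo (gate (gZ (Suc j))) (state j y a1 b1 a2 b2 a3 b3) = state j y a1 b1 (a2 + b3) b2 (a3 + b2) b3"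
proof -
  note F = three_site_forms[OF j] y[rule_format]
  have jn: "j < n" "Suc j < n" "1 \<le> Suc j" using j by auto
  show "apply_endo (gate (gH j)) (state j y a1 b1 a2 b2 a3 b3) = state j y b1 a1 a2 b2 a3 b3"
    by (cases a1; cases b1) (simp_all add: state_def gate_expand F j jn del: One_nat_def)
  show "apply_endo (gate (gH (Suc j))) (state j y a1 b1 a2 b2 a3 b3) = state j y a1 b1 b2 a2 a3 b3"
    by (cases a2; cases b2) (simp_all add: state_def gate_expand F j jn del: One_nat_def)
  show "apply_endo (gate (gH (Suc (Suc j)))) (state j y a1 b1 a2 b2 a3 b3) = state j y a1 b1 a2 b2 b3 a3"
    by (cases a3; cases b3) (simp_all add: state_def gate_expand F j jn del: One_nat_def)
  show "apply_endo (gate (gZ j)) (state j y a1 b1 a2 b2 a3 b3) = state j y (a1 + b2) b1 (a2 + b1) b2 a3 b3"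
    by (cases a1; cases b1; cases a2; cases b2) (simp_all add: state_def gate_expand F j jn del: One_nat_def)
  show "apply_endo (gate (gZ (Suc j))) (state j y a1 b1 a2 b2 a3 b3) = state j y a1 b1 (a2 + b3) b2 (a3 + b2) b3"
    by (cases a2; cases b2; cases a3; cases b3) (simp_all add: state_def gate_expand F j jn del: One_nat_def)
qed

lemma bit_cancel: "a + a = (0 :: bit)" "a + (a + b) = (b :: bit)"
  by (cases a; cases b; simp)+

lemma gates_B1_B2_B3:
  assumes j: "1 \<le> j" "j + 2 \<le> n"
  shows "prod_list (map gate [gZ j, gH j, gH (j + 1), gZ j, gH (j + 1), gH (j + 2), gZ (j + 1), gH (j + 1),
      gH (j + 2), gZ j, gH j, gH (j + 1), gZ j])
    = prod_list (map gate [gZ (j + 1), gH (j + 1), gH (j + 2), gZ (j + 1), gH j, gH (j + 1), gZ j, gH j,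
      gH (j + 1), gZ (j + 1), gH (j + 1), gH (j + 2), gZ (j + 1)])" (is ?B1)
    and "prod_list (map gate (wpow [gZ (j + 1), gH j, gH (j + 1), gZ j, gH j, gH (j + 1), gZ j] 3)) = 1" (is ?B2)
    and "prod_list (map gate (wpow [gZ j, gH (j + 1), gH (j + 2), gZ (j + 1), gH (j + 1), gH (j + 2), gZ (j + 1)] 3))
      = 1" (is ?B3)
proof -
  have j': "1 \<le> j" "Suc (Suc j) \<le> n" using j by auto
  have j2: "j + 1 = Suc j" "j + 2 = Suc (Suc j)" by simp_all
  have "?B1 \<and> ?B2 \<and> ?B3"
  proof (intro conjI endo_eqI)
    fix x
    obtain y a1 b1 a2 b2 a3 b3 where x: "x = state j y a1 b1 a2 b2 a3 b3"
      and y: "\<forall>i\<in>{j, Suc j, Suc (Suc j)}. \<omega> (e i) y = 0 \<and> \<omega> (f i) y = 0"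
      by (rule state_exists[OF j', of x])
    note eval = gates_state[OF j' y] wpow_unfold append.simps list.map prod_list.Cons prod_list.Nil apply_endo_simps
      mult_1_right id_apply add_ac bit_cancel add_0_left add_0_right
    show "apply_endo (prod_list (map gate [gZ j, gH j, gH (j + 1), gZ j, gH (j + 1), gH (j + 2), gZ (j + 1), gH (j + 1),
      gH (j + 2), gZ j, gH j, gH (j + 1), gZ j])) x
      = apply_endo (prod_list (map gate [gZ (j + 1), gH (j + 1), gH (j + 2), gZ (j + 1), gH j, gH (j + 1), gZ j, gH j,
      gH (j + 1), gZ (j + 1), gH (j + 1), gH (j + 2), gZ (j + 1)])) x"
      unfolding x j2 by (simp only: eval)
    show "apply_endo (prod_list (map gate (wpow [gZ (j + 1), gH j, gH (j + 1), gZ j, gH j, gH (j + 1), gZ j] 3))) x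
      = apply_endo 1 x"
      unfolding x j2 by (simp only: eval)
    show "apply_endo (prod_list (map gate (wpow [gZ j, gH (j + 1), gH (j + 2), gZ (j + 1), gH (j + 1), gH (j + 2), gZ (j + 1)] 3))) x
      = apply_endo 1 x"
      unfolding x j2 by (simp only: eval)
  qed
  then show ?B1 ?B2 ?B3 by auto
qed

theorem gate_relations:
  assumes "(u, v) \<in> sp_rels n"
  shows "prod_list (map gate u) = prod_list (map gate v)"
  using assms
proof cases
  case (B1 j)
  then show ?thesis using gates_B1_B2_B3(1)[of j] by simp
next
  case (B2 j)
  then show ?thesis using gates_B1_B2_B3(2)[of j] by simp
next
  case (B3 j)
  then show ?thesis using gates_B1_B2_B3(3)[of j] by simp
next
  case (R8 j)
  show ?thesis
    using R8 site_forms[of j] site_forms[of "Suc j"] site_forms'[of j "Suc j"]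
    by (intro endo_eqI) (simp add: gate_expand)
next
  case (R9 j)
  show ?thesis
    using R9 site_forms[of j] site_forms[of "Suc j"] site_forms'[of j "Suc j"]
    by (intro endo_eqI) (simp add: gate_expand)
next
  case (R10 j)
  show ?thesis
    using R10 site_forms[of j] site_forms[of "Suc j"] site_forms'[of j "Suc j"]
    by (intro endo_eqI) (simp add: gate_expand)
next
  case (R11 j)
  show ?thesis
    using R11 site_forms[of j] site_forms[of "Suc j"] site_forms'[of j "Suc j"]
    by (intro endo_eqI) (simp add: gate_expand)
next
  case (R1_Z j)
  then show ?thesis by (intro endo_eqI) (simp add: gate_expand)
next
  case (R5_Z i j)
  then show ?thesis by (intro endo_eqI) (simp add: gate_expand)
next
  case (R6 i j)
  then show ?thesis by (intro endo_eqI) (simp add: gate_expand)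
next
  case (R7 i j)
  then show ?thesis by (intro endo_eqI) (simp add: gate_expand)
next
  case (R5_P i j)
  then show ?thesis by (simp add: gate_P_H gate_commute)
next
  case (R5_H i j)
  then have "\<omega> (e i + f i) (e j + f j) = 0" by (simp add: form_add)
  from gate_commute[OF this] show ?thesis using R5_H by (simp add: gate_P_H)
qed (simp_all add: wpow_unfold one_site_gates)

end

section \<open>Existence of a symplectic basis\<close>

context alternating_space begin

text \<open>
  Cardinalities replace dimensions: they will identify the number of hyperbolic planes as \<open>n\<close>.
\<close>

lemma card_hyperbolic:
  assumes W: "subspace2 W" "finite W" and ef: "e \<in> W" "f \<in> W" "\<omega> e f = 1"
  shows "card W = 4 * card (perp (perp W e) f)"
proof -
  let ?W = "perp (perp W e) f" and ?A = "{0, e, f, e + f}"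
  note sub = subspace2D[OF W(1)]
  have fe: "\<omega> f e = 1" using ef by (simp add: form_commute)
  have ne: "e \<noteq> 0" "f \<noteq> 0" "e \<noteq> f"
    using ef by (metis form_zero zero_neq_one form_self)+
  have "bij_betw (\<lambda>(w, a). w + a) (?W \<times> ?A) W"
  proof (rule bij_betw_imageI)
    show "inj_on (\<lambda>(w, a). w + a) (?W \<times> ?A)"
    proof (rule inj_onI, clarify)
      fix w a w' a' assume w: "w \<in> ?W" "w' \<in> ?W" and a: "a \<in> ?A" "a' \<in> ?A" and eq: "w + a = w' + a'"
      have "\<omega> e (x + b) = \<omega> e b \<and> \<omega> f (x + b) = \<omega> f b" if "x \<in> ?W" for x b
        using that by (simp only: perp_def mem_Collect_eq form_add add_0_left)
      then have "\<omega> e a = \<omega> e a'" "\<omega> f a = \<omega> f a'" using w eq by metis+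
      then have "a = a'" using a ef fe by (auto simp: form_add)
      then show "w = w' \<and> a = a'" using eq by simp
    qed
    show "(\<lambda>(w, a). w + a) ` (?W \<times> ?A) = W"
    proof
      show "(\<lambda>(w, a). w + a) ` (?W \<times> ?A) \<subseteq> W" using ef sub by (auto simp: perp_def)
      show "W \<subseteq> (\<lambda>(w, a). w + a) ` (?W \<times> ?A)"
      proof
        fix x assume "x \<in> W"
        then obtain y a where "y \<in> ?W" "a \<in> ?A" "x = y + a" using hyperbolic_split[OF W(1) ef] by metis
        then show "x \<in> (\<lambda>(w, a). w + a) ` (?W \<times> ?A)" by force
      qed
    qed
  qed
  then have "card W = card (?W \<times> ?A)" by (rule bij_betw_same_card[symmetric])
  moreover have "card ?A = 4" using ne by (simp add: add_eq_zero_iff)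
  ultimately show ?thesis by (simp add: card_cartesian_product)
qed

lemma symplectic_basis_exists:
  assumes "finite W" "subspace2 W" "nondegenerate W"
  shows "\<exists>m e f. card W = 4 ^ m \<and> (\<forall>i\<in>{1..m}. e i \<in> W \<and> f i \<in> W)
    \<and> (\<forall>i\<in>{1..m}. \<forall>j\<in>{1..m}. \<omega> (e i) (e j) = 0 \<and> \<omega> (f i) (f j) = 0
        \<and> \<omega> (e i) (f j) = (if i = j then 1 else 0))
    \<and> (\<forall>x\<in>W. (\<forall>i\<in>{1..m}. \<omega> (e i) x = 0 \<and> \<omega> (f i) x = 0) \<longrightarrow> x = 0)"
  using assms
proof (induction "card W" arbitrary: W rule: less_induct)
  case less
  show ?case
  proof (cases "W = {0}")
    case True
    then show ?thesis by (intro exI[of _ 0]) auto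
  next
    case False
    then obtain e0 where "e0 \<in> W" "e0 \<noteq> 0" using less.prems(2) by (auto simp: subspace2_def)
    then obtain f0 where ef: "e0 \<in> W" "f0 \<in> W" "\<omega> e0 f0 = 1" using less.prems(3) by (auto simp: nondegenerate_def)
    have fe: "\<omega> f0 e0 = 1" using ef by (simp add: form_commute)
    let ?W = "perp (perp W e0) f0"
    have card: "card W = 4 * card ?W" by (rule card_hyperbolic[OF less.prems(2,1) ef])
    have "card W \<noteq> 0" using less.prems ef by auto
    then have lt: "card ?W < card W" using card by simp
    have fin: "finite ?W" using less.prems(1) by (simp add: perp_def)
    obtain m e f where m: "card ?W = 4 ^ m" and in_W: "\<forall>i\<in>{1..m}. e i \<in> ?W \<and> f i \<in> ?W"
      and forms: "\<forall>i\<in>{1..m}. \<forall>j\<in>{1..m}. \<omega> (e i) (e j) = 0 \<and> \<omega> (f i) (f j) = 0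
        \<and> \<omega> (e i) (f j) = (if i = j then 1 else 0)"
      and compl: "\<forall>x\<in>?W. (\<forall>i\<in>{1..m}. \<omega> (e i) x = 0 \<and> \<omega> (f i) x = 0) \<longrightarrow> x = 0"
      using less.hyps[OF lt fin subspace2_perp[OF subspace2_perp[OF less.prems(2)]]
          nondegenerate_perp[OF less.prems(2,3) ef]]
      by (elim exE conjE) (rule that)
    define e' where "e' i = (if i = Suc m then e0 else e i)" for i
    define f' where "f' i = (if i = Suc m then f0 else f i)" for i
    have orth: "\<omega> e0 (e i) = 0" "\<omega> f0 (e i) = 0" "\<omega> e0 (f i) = 0" "\<omega> f0 (f i) = 0"
      "\<omega> (e i) e0 = 0" "\<omega> (e i) f0 = 0" "\<omega> (f i) e0 = 0" "\<omega> (f i) f0 = 0" "e i \<in> W" "f i \<in> W"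
      if "i \<in> {1..m}" for i
      using in_W that by (auto simp: perp_def form_commute[of _ e0] form_commute[of _ f0])
    have old: "i \<in> {1..m}" if "i \<in> {1..Suc m}" "i \<noteq> Suc m" for i using that by auto
    have compl': "x = 0" if x: "x \<in> W" "\<forall>i\<in>{1..Suc m}. \<omega> (e' i) x = 0 \<and> \<omega> (f' i) x = 0" for x
    proof -
      have "\<omega> e0 x = 0" "\<omega> f0 x = 0" using x(2)[rule_format, of "Suc m"] by (simp_all add: e'_def f'_def)
      then have "x \<in> ?W" using x(1) by (simp add: perp_def)
      moreover have "\<omega> (e i) x = 0 \<and> \<omega> (f i) x = 0" if "i \<in> {1..m}" for i
        using x(2)[rule_format, of i] that by (simp add: e'_def f'_def)
      ultimately show ?thesis using compl by blast
    qed
    have card': "card W = 4 ^ Suc m" using card m by simp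
    have in_W': "e' i \<in> W \<and> f' i \<in> W" if "i \<in> {1..Suc m}" for i
      using old[OF that] orth ef by (auto simp: e'_def f'_def)
    have forms': "\<omega> (e' i) (e' j) = 0 \<and> \<omega> (f' i) (f' j) = 0 \<and> \<omega> (e' i) (f' j) = (if i = j then 1 else 0)"
      if "i \<in> {1..Suc m}" "j \<in> {1..Suc m}" for i j
      using old[OF that(1)] old[OF that(2)] orth ef forms
      by (cases "i = Suc m"; cases "j = Suc m") (simp_all add: e'_def f'_def)
    show ?thesis
      by (rule exI[of _ "Suc m"], rule exI[of _ e'], rule exI[of _ f'], intro conjI ballI impI)
        (use card' in_W' forms' compl' in simp_all)
  qed
qed

end

lemma card_span_bit:
  fixes scale :: "bit \<Rightarrow> 'v::ab_group_add \<Rightarrow> 'v"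
  assumes vs: "vector_space scale" and B: "finite B" "\<not> module.dependent scale B"
  shows "finite (module.span scale B) \<and> card (module.span scale B) = 2 ^ card B"
proof -
  interpret vector_space scale by (rule vs)
  show ?thesis
    using B
  proof (induction B)
    case empty
    then show ?case by simp
  next
    case (insert b B)
    then have ind: "independent B" "b \<notin> span B" by (auto simp: independent_insert)
    have bits: "(\<exists>k. P k) \<longleftrightarrow> P 0 \<or> P 1" for P :: "bit \<Rightarrow> bool" by (metis bit_not_zero_iff)
    have un: "span (insert b B) = span B \<union> (+) b ` span B"
      unfolding span_insert bits by (auto simp: image_iff) (metis add.commute diff_add_cancel)
    have "span B \<inter> (+) b ` span B = {}"
      using ind(2) span_diff by (auto simp: disjoint_iff) (metis add_diff_cancel_right')
    then have "card (span (insert b B)) = card (span B) + card ((+) b ` span B)"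
      unfolding un using insert.IH[OF ind(1)] by (intro card_Un_disjoint) auto
    also have "card ((+) b ` span B) = card (span B)" by (intro card_image) simp
    finally show ?case using insert un ind by simp
  qed
qed

section \<open>The isomorphism\<close>

abbreviation pres_class :: "'g set \<Rightarrow> ('g word \<times> 'g word) set \<Rightarrow> 'g word \<Rightarrow> 'g word set" where
  "pres_class X R w \<equiv> {v. pres_eq X R w v}"

lemma pres_class_eq: "pres_eq X R u v \<Longrightarrow> pres_class X R u = pres_class X R v"
  by (auto intro: pres_eq.trans pres_eq.sym)

lemma carrier_presented_group: "carrier (presented_group X R) = pres_class X R ` words X"
  by (auto simp: presented_group_def quotient_def)

text \<open>
  The left regular representation, extended by the identity outside the carrier so that the empty word
  gives the unit.
\<close>

definition regular :: "'g set \<Rightarrow> ('g word \<times> 'g word) set \<Rightarrow> 'g word \<Rightarrow> 'g word set endo" where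
  "regular X R w = Endo (\<lambda>A. if A \<in> carrier (presented_group X R)
     then pres_class X R w \<otimes>\<^bsub>presented_group X R\<^esub> A else A)"

lemma apply_regular:
  assumes "w \<in> words X"
  shows "v \<in> words X \<Longrightarrow> apply_endo (regular X R w) (pres_class X R v) = pres_class X R (w @ v)"
    and "A \<notin> carrier (presented_group X R) \<Longrightarrow> apply_endo (regular X R w) A = A"
  using assms by (auto simp: regular_def carrier_presented_group presented_group_mult)

lemma words_append [simp]: "u @ v \<in> words X \<longleftrightarrow> u \<in> words X \<and> v \<in> words X"
  and words_Nil [simp]: "[] \<in> words X"
  and words_Cons [simp]: "p # w \<in> words X \<longleftrightarrow> fst p \<in> X \<and> w \<in> words X"
  by (auto simp: words_def mem_Times_iff)

lemma regular_append:
  assumes "u \<in> words X" "v \<in> words X"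
  shows "regular X R (u @ v) = regular X R u * regular X R v"
proof (rule endo_eqI)
  fix A
  show "apply_endo (regular X R (u @ v)) A = apply_endo (regular X R u * regular X R v) A"
  proof (cases "A \<in> carrier (presented_group X R)")
    case True
    then obtain w where "w \<in> words X" "A = pres_class X R w" by (auto simp: carrier_presented_group)
    then show ?thesis using assms by (simp add: apply_regular)
  qed (use assms in \<open>simp add: apply_regular\<close>)
qed

lemma regular_Nil: "regular X R [] = 1"
proof (rule endo_eqI)
  fix A
  show "apply_endo (regular X R []) A = apply_endo 1 A"
    by (cases "A \<in> carrier (presented_group X R)")
      (auto simp: apply_regular carrier_presented_group)
qed

lemma regular_cong: "pres_eq X R u v \<Longrightarrow> regular X R u = regular X R v"
  unfolding regular_def by (drule pres_class_eq) (simp only:)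

lemma regular_eq_1:
  assumes "w \<in> words X" "regular X R w = 1"
  shows "pres_eq X R w []"
proof -
  have "pres_class X R w = pres_class X R []"
    using apply_regular(1)[OF assms(1) words_Nil, of R] unfolding assms(2) by simp
  then show ?thesis using pres_eq.refl[OF words_Nil] by auto
qed

text \<open>Formal inverses are evaluated like the letters themselves, as the generators will be involutions.\<close>

definition eval :: "('g \<Rightarrow> 'm::monoid_mult) \<Rightarrow> 'g word \<Rightarrow> 'm" where
  "eval g w = prod_list (map (\<lambda>(x, b). g x) w)"

lemma eval_simps [simp]:
  "eval g [] = 1" "eval g (p # w) = g (fst p) * eval g w" "eval g (u @ v) = eval g u * eval g v"
  by (simp_all add: eval_def split_beta)

lemma eval_positive: "eval g (positive us) = prod_list (map g us)"
  by (induction us) (simp_all add: positive_def)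

lemma eval_cong:
  assumes inv: "\<And>x. x \<in> X \<Longrightarrow> g x * g x = 1"
    and rel: "\<And>u v. (u, v) \<in> R \<Longrightarrow> eval g u = eval g v"
    and eq: "pres_eq X R u v"
  shows "eval g u = eval g v"
  using eq by induction (auto simp: inv rel)

lemma regular_eval:
  assumes inv: "\<And>x. x \<in> X \<Longrightarrow> pres_eq X R [(x, True), (x, True)] []" and w: "w \<in> words X"
  shows "regular X R w = eval (\<lambda>x. regular X R [(x, True)]) w"
  using w
proof (induction w)
  case (Cons p w)
  obtain x b where p: "p = (x, b)" by force
  have x: "x \<in> X" "[(x, b)] \<in> words X" using Cons.prems by (simp_all add: p)
  have "pres_eq X R [(x, b)] [(x, True)]"
  proof (cases b)
    case False
    have F: "[(x, False)] \<in> words X" and T: "[(x, True)] \<in> words X" using x by simp_all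
    have "pres_eq X R ([(x, False)] @ [(x, True), (x, True)]) ([(x, False)] @ [])"
      by (intro pres_eq.append pres_eq.refl[OF F] inv x)
    then have "pres_eq X R [(x, False)] ([(x, False), (x, True)] @ [(x, True)])" by (auto intro: pres_eq.sym)
    also have "pres_eq X R \<dots> ([] @ [(x, True)])"
      using pres_eq.append[OF pres_eq.cancel[OF x(1), of R False] pres_eq.refl[OF T]] by simp
    finally (pres_eq.trans) show ?thesis using False by simp
  qed (use pres_eq.refl[OF x(2)] in simp)
  then have "regular X R [p] = regular X R [(x, True)]" unfolding p by (rule regular_cong)
  then show ?case using regular_append[OF x(2), of w R] Cons by (simp add: p)
qed (simp add: regular_Nil)

context symplectic_basis begin

definition gate_word :: "gen word \<Rightarrow> 'v list" where
  "gate_word w = concat (map (\<lambda>(x, b). gate_vectors x) w)"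

lemma word_gate_word: "word t (gate_word w) = eval (\<lambda>x. word t (gate_vectors x)) w"
  by (induction w) (auto simp: gate_word_def eval_def split: prod.split)

abbreviation "rels \<equiv> map_prod positive positive ` sp_rels n"

lemma gate_involution: "x \<in> sp_gens n \<Longrightarrow> gate x * gate x = 1"
  using gate_relations[OF sp_rels.R1_H] gate_relations[OF sp_rels.SP1] gate_relations[OF sp_rels.R1_Z]
  by (auto simp: sp_gens_def wpow_unfold)

lemma eval_gate_cong: "pres_eq (sp_gens n) rels u v \<Longrightarrow> eval gate u = eval gate v"
proof (rule eval_cong[of "sp_gens n" gate rels])
  show "eval gate u = eval gate v" if "(u, v) \<in> rels" for u v
    using that gate_relations by (auto simp: eval_positive)
qed (auto simp: gate_involution)

text \<open>
  The construction, applied to the regular representation, yields a family \<open>t\<close> such that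
  \<open>regular\<close> maps \<open>w\<close> to \<open>word t (gate_word w)\<close>. By faithfulness this is trivial as soon as the gates of \<open>w\<close>
  multiply to the identity map.
\<close>

theorem eval_gate_faithful:
  assumes w: "w \<in> words (sp_gens n)" and "eval gate w = 1"
  shows "pres_eq (sp_gens n) rels w []"
proof -
  let ?X = "sp_gens n"
  define g where "g = (\<lambda>x. regular ?X rels [(x, True)])"
  have inv: "pres_eq ?X rels [(x, True), (x, True)] []" if "x \<in> ?X" for x
  proof -
    have "([x, x], []) \<in> sp_rels n"
      using that sp_rels.R1_H[of _ n] sp_rels.SP1[of _ n] sp_rels.R1_Z[of _ n]
      by (auto simp: sp_gens_def wpow_unfold)
    then have "(positive [x, x], positive []) \<in> rels" by (auto intro: rev_image_eqI)
    then show ?thesis using pres_eq.relation[of _ _ rels ?X] by (simp add: positive_def)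
  qed
  have reg: "regular ?X rels v = eval g v" if "v \<in> words ?X" for v
    unfolding g_def using regular_eval[OF inv that] .
  have rel: "prod_list (map g u) = prod_list (map g v)" if "(u, v) \<in> sp_rels n" for u v
  proof -
    have R: "(positive u, positive v) \<in> rels" using that by (auto intro: rev_image_eqI)
    then have "positive u \<in> words ?X" "positive v \<in> words ?X" using sp_rels_words[of n] by auto
    then show ?thesis using regular_cong[OF pres_eq.relation[OF R, of ?X]] reg by (simp add: eval_positive)
  qed
  interpret sp_relations \<omega> n e f "\<lambda>i. g (gP i)" "\<lambda>i. g (gH i)" "\<lambda>j. g (gZ j) * g (gP j) * g (gP (Suc j))"
    by (rule sp_relations_of_presentation[OF rel])
  obtain t where t: "transv_rep (V n) t" "\<forall>i\<in>{1..n}. t (e i) = g (gP i) \<and> t (e i + f i) = g (gH i)"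
    "\<forall>i\<in>{1..<n}. t (e i + e (Suc i)) = g (gZ i) * g (gP i) * g (gP (Suc i))"
    using transv_rep_exists[of n] by auto
  have g_t: "g x = word t (gate_vectors x)" if x: "x \<in> ?X" for x
  proof (cases x)
    case (gZ j)
    then have j: "1 \<le> j" "j < n" using x by (auto simp: sp_gens_def)
    have c: "g (gP (Suc j)) * g (gZ j) = g (gZ j) * g (gP (Suc j))" "g (gP j) * g (gZ j) = g (gZ j) * g (gP j)"
      "g (gP j) * g (gP (Suc j)) = g (gP (Suc j)) * g (gP j)"
      using rel[OF sp_rels.R6[of "Suc j" n j]] rel[OF sp_rels.R6[of j n j]] rel[OF sp_rels.R5_P[of j n "Suc j"]] j
      by simp_all
    have sq: "g (gP j) * g (gP j) = 1" "g (gP (Suc j)) * g (gP (Suc j)) = 1"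
      using p_inv[of j] p_inv[of "Suc j"] j by auto
    have "word t (gate_vectors x) = g (gP j) * (g (gP (Suc j)) * g (gZ j)) * g (gP j) * g (gP (Suc j))"
      using t j gZ by (simp add: mult.assoc)
    also have "\<dots> = (g (gP j) * g (gZ j)) * (g (gP (Suc j)) * g (gP j)) * g (gP (Suc j))"
      unfolding c(1) by (simp only: mult.assoc)
    also have "\<dots> = g (gZ j) * (g (gP j) * g (gP j)) * (g (gP (Suc j)) * g (gP (Suc j)))"
      unfolding c(2) c(3)[symmetric] by (simp only: mult.assoc)
    finally show ?thesis using sq gZ by simp
  qed (use x t in \<open>auto simp: sp_gens_def\<close>)
  have "eval g w = eval (\<lambda>x. word t (gate_vectors x)) w"
    using w by (induction w) (auto simp: g_t)
  also have "\<dots> = word t (gate_word w)" by (simp add: word_gate_word)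
  also have "\<dots> = 1"
  proof -
    have "faithful (V n) t" by (rule faithful_V[OF t(1)]) simp
    moreover have "act (gate_word w) x = x" for x
      using assms(2) word_gate_word[of transv_endo w] by (simp add: gate_def[abs_def])
    ultimately show ?thesis by (simp add: faithful_def V_n)
  qed
  finally have "regular ?X rels w = 1" using reg[OF w] by simp
  then show ?thesis by (rule regular_eq_1[OF w])
qed

text \<open>
  The vectors whose transvections are products of gates contain the generating vectors and are closed
  under transvections, hence comprise everything.
\<close>

lemma eval_gate_surj: "\<exists>w\<in>words (sp_gens n). word transv_endo us = eval gate w"
proof -
  let ?X = "sp_gens n"
  define I where "I = {u. \<exists>w\<in>words ?X. transv_endo u = eval gate w}"
  have gens: "u \<in> I" if u: "u \<in> gen_vectors n" for u
  proof -
    consider i where "i \<in> {1..n}" "u = e i" | i where "i \<in> {1..n}" "u = e i + f i"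
      | j where "j \<in> {1..<n}" "u = e j + e (Suc j)"
      using u unfolding gen_vectors_def by blast
    then show ?thesis
    proof cases
      case (1 i)
      then show ?thesis unfolding I_def
        by (intro CollectI bexI[of _ "[(gP i, True)]"]) (auto simp: gate_P_H sp_gens_def)
    next
      case (2 i)
      then show ?thesis unfolding I_def
        by (intro CollectI bexI[of _ "[(gH i, True)]"]) (auto simp: gate_P_H sp_gens_def)
    next
      case (3 j)
      have "transv_endo u = gate (gP (Suc j)) * (gate (gP j) * gate (gZ j))"
        by (rule endo_eqI) (simp add: 3 apply_gate)
      then show ?thesis using 3 unfolding I_def
        by (intro CollectI bexI[of _ "[(gP (Suc j), True), (gP j, True), (gZ j, True)]"]) (auto simp: sp_gens_def)
    qed
  qed
  have "u \<in> I" if "u \<in> transv_closure (gen_vectors n)" for u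
    using that
  proof induction
    case (step u v)
    then obtain a b where ab: "a \<in> words ?X" "transv_endo u = eval gate a" "b \<in> words ?X" "transv_endo v = eval gate b"
      by (auto simp: I_def)
    have "transv_endo (transv u v) = transv_endo u * transv_endo v * transv_endo u"
      using transv_repD(3)[OF transv_rep_endo[of UNIV]] by simp
    also have "\<dots> = eval gate (a @ b @ a)" using ab by (simp add: mult.assoc)
    finally show ?case using ab unfolding I_def by (intro CollectI bexI[of _ "a @ b @ a"]) auto
  qed (rule gens)
  moreover have "0 \<in> I"
    unfolding I_def using transv_repD(1)[OF transv_rep_endo[of UNIV]] by (intro CollectI bexI[of _ "[]"]) auto
  ultimately have I: "u \<in> I" for u using V_closure[of n] by (cases "u = 0") (auto simp: V_n)
  show ?thesis
  proof (induction us)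
    case Nil
    show ?case by (intro bexI[of _ "[]"]) auto
  next
    case (Cons u us)
    obtain a where a: "a \<in> words ?X" "transv_endo u = eval gate a" using I[of u] by (auto simp: I_def)
    obtain w where "w \<in> words ?X" "word transv_endo us = eval gate w" using Cons by auto
    then show ?case using a by (intro bexI[of _ "a @ w"]) auto
  qed
qed

end

theorem theorem6p1:
  fixes n :: nat
    and scale :: "bit \<Rightarrow> 'v \<Rightarrow> 'v::ab_group_add"
    and \<omega> :: "'v \<Rightarrow> 'v \<Rightarrow> bit"
  assumes "n \<ge> 1"
    and "vector_space scale"
    and "vector_space.dim scale UNIV = 2 * n"
    and "symplectic_form scale \<omega>"
  shows "presented_group (sp_gens n) (map_prod positive positive ` sp_rels n)
    \<cong> symplectic_group scale \<omega>"
proof -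
  interpret vector_space scale by (rule assms(2))
  have lin: "Vector_Spaces.linear scale (*) (\<lambda>y. \<omega> x y)" "Vector_Spaces.linear scale (*) (\<lambda>y. \<omega> y x)" for x
    using assms(4) by (auto simp: symplectic_form_def)
  interpret alternating_space \<omega>
  proof
    show "x + x = (0 :: 'v)" for x
      using scale_left_distrib[of 1 1 x] by simp
    show "\<omega> (x + y) z = \<omega> x z + \<omega> y z" for x y z using lin(2)[of z] by (simp add: Vector_Spaces.linear_iff)
    show "\<omega> x (y + z) = \<omega> x y + \<omega> x z" for x y z using lin(1)[of x] by (simp add: Vector_Spaces.linear_iff)
    show "\<omega> x x = 0" for x using assms(4) by (simp add: symplectic_form_def)
  qed
  have nd: "nondegenerate UNIV"
    unfolding nondegenerate_def using assms(4) by (auto simp: symplectic_form_def) (metis bit_not_zero_iff)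
  obtain B where B: "independent B" "UNIV \<subseteq> span B" "card B = 2 * n"
    using basis_exists[of UNIV] assms(3) by metis
  have "finite B" using B(3) assms(1) by (intro card_ge_0_finite) simp
  then have card: "finite (UNIV :: 'v set)" "card (UNIV :: 'v set) = 2 ^ (2 * n)"
    using card_span_bit[OF assms(2) _ B(1)] B(2,3) by (simp_all add: top.extremum_unique)
  have UNIV: "subspace2 UNIV" by (simp add: subspace2_def)
  obtain m e f where m: "card (UNIV :: 'v set) = 4 ^ m"
    and basis: "\<forall>i\<in>{1..m}. \<forall>j\<in>{1..m}. \<omega> (e i) (e j) = 0 \<and> \<omega> (f i) (f j) = 0
        \<and> \<omega> (e i) (f j) = (if i = j then 1 else 0)"
      "\<forall>x\<in>UNIV. (\<forall>i\<in>{1..m}. \<omega> (e i) x = 0 \<and> \<omega> (f i) x = 0) \<longrightarrow> x = 0"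
    using symplectic_basis_exists[OF card(1) UNIV nd] by (elim exE conjE) (rule that)
  (* comparing cardinalities, the basis consists of n hyperbolic planes *)
  have "(4 :: nat) ^ m = 4 ^ n" using m card(2) by (simp add: power_mult)
  then have "m = n" by simp
  interpret symplectic_basis \<omega> n e f
    by unfold_locales (use basis in \<open>auto simp: \<open>m = n\<close>\<close>)
  let ?X = "sp_gens n"
  let ?G = "presented_group ?X rels" and ?S = "symplectic_group scale \<omega>"
  have bits: "c = 0 \<or> c = 1" for c :: bit by auto
  have linear: "Vector_Spaces.linear scale scale F" if "\<And>x y. F (x + y) = F x + F y" for F
  proof -
    have "F 0 = 0" using that[of 0 0] by simp
    then have "F (scale c x) = scale c (F x)" for c x using bits[of c] by auto
    then show ?thesis using that assms(2) by (simp add: Vector_Spaces.linear_iff)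
  qed
  have act_S: "act us \<in> carrier ?S" for us
    by (auto simp: symplectic_group_def act_add intro!: linear o_bij[of "act (rev us)"])
  define \<phi> where "\<phi> A = the_elem ((\<lambda>w. apply_endo (eval gate w)) ` A)" for A
  have \<phi>: "\<phi> (pres_class ?X rels w) = apply_endo (eval gate w)" if "w \<in> words ?X" for w
  proof -
    have w: "w \<in> pres_class ?X rels w" using pres_eq.refl[OF that] by simp
    have "eval gate v = eval gate w" if "v \<in> pres_class ?X rels w" for v
      using eval_gate_cong[of w v] that by simp
    then have "(\<lambda>v. apply_endo (eval gate v)) ` pres_class ?X rels w
        = (\<lambda>v. apply_endo (eval gate w)) ` pres_class ?X rels w"
      by (intro image_cong) (simp_all only:)
    then show ?thesis unfolding \<phi>_def image_constant[OF w] by (simp only: the_elem_eq)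
  qed
  have eval_S: "apply_endo (eval gate w) \<in> carrier ?S" for w
    using act_S[of "gate_word w"] by (simp add: word_gate_word gate_def[abs_def])
  have "\<phi> \<in> iso ?G ?S"
    unfolding iso_def
  proof (intro CollectI conjI)
    show "\<phi> \<in> hom ?G ?S"
    proof (rule homI)
      show "\<phi> A \<in> carrier ?S" if "A \<in> carrier ?G" for A
        using that eval_S by (auto simp: carrier_presented_group \<phi>)
      show "\<phi> (A \<otimes>\<^bsub>?G\<^esub> B) = \<phi> A \<otimes>\<^bsub>?S\<^esub> \<phi> B" if "A \<in> carrier ?G" "B \<in> carrier ?G" for A B
      proof -
        obtain u v where uv: "u \<in> words ?X" "A = pres_class ?X rels u" "v \<in> words ?X" "B = pres_class ?X rels v"
          using \<open>A \<in> carrier ?G\<close> \<open>B \<in> carrier ?G\<close> by (auto simp: carrier_presented_group)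
        have "\<phi> (A \<otimes>\<^bsub>?G\<^esub> B) = apply_endo (eval gate u * eval gate v)"
          using uv \<phi>[of "u @ v"] by (simp add: presented_group_mult)
        then show ?thesis using uv by (auto simp: \<phi> symplectic_group_def)
      qed
    qed
    show "bij_betw \<phi> (carrier ?G) (carrier ?S)"
    proof (rule bij_betw_imageI)
      show "inj_on \<phi> (carrier ?G)"
      proof (rule inj_onI)
        fix A B assume "A \<in> carrier ?G" "B \<in> carrier ?G" and eq: "\<phi> A = \<phi> B"
        then obtain u v where uv: "u \<in> words ?X" "A = pres_class ?X rels u" "v \<in> words ?X" "B = pres_class ?X rels v"
          by (auto simp: carrier_presented_group)
        let ?i = "map (\<lambda>(x, b). (x, \<not> b)) (rev u)"
        have i: "?i \<in> words ?X" using uv(1) by (auto simp: words_def)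
        have inv: "pres_eq ?X rels (?i @ u) []" by (rule pres_eq_inverse[OF uv(1)])
        have "apply_endo (eval gate u) = apply_endo (eval gate v)" using eq uv by (simp add: \<phi>)
        then have "eval gate u = eval gate v" by (simp add: apply_endo_inject)
        then have "eval gate (?i @ v) = eval gate (?i @ u)" by simp
        also have "\<dots> = 1" using eval_gate_cong[OF inv] by simp
        finally have iv: "pres_eq ?X rels (?i @ v) []" using i uv by (intro eval_gate_faithful) auto
        have ui: "pres_eq ?X rels (u @ ?i) []"
          using pres_eq_inverse[OF i, of rels] by (simp add: rev_map o_def split_beta)
        have "pres_eq ?X rels (u @ (?i @ v)) (u @ [])"
          by (rule pres_eq.append[OF pres_eq.refl[OF uv(1)] iv])
        moreover have "pres_eq ?X rels ((u @ ?i) @ v) ([] @ v)"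
          by (rule pres_eq.append[OF ui pres_eq.refl[OF uv(3)]])
        ultimately have "pres_eq ?X rels u v"
          using pres_eq.trans[OF pres_eq.sym] by simp
        then show "A = B" using pres_class_eq uv by simp
      qed
      show "\<phi> ` carrier ?G = carrier ?S"
      proof
        show "\<phi> ` carrier ?G \<subseteq> carrier ?S" using eval_S by (auto simp: carrier_presented_group \<phi>)
        show "carrier ?S \<subseteq> \<phi> ` carrier ?G"
        proof
          fix F assume "F \<in> carrier ?S"
          then have F: "F (x + y) = F x + F y" "\<omega> (F x) (F y) = \<omega> x y" for x y
            by (auto simp: symplectic_group_def Vector_Spaces.linear_iff)
          have "isometries_generated (V n)" by (rule isometries_generated_V) simp
          then obtain us where "\<forall>x. F x = act us x"
            using F unfolding isometries_generated_def V_n by blast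
          then have us: "F = act us" by auto
          obtain w where w: "w \<in> words ?X" "word transv_endo us = eval gate w" using eval_gate_surj by blast
          then have "F = \<phi> (pres_class ?X rels w)" using us by (simp add: \<phi>)
          then show "F \<in> \<phi> ` carrier ?G" using w(1) by (auto simp: carrier_presented_group)
        qed
      qed
    qed
  qed
  then show ?thesis unfolding is_iso_def by blast
qed

end
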